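(* Let $n\in\mathbb N\setminus\{1\}$. There exist a polynomial $Q_3$ of degree $2^n-2$ and $\mu_3>0$ such that $$U_n(x):=\sum_{\substack{1\le m_1,\dots,m_n\le x\\ \gcd(m_1,\dots,m_n)=1}}\frac1{\operatorname{lcm}(m_1,\dots,m_n)}=Q_3(\ln x)+O(x^{-\mu_3})\quad\text{as }x\to\infty.$$ In particular, $$U_n(x)=C_n(u_n)\,K_n(u_n,\|\cdot\|_\infty)\,(\ln x)^{2^n-2}+O\big((\ln x)^{2^n-3}\big)\quad\text{as }x\to\infty,$$ where $$C_n(u_n):=\prod_p\Big(1-\frac1p\Big)^{2^n-1}\Big(\sum_{k=0}^\infty\frac{(k+1)^n-k^n}{p^k}\Big)>0$$ (product over primes $p$) and $$K_n(u_n,\|\cdot\|_\infty):=\lim_{x\to\infty}\mathcal I_n(I,\mathbf u,\mathbf c;x)\,(\ln x)^{-2^n+2}>0,$$ where $\mathcal I_n(I,\mathbf u,\mathbf c;x)$ is the integral associated with $I=\{0,1\}^n\setminus\{\mathbf 0,\mathbf 1\}$, the sequence $\mathbf u=(u(\boldsymbol\nu))_{\boldsymbol\nu\in I}$ defined by $u(\boldsymbol\nu)=1$ for all $\boldsymbol\nu\in I$, and the vector $\mathbf c=\mathbf 0$.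
   Context: $\mathbb N=\{1,2,\dots\}$, $\mathbb N_0=\mathbb N\cup\{0\}$; $\langle\cdot,\cdot\rangle$ is the standard inner product, $(\mathbf e_1,\dots,\mathbf e_n)$ the canonical basis of $\mathbb R^n$, $\mathbf 0=(0,\dots,0)$, $\mathbf 1=(1,\dots,1)$. Here $u_n$ denotes the function equal to $1/\operatorname{lcm}(m_1,\dots,m_n)$ if $\gcd(m_1,\dots,m_n)=1$ and $0$ otherwise (it only serves as a label in $C_n(u_n)$ and $K_n(u_n,\|\cdot\|_\infty)$). The integral $\mathcal I_n$: let $I$ be a finite subset of $\mathbb N_0^n\setminus\{\mathbf 0\}$ with elements $\boldsymbol\nu^1,\dots,\boldsymbol\nu^r$ ($r=\#I$), $\mathbf u=(u(\boldsymbol\nu))_{\boldsymbol\nu\in I}$ positive integers, $\mathbf c\in[0,\infty)^n$. Put $q_0=0$ and $q_k=\sum_{j=1}^k u(\boldsymbol\nu^j)$ for $1\le k\le r$. For $x>0$, $$\mathcal I_n(I,\mathbf u,\mathbf c;x):=\int_{\mathcal A(I,\mathbf u;x)}\frac{dy_1\cdots dy_{q_r}}{\prod_{k=1}^r\prod_{\ell=q_{k-1}+1}^{q_k}y_\ell^{1-\langle\boldsymbol\nu^k,\mathbf c\rangle}},$$ where $\mathcal A(I,\mathbf u;x):=\{\mathbf y\in[1,\infty)^{q_r}:\ \prod_{k=1}^r\prod_{\ell=q_{k-1}+1}^{q_k}y_\ell^{\langle\boldsymbol\nu^k,\mathbf e_j\rangle}\le x\ \ \forall j=1,\dots,n\}$.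 *)

theory Defs
  imports
    "HOL-Analysis.Analysis"
    "HOL-Computational_Algebra.Primes"
    "HOL-Computational_Algebra.Polynomial"
    "HOL-Library.Landau_Symbols"
begin

text \<open>
  An \<open>n\<close>-tuple with entries in \<open>S\<close> is an element of the extensional function space
  \<open>{1..n} \<rightarrow>\<^sub>E S\<close>, so that distinct elements represent distinct tuples.
\<close>

definition U :: "nat \<Rightarrow> real \<Rightarrow> real" where
  "U n x = (\<Sum>m | m \<in> {1..n} \<rightarrow>\<^sub>E {k::nat. 1 \<le> k \<and> real k \<le> x} \<and> Gcd (m ` {1..n}) = 1.
              1 / real (Lcm (m ` {1..n})))"

definition inner_n :: "nat \<Rightarrow> (nat \<Rightarrow> nat) \<Rightarrow> (nat \<Rightarrow> real) \<Rightarrow> real" where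
  "inner_n n \<nu> c = (\<Sum>i\<in>{1..n}. real (\<nu> i) * c i)"

text \<open>
  The integral has one integration variable for each \<open>\<nu> \<in> I\<close> and each of its \<open>u \<nu>\<close> copies.
  Instead of numbering these variables consecutively, block by block along some enumeration of
  \<open>I\<close>, we index them by the pairs \<open>(\<nu>, l)\<close> with \<open>1 \<le> l \<le> u \<nu>\<close>; no enumeration of \<open>I\<close> has to be
  chosen. The exponent \<open>\<nu> j\<close> in the domain is the inner product of \<open>\<nu>\<close> with the
  \<open>j\<close>-th canonical basis vector.
\<close>

definition int_vars :: "(nat \<Rightarrow> nat) set \<Rightarrow> ((nat \<Rightarrow> nat) \<Rightarrow> nat) \<Rightarrow> ((nat \<Rightarrow> nat) \<times> nat) set" where
  "int_vars I u = (SIGMA \<nu>:I. {1..u \<nu>})"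

definition int_domain ::
  "nat \<Rightarrow> (nat \<Rightarrow> nat) set \<Rightarrow> ((nat \<Rightarrow> nat) \<Rightarrow> nat) \<Rightarrow> real \<Rightarrow> ((nat \<Rightarrow> nat) \<times> nat \<Rightarrow> real) set" where
  "int_domain n I u x =
     {y \<in> int_vars I u \<rightarrow>\<^sub>E {1..}. \<forall>j\<in>{1..n}. (\<Prod>\<nu>\<in>I. \<Prod>l\<in>{1..u \<nu>}. y (\<nu>, l) ^ \<nu> j) \<le> x}"

definition int_I ::
  "nat \<Rightarrow> (nat \<Rightarrow> nat) set \<Rightarrow> ((nat \<Rightarrow> nat) \<Rightarrow> nat) \<Rightarrow> (nat \<Rightarrow> real) \<Rightarrow> real \<Rightarrow> real" where
  "int_I n I u c x =
     (LINT y : int_domain n I u x | Pi\<^sub>M (int_vars I u) (\<lambda>_. lborel).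
        1 / (\<Prod>\<nu>\<in>I. \<Prod>l\<in>{1..u \<nu>}. y (\<nu>, l) powr (1 - inner_n n \<nu> c)))"

definition cube_I :: "nat \<Rightarrow> (nat \<Rightarrow> nat) set" where
  "cube_I n = ({1..n} \<rightarrow>\<^sub>E {0, 1}) - {\<lambda>i\<in>{1..n}. 0, \<lambda>i\<in>{1..n}. 1}"

definition local_term :: "nat \<Rightarrow> nat \<Rightarrow> nat \<Rightarrow> real" where
  "local_term n p k = ((real k + 1) ^ n - real k ^ n) / real p ^ k"

text \<open>The product over the primes is an infinite product over \<open>nat\<close> with factor 1 at non-primes.\<close>

definition euler_factor :: "nat \<Rightarrow> nat \<Rightarrow> real" where
  "euler_factor n p =
     (if prime p then (1 - 1 / real p) ^ (2 ^ n - 1) * (\<Sum>k. local_term n p k) else 1)"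

definition C_const :: "nat \<Rightarrow> real" where
  "C_const n = prodinf (euler_factor n)"

definition K_quot :: "nat \<Rightarrow> real \<Rightarrow> real" where
  "K_quot n x = int_I n (cube_I n) (\<lambda>_. 1) (\<lambda>_. 0) x * ln x powi (- (2 ^ n) + 2)"

definition K_const :: "nat \<Rightarrow> real" where
  "K_const n = Lim at_top (K_quot n)"

end

theory Submission
  imports Defs
begin

text \<open>
  A tuple \<open>m\<close> with greatest common divisor 1 factors uniquely as \<open>m j = (\<Prod>S \<ni> j. d S)\<close> over the proper nonempty
  \<open>S \<subseteq> {1..n}\<close>, where \<open>d S\<close> and \<open>d T\<close> are coprime for incomparable \<open>S\<close>, \<open>T\<close>; its least common multiple is
  then \<open>\<Prod>S. d S\<close>. Moebius inversion of the coprimality condition writes \<open>U n x\<close> as an absolutely convergent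
  combination of sums of \<open>\<Prod>S. 1 / d S\<close> over \<open>(\<Prod>S \<ni> j. d S) \<le> x / e j\<close>, and the local factors of the total
  weight are those of \<open>C_const\<close>.

  To evaluate such a sum for \<open>ln x \<in> [k, 2 k]\<close>, replace each harmonic sum over \<open>d \<ge> D\<close> by an integral, where \<open>D\<close> is
  about \<open>exp (\<epsilon> k)\<close>. By monotonicity the error is exponentially small in \<open>k\<close>. What remains is a finite
  combination of shifted polytope volumes, which are piecewise polynomial and, because all shifts are
  at most \<open>O(\<epsilon> k)\<close>, polynomial in \<open>ln x\<close> on the whole range. Polynomials of bounded degree that approximate
  the same function on overlapping ranges with exponentially small error converge to a single one.
  Its leading coefficient is found by comparing the sums with the volume of the unit polytope, which is \<open>K_const\<close>.
\<close>

section \<open>Harmonic sums and integrals of monotone functions\<close>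

text \<open>Using integrals from the start (\<open>D = 1\<close>) leaves an error only one power of
  \<open>ln x\<close> below the main term, enough for the leading coefficient and nothing more. A
  power saving in \<open>x\<close> forces \<open>D\<close> to grow exponentially in
  \<open>k\<close>, so the polynomial found on one range depends on \<open>k\<close>; hence the
  gluing. Two demands on \<open>D\<close> conflict: the error is of order \<open>1 / D\<close>, but
  the terms \<open>d < D\<close> shift the polytopes by \<open>ln d\<close>, and polynomiality holds
  only while all shifts stay below a fixed fraction of \<open>ln x\<close>. Taking
  \<open>ln D\<close> near a small multiple of \<open>k\<close> meets both. It can, because every
  cutting hyperplane passes through the origin: the side on which a shifted diagonal point lies is
  settled once \<open>ln x\<close> exceeds a constant times the shift. Moebius inversion produces
  further shifts, which are unbounded; terms shifting too far are discarded at exponentially small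
  cost, since the weights stay absolutely summable against the exponential of a quarter of
  \<open>face_weight\<close>. Monotonicity is the invariant of the iteration: each operator
  preserves it, and it alone gives the comparison of sum and integral.\<close>

definition shift :: "nat set \<Rightarrow> real \<Rightarrow> (nat \<Rightarrow> real) \<Rightarrow> nat \<Rightarrow> real" where
  "shift S s L = (\<lambda>j. if j \<in> S then L j - s else L j)"

text \<open>
  The coordinates \<open>L j\<close> are logarithms of the bounds on the \<open>m j\<close>; a summation variable \<open>d\<close> that
  divides the \<open>m j\<close> with \<open>j \<in> S\<close> lowers the coordinates in \<open>S\<close> by \<open>ln d\<close>.
\<close>

definition orthant_mono :: "nat \<Rightarrow> ((nat \<Rightarrow> real) \<Rightarrow> real) \<Rightarrow> bool" where
  "orthant_mono n f \<longleftrightarrow> (\<forall>L. 0 \<le> f L) \<and>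
     (\<forall>L L'. (\<forall>j\<in>{1..n}. L j \<le> L' j) \<longrightarrow> f L \<le> f L') \<and>
     (\<forall>L. \<forall>j\<in>{1..n}. L j < 0 \<longrightarrow> f L = 0)"

definition orthant :: "nat \<Rightarrow> (nat \<Rightarrow> real) \<Rightarrow> real" where
  "orthant n L = of_bool (\<forall>j\<in>{1..n}. 0 \<le> L j)"

definition face :: "nat \<Rightarrow> nat set \<Rightarrow> bool" where
  "face n S \<longleftrightarrow> S \<subseteq> {1..n} \<and> S \<noteq> {}"

definition sum_op :: "nat \<Rightarrow> nat set \<Rightarrow> ((nat \<Rightarrow> real) \<Rightarrow> real) \<Rightarrow> (nat \<Rightarrow> real) \<Rightarrow> real" where
  "sum_op N S f L = (\<Sum>d=1..N. f (shift S (ln (real d)) L) / real d)"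

text \<open>The variable \<open>s\<close> is the logarithm of a continuous summation variable
  \<open>t\<close>: the measure \<open>dt / t\<close> on \<open>t >= 1\<close> becomes
  \<open>ds\<close> on \<open>s >= 0\<close>.\<close>

definition int_op :: "nat set \<Rightarrow> ((nat \<Rightarrow> real) \<Rightarrow> real) \<Rightarrow> (nat \<Rightarrow> real) \<Rightarrow> real" where
  "int_op S f L = (LINT s:{0..}|lborel. f (shift S s L))"

text \<open>
  \<open>mixed_op D\<close> replaces only the tail of the harmonic sum by an integral. For monotone \<open>f\<close> this costs
  at most \<open>f L / D\<close>, and for bounded \<open>ln D\<close> the result is still a piecewise polynomial.
\<close>

definition mixed_op :: "nat \<Rightarrow> nat set \<Rightarrow> ((nat \<Rightarrow> real) \<Rightarrow> real) \<Rightarrow> (nat \<Rightarrow> real) \<Rightarrow> real" where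
  "mixed_op D S f L = (\<Sum>d=1..<D. f (shift S (ln (real d)) L) / real d) + int_op S f (shift S (ln (real D)) L)"

lemma set_integral_zero:
  fixes h :: "real \<Rightarrow> real"
  assumes "\<And>s. s \<in> A \<Longrightarrow> h s = 0"
  shows "(LINT s:A|M. h s) = 0"
proof -
  have "(\<lambda>s. indicator A s *\<^sub>R h s) = (\<lambda>_. 0)" using assms by (auto simp: indicator_def)
  thus ?thesis by (simp add: set_lebesgue_integral_def)
qed

lemma orthant_mono_nonneg: "orthant_mono n f \<Longrightarrow> 0 \<le> f L"
  and orthant_mono_mono: "orthant_mono n f \<Longrightarrow> (\<And>j. j \<in> {1..n} \<Longrightarrow> L j \<le> L' j) \<Longrightarrow> f L \<le> f L'"
  and orthant_mono_zero: "orthant_mono n f \<Longrightarrow> j \<in> {1..n} \<Longrightarrow> L j < 0 \<Longrightarrow> f L = 0"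
  unfolding orthant_mono_def by blast+

lemma orthant_mono_orthant: "orthant_mono n (orthant n)"
  unfolding orthant_mono_def orthant_def by (fastforce simp: not_le intro: order_trans)

lemma shift_shift: "shift S s (shift S a L) = shift S (a + s) L"
  by (auto simp: shift_def)

lemma shift_0 [simp]: "shift S 0 L = L"
  by (auto simp: shift_def)

lemma ray_antimono:
  assumes "orthant_mono n f" "s \<le> t"
  shows "f (shift S t L) \<le> f (shift S s L)"
  using assms(2) by (intro orthant_mono_mono[OF assms(1)]) (auto simp: shift_def)

lemma ray_zero:
  assumes "orthant_mono n f" "face n S" "\<forall>j\<in>{1..n}. L j \<le> B" "B < s"
  shows "f (shift S s L) = 0"
proof -
  obtain j where j: "j \<in> S" "j \<in> {1..n}" using assms(2) unfolding face_def by blast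
  show ?thesis
    using j assms(3)[rule_format, of j] assms(4) by (intro orthant_mono_zero[OF assms(1), of j]) (auto simp: shift_def)
qed

lemma ray_measurable:
  assumes "orthant_mono n f"
  shows "(\<lambda>s. f (shift S s L)) \<in> borel_measurable borel"
proof -
  have "mono (\<lambda>s. - f (shift S s L))"
    using ray_antimono[OF assms] by (auto simp: mono_def)
  hence "(\<lambda>s. - f (shift S s L)) \<in> borel_measurable borel"
    by (rule borel_measurable_mono)
  thus ?thesis by simp
qed

lemma ray_integrable:
  assumes f: "orthant_mono n f" and S: "face n S"
  shows "set_integrable lborel {a..} (\<lambda>s. f (shift S s L))"
proof -
  \<comment> \<open>Beyond all coordinates of \<open>L\<close> the ray is zero, and up to there it
    is bounded by its value at \<open>a\<close>.\<close>
  define B where "B = max a (Max (insert 0 (L ` {1..n})))"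
  have B: "\<forall>j\<in>{1..n}. L j \<le> B"
    by (auto simp: B_def le_max_iff_disj intro!: Max_ge)
  have "set_integrable lborel {a..B} (\<lambda>s. f (shift S a L))"
    unfolding set_integrable_def by (intro integrable_scaleR_left integrable_real_indicator) (auto simp: emeasure_lborel_Icc_eq)
  hence "set_integrable lborel {a..B} (\<lambda>s. f (shift S s L))"
    unfolding set_integrable_def
    by (rule Bochner_Integration.integrable_bound)
       (use ray_measurable[OF f] ray_antimono[OF f] orthant_mono_nonneg[OF f] in
         \<open>auto intro!: borel_measurable_times borel_measurable_indicator simp: indicator_def\<close>)
  moreover have "indicator {a..B} s *\<^sub>R f (shift S s L) = indicator {a..} s *\<^sub>R f (shift S s L)" for s
    using ray_zero[OF f S B, of s] by (auto simp: indicator_def)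
  ultimately show ?thesis
    unfolding set_integrable_def by (simp only:)
qed

lemma int_op_shift: "int_op S f (shift S a L) = (LINT s:{a..}|lborel. f (shift S s L))"
proof -
  have "(LINT s:{a..}|lborel. f (shift S s L)) =
        (LINT s|lborel. indicator {a..} (a + 1 * s) *\<^sub>R f (shift S (a + 1 * s) L))"
    unfolding set_lebesgue_integral_def by (subst lborel_integral_real_affine[where c = 1 and t = a]) auto
  also have "\<dots> = int_op S f (shift S a L)"
    unfolding int_op_def set_lebesgue_integral_def shift_shift
    by (intro Bochner_Integration.integral_cong) (auto simp: indicator_def)
  finally show ?thesis by simp
qed

text \<open>The difference is the integral of an antitone function over \<open>[a, b)\<close>,
  bounded by its two endpoint values.\<close>

lemma int_op_step:
  assumes f: "orthant_mono n f" and S: "face n S" and ab: "a \<le> b"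
  shows "int_op S f (shift S a L) - int_op S f (shift S b L) \<le> f (shift S a L) * (b - a)"
    and "int_op S f (shift S a L) - int_op S f (shift S b L) \<ge> f (shift S b L) * (b - a)"
proof -
  let ?h = "\<lambda>s. f (shift S s L)"
  have i: "set_integrable lborel {a..<b} ?h"
    by (rule set_integrable_subset[OF ray_integrable[OF f S, of a]]) auto
  have "{a..} = {a..<b} \<union> {b..}" using ab by auto
  hence "(LINT s:{a..}|lborel. ?h s) = (LINT s:{a..<b}|lborel. ?h s) + (LINT s:{b..}|lborel. ?h s)"
    using set_integral_Un[OF _ i ray_integrable[OF f S, of b]] by (simp add: disjoint_iff)
  hence e: "int_op S f (shift S a L) - int_op S f (shift S b L) = (LINT s:{a..<b}|lborel. ?h s)"
    unfolding int_op_shift by simp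
  have c: "(LINT s:{a..<b}|lborel. c) = c * (b - a)" "set_integrable lborel {a..<b} (\<lambda>_. c)" for c :: real
    using ab by (simp_all add: set_lebesgue_integral_def set_integrable_def integrable_real_indicator)
  show "int_op S f (shift S a L) - int_op S f (shift S b L) \<le> f (shift S a L) * (b - a)"
    unfolding e c(1)[symmetric]
    by (rule set_integral_mono[OF i c(2)]) (auto intro: ray_antimono[OF f])
  show "int_op S f (shift S a L) - int_op S f (shift S b L) \<ge> f (shift S b L) * (b - a)"
    unfolding e c(1)[symmetric]
    by (rule set_integral_mono[OF c(2) i]) (auto intro: ray_antimono[OF f])
qed

lemma int_op_mono:
  assumes f: "orthant_mono n f" and g: "orthant_mono n g" and S: "face n S"
    and "\<And>s. 0 \<le> s \<Longrightarrow> f (shift S s L) \<le> g (shift S s L')"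
  shows "int_op S f L \<le> int_op S g L'"
  unfolding int_op_def
  by (rule set_integral_mono[OF ray_integrable[OF f S] ray_integrable[OF g S]]) (use assms(4) in auto)

lemma int_op_nonneg:
  assumes f: "orthant_mono n f"
  shows "0 \<le> int_op S f L"
  unfolding int_op_def set_lebesgue_integral_def
  by (rule Bochner_Integration.integral_nonneg) (auto simp: orthant_mono_nonneg[OF f])

lemma orthant_mono_int_op:
  assumes f: "orthant_mono n f" and S: "face n S"
  shows "orthant_mono n (int_op S f)"
  unfolding orthant_mono_def
proof (intro conjI allI impI ballI)
  show "0 \<le> int_op S f L" for L by (rule int_op_nonneg[OF f])
  show "int_op S f L \<le> int_op S f L'" if "\<forall>j\<in>{1..n}. L j \<le> L' j" for L L'
    using that by (intro int_op_mono[OF f f S] orthant_mono_mono[OF f]) (auto simp: shift_def)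
  show "int_op S f L = 0" if j: "j \<in> {1..n}" "L j < 0" for L j
  proof -
    have "f (shift S s L) = 0" if "0 \<le> s" for s
      using j that by (intro orthant_mono_zero[OF f, of j]) (auto simp: shift_def)
    thus ?thesis unfolding int_op_def by (intro set_integral_zero) auto
  qed
qed

lemma orthant_mono_ray:
  assumes f: "orthant_mono n f" and "0 \<le> a"
  shows "orthant_mono n (\<lambda>L. f (shift S a L))"
  unfolding orthant_mono_def
proof (intro conjI allI impI ballI)
  show "0 \<le> f (shift S a L)" for L by (rule orthant_mono_nonneg[OF f])
  show "f (shift S a L) \<le> f (shift S a L')" if "\<forall>j\<in>{1..n}. L j \<le> L' j" for L L'
    using that by (intro orthant_mono_mono[OF f]) (auto simp: shift_def)
  show "f (shift S a L) = 0" if "j \<in> {1..n}" "L j < 0" for L j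
    using that assms(2) by (intro orthant_mono_zero[OF f, of j]) (auto simp: shift_def)
qed

lemma orthant_mono_add: "orthant_mono n f \<Longrightarrow> orthant_mono n g \<Longrightarrow> orthant_mono n (\<lambda>L. f L + g L)"
  unfolding orthant_mono_def by (simp add: add_mono)

lemma orthant_mono_cmult: "orthant_mono n f \<Longrightarrow> 0 \<le> c \<Longrightarrow> orthant_mono n (\<lambda>L. c * f L)"
  unfolding orthant_mono_def by (auto intro!: mult_left_mono)

lemma orthant_mono_sum:
  assumes "finite X" "\<And>x. x \<in> X \<Longrightarrow> orthant_mono n (f x)"
  shows "orthant_mono n (\<lambda>L. \<Sum>x\<in>X. f x L)"
  using assms
proof (induction rule: finite_induct)
  case empty
  then show ?case by (simp add: orthant_mono_def)
next
  case (insert x F)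
  then show ?case by (simp add: orthant_mono_add)
qed

lemma orthant_mono_sum_op:
  assumes f: "orthant_mono n f"
  shows "orthant_mono n (sum_op N S f)"
  unfolding sum_op_def
  by (intro orthant_mono_sum)
    (use orthant_mono_cmult[OF orthant_mono_ray[OF f], of "ln (real d)" "1 / real d" S for d] in auto)

lemma orthant_mono_mixed_op:
  assumes f: "orthant_mono n f" and S: "face n S" and "1 \<le> D"
  shows "orthant_mono n (mixed_op D S f)"
proof -
  have "orthant_mono n (\<lambda>L. \<Sum>d=1..<D. f (shift S (ln (real d)) L) / real d)"
    by (intro orthant_mono_sum)
      (use orthant_mono_cmult[OF orthant_mono_ray[OF f], of "ln (real d)" "1 / real d" S for d] in auto)
  thus ?thesis
    unfolding mixed_op_def using assms(3)
    by (auto intro!: orthant_mono_add orthant_mono_ray orthant_mono_int_op[OF f S])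
qed

lemma mixed_op_1: "mixed_op 1 S f = int_op S f"
  by (auto simp: mixed_op_def)

text \<open>Passing from \<open>D\<close> to \<open>D + 1\<close> trades the integral over
  \<open>[ln D, ln (D + 1))\<close> for the term \<open>d = D\<close>. The length of this interval
  lies between \<open>1 / (D + 1)\<close> and \<open>1 / D\<close>; the lower bound makes the error
  a difference of consecutive terms, which telescopes.\<close>

lemma mixed_op_step:
  assumes f: "orthant_mono n f" and S: "face n S" and D: "1 \<le> D"
  shows "mixed_op D S f L \<le> mixed_op (Suc D) S f L"
    and "mixed_op (Suc D) S f L - mixed_op D S f L
         \<le> f (shift S (ln (real D)) L) / real D - f (shift S (ln (real (Suc D))) L) / real (Suc D)"
proof -
  let ?h = "\<lambda>d. f (shift S (ln (real d)) L)"
  let ?l = "ln (real (Suc D)) - ln (real D)"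
  have l: "ln (real D) \<le> ln (real (Suc D))" using D by simp
  have e: "mixed_op (Suc D) S f L - mixed_op D S f L =
     ?h D / real D - (int_op S f (shift S (ln (real D)) L) - int_op S f (shift S (ln (real (Suc D))) L))"
    using D by (simp add: mixed_op_def sum.atLeastLessThan_Suc)
  have l1: "?l \<le> 1 / real D"
    using D ln_add_one_self_le_self2[of "1 / real D"]
    by (simp add: add_divide_distrib[symmetric] ln_div field_simps)
  have "ln (real D / real (Suc D)) \<le> real D / real (Suc D) - 1"
    using D by (intro ln_le_minus_one) auto
  hence l2: "1 / real (Suc D) \<le> ?l"
    using D by (simp add: ln_div field_simps)
  have "?h D * ?l \<le> ?h D * (1 / real D)"
    by (rule mult_left_mono[OF l1 orthant_mono_nonneg[OF f]])
  thus "mixed_op D S f L \<le> mixed_op (Suc D) S f L"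
    using e int_op_step(1)[OF f S l, of L] by simp
  have "?h (Suc D) * (1 / real (Suc D)) \<le> ?h (Suc D) * ?l"
    by (rule mult_left_mono[OF l2 orthant_mono_nonneg[OF f]])
  thus "mixed_op (Suc D) S f L - mixed_op D S f L \<le> ?h D / real D - ?h (Suc D) / real (Suc D)"
    using e int_op_step(2)[OF f S l, of L] by simp
qed

lemma mixed_op_diff:
  assumes f: "orthant_mono n f" and S: "face n S" and D: "1 \<le> D" and "D \<le> M"
  shows "mixed_op D S f L \<le> mixed_op M S f L"
    and "mixed_op M S f L - mixed_op D S f L
         \<le> f (shift S (ln (real D)) L) / real D - f (shift S (ln (real M)) L) / real M"
proof -
  have "mixed_op D S f L \<le> mixed_op M S f L \<and> mixed_op M S f L - mixed_op D S f L
         \<le> f (shift S (ln (real D)) L) / real D - f (shift S (ln (real M)) L) / real M"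
    using \<open>D \<le> M\<close>
  proof (induction M rule: dec_induct)
    case base
    then show ?case by simp
  next
    case (step M)
    then show ?case using mixed_op_step[OF f S, of M L] D by linarith
  qed
  thus "mixed_op D S f L \<le> mixed_op M S f L"
    "mixed_op M S f L - mixed_op D S f L
         \<le> f (shift S (ln (real D)) L) / real D - f (shift S (ln (real M)) L) / real M" by auto
qed

text \<open>The truncated sum is itself a mixed operator: past \<open>ln (N + 1)\<close> the tail
  integral sees only zeros. Comparing the sum with smaller \<open>D\<close> is thus a case of
  \<open>mixed_op_diff\<close>.\<close>

lemma sum_op_eq_mixed_op:
  assumes f: "orthant_mono n f" and S: "face n S" 
    and L: "\<forall>j\<in>{1..n}. L j \<le> B" and B: "B < ln (real (Suc N))"
  shows "sum_op N S f L = mixed_op (Suc N) S f L"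
proof -
  have "(LINT s:{ln (real (Suc N))..}|lborel. f (shift S s L)) = 0"
    using ray_zero[OF f S L] B by (intro set_integral_zero) auto
  thus ?thesis
    unfolding sum_op_def mixed_op_def int_op_shift by (simp add: atLeastLessThanSuc_atLeastAtMost)
qed

lemma sum_op_mixed_op:
  assumes f: "orthant_mono n f" and S: "face n S" and D: "1 \<le> D" "D \<le> Suc N"
    and L: "\<forall>j\<in>{1..n}. L j \<le> B" and B: "B < ln (real (Suc N))"
  shows "mixed_op D S f L \<le> sum_op N S f L"
    and "sum_op N S f L - mixed_op D S f L \<le> f L / real D"
proof -
  note e = sum_op_eq_mixed_op[OF f S L B]
  show "mixed_op D S f L \<le> sum_op N S f L"
    unfolding e by (rule mixed_op_diff[OF f S D])
  have "f (shift S (ln (real D)) L) / real D \<le> f L / real D"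
    using ray_antimono[OF f, of 0 "ln (real D)" S L] D by (intro divide_right_mono) auto
  moreover have "0 \<le> f (shift S (ln (real (Suc N))) L) / real (Suc N)"
    by (simp add: orthant_mono_nonneg[OF f])
  ultimately show "sum_op N S f L - mixed_op D S f L \<le> f L / real D"
    using mixed_op_diff(2)[OF f S D, of L] e by simp
qed

lemma int_op_le:
  assumes f: "orthant_mono n f" and S: "face n S" 
    and L: "\<forall>j\<in>{1..n}. L j \<le> B" and B: "0 \<le> B"
  shows "int_op S f L \<le> B * f L"
proof (rule field_le_epsilon)
  fix e :: real assume e: "0 < e"
  \<comment> \<open>The ray is known to vanish only strictly beyond \<open>B\<close>, so the
    integral is cut slightly later; dividing by \<open>1 + f L\<close> keeps the excess below
    \<open>e\<close> also if \<open>f L = 0\<close>.\<close>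
  define b where "b = B + e / (1 + f L)"
  have fL: "0 \<le> f L" by (rule orthant_mono_nonneg[OF f])
  have b: "B < b" using e fL by (simp add: b_def add_nonneg_pos)
  have "int_op S f (shift S b L) = 0"
    unfolding int_op_shift using ray_zero[OF f S L] b by (intro set_integral_zero) auto
  hence "int_op S f L \<le> f L * b"
    using int_op_step(1)[OF f S, of 0 b L] b B by simp
  also have "\<dots> = B * f L + e * (f L / (1 + f L))" by (simp add: b_def algebra_simps)
  also have "\<dots> \<le> B * f L + e"
    using mult_left_mono[of "f L / (1 + f L)" 1 e] e fL by simp
  finally show "int_op S f L \<le> B * f L + e" .
qed

text \<open>The summand \<open>1\<close> is the cost of replacing the sum by the integral at
  \<open>D = 1\<close>, the summand \<open>B\<close> bounds the integral.\<close>

lemma sum_op_le: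
  assumes f: "orthant_mono n f" and S: "face n S"
    and L: "\<forall>j\<in>{1..n}. L j \<le> B" and B: "0 \<le> B" "B < ln (real (Suc N))"
  shows "sum_op N S f L \<le> (1 + B) * f L"
  using sum_op_mixed_op(2)[OF f S, of 1 N L B] int_op_le[OF f S, of L B] assms
  by (simp add: mixed_op_1[unfolded One_nat_def] algebra_simps)

lemma mixed_op_le:
  assumes f: "orthant_mono n f" and S: "face n S" and D: "1 \<le> D" "D \<le> Suc N"
    and L: "\<forall>j\<in>{1..n}. L j \<le> B" and B: "0 \<le> B" "B < ln (real (Suc N))"
  shows "mixed_op D S f L \<le> (1 + B) * f L"
  using sum_op_le[OF f S L B] sum_op_mixed_op(1)[OF f S D L B(2)] by simp

lemma int_op_add_cmult:
  assumes f: "orthant_mono n f" and g: "orthant_mono n g" and S: "face n S"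
  shows "int_op S (\<lambda>L. f L + c * g L) L = int_op S f L + c * int_op S g L"
proof -
  have "set_integrable lborel {0..} (\<lambda>s. c * g (shift S s L))"
    using ray_integrable[OF g S] by simp
  thus ?thesis
    unfolding int_op_def by (simp add: set_integral_add(2)[OF ray_integrable[OF f S]])
qed

lemma mixed_op_add_cmult:
  assumes f: "orthant_mono n f" and g: "orthant_mono n g" and S: "face n S"
  shows "mixed_op D S (\<lambda>L. f L + c * g L) L = mixed_op D S f L + c * mixed_op D S g L"
  unfolding mixed_op_def int_op_add_cmult[OF f g S]
  by (simp add: add_divide_distrib sum.distrib sum_distrib_left algebra_simps)

lemma mixed_op_mono:
  assumes f: "orthant_mono n f" and g: "orthant_mono n g" and S: "face n S" and D: "1 \<le> D"
    and "\<And>s. 0 \<le> s \<Longrightarrow> f (shift S s L) \<le> g (shift S s L)"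
  shows "mixed_op D S f L \<le> mixed_op D S g L"
  unfolding mixed_op_def using D assms(5)
  by (intro add_mono sum_mono divide_right_mono int_op_mono[OF f g S]) (auto simp: shift_shift)

section \<open>Iterated operators\<close>

definition iter_op where
  "iter_op n F Ss = foldr F Ss (orthant n)" for F :: "nat set \<Rightarrow> ((nat \<Rightarrow> real) \<Rightarrow> real) \<Rightarrow> (nat \<Rightarrow> real) \<Rightarrow> real"

lemma iter_op_simps [simp]:
  "iter_op n F [] = orthant n"
  "iter_op n F (S # Ss) = F S (iter_op n F Ss)"
  by (simp_all add: iter_op_def)

lemma orthant_mono_iter_op:
  assumes "\<And>S f. S \<in> set Ss \<Longrightarrow> orthant_mono n f \<Longrightarrow> orthant_mono n (F S f)"
  shows "orthant_mono n (iter_op n F Ss)"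
  using assms by (induction Ss) (auto simp: orthant_mono_orthant)

lemma iter_sum_op_le:
  assumes "\<forall>S\<in>set Ss. face n S" and L: "\<forall>j\<in>{1..n}. L j \<le> B"
    and B: "0 \<le> B" "B < ln (real (Suc N))"
  shows "iter_op n (sum_op N) Ss L \<le> (1 + B) ^ length Ss * orthant n L"
  using assms(1)
proof (induction Ss)
  case Nil
  then show ?case by simp
next
  case (Cons S Ss)
  have "iter_op n (sum_op N) (S # Ss) L \<le> (1 + B) * iter_op n (sum_op N) Ss L"
    using Cons.prems by (auto intro!: sum_op_le[OF orthant_mono_iter_op _ L B] orthant_mono_sum_op)
  also have "\<dots> \<le> (1 + B) * ((1 + B) ^ length Ss * orthant n L)"
    using Cons B by (intro mult_left_mono) auto
  finally show ?case by (simp add: mult_ac)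
qed

text \<open>Two errors add up in each step: the error of the inner operators, which the outer mixed
  operator enlarges by at most \<open>1 + B\<close>, and the error of replacing the outer sum, which
  is the size of the inner sums over \<open>D\<close>. Keeping the factor \<open>orthant n L\<close>
  in the bound lets the outer operator act on it.\<close>

lemma iter_sum_op_mixed_op:
  assumes "\<forall>S\<in>set Ss. face n S" and D: "1 \<le> D" "D \<le> Suc N" and L: "\<forall>j\<in>{1..n}. L j \<le> B"
    and B: "0 \<le> B" "B < ln (real (Suc N))"
  shows "iter_op n (mixed_op D) Ss L \<le> iter_op n (sum_op N) Ss L"
    and "iter_op n (sum_op N) Ss L - iter_op n (mixed_op D) Ss L
         \<le> real (length Ss) * (1 + B) ^ (length Ss - 1) / real D * orthant n L"
proof -
  have "iter_op n (mixed_op D) Ss L \<le> iter_op n (sum_op N) Ss L \<and>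
    iter_op n (sum_op N) Ss L - iter_op n (mixed_op D) Ss L
         \<le> real (length Ss) * (1 + B) ^ (length Ss - 1) / real D * orthant n L"
    using assms(1) L
  proof (induction Ss arbitrary: L)
    case Nil
    then show ?case by simp
  next
    case (Cons S Ss)
    let ?G = "iter_op n (sum_op N) Ss" and ?H = "iter_op n (mixed_op D) Ss"
    let ?e = "real (length Ss) * (1 + B) ^ (length Ss - 1) / real D"
    have S: "face n S" using Cons.prems by simp
    have G: "orthant_mono n ?G" by (intro orthant_mono_iter_op orthant_mono_sum_op)
    have H: "orthant_mono n ?H" using Cons.prems D by (intro orthant_mono_iter_op orthant_mono_mixed_op) auto
    have e: "0 \<le> ?e" using B by simp
    have sL: "\<forall>j\<in>{1..n}. shift S s L j \<le> B" if "0 \<le> s" for s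
      using Cons.prems(2) that by (force simp: shift_def)
    have IH: "?H (shift S s L) \<le> ?G (shift S s L)"
      "?G (shift S s L) \<le> ?H (shift S s L) + ?e * orthant n (shift S s L)" if "0 \<le> s" for s
      using Cons.IH[of "shift S s L"] sL that Cons.prems(1) by force+
    have 1: "mixed_op D S ?H L \<le> mixed_op D S ?G L"
      by (intro mixed_op_mono[OF H G S D(1)] IH)
    have 2: "mixed_op D S ?G L \<le> mixed_op D S (\<lambda>L. ?H L + ?e * orthant n L) L"
      by (intro mixed_op_mono[OF G _ S D(1)] IH orthant_mono_add[OF H] orthant_mono_cmult[OF orthant_mono_orthant] e)
    have 3: "\<dots> = mixed_op D S ?H L + ?e * mixed_op D S (orthant n) L"
      by (rule mixed_op_add_cmult[OF H orthant_mono_orthant S])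
    have 4: "?e * mixed_op D S (orthant n) L \<le> ?e * ((1 + B) * orthant n L)"
      by (intro mult_left_mono e mixed_op_le[OF orthant_mono_orthant S D Cons.prems(2) B])
    note 5 = sum_op_mixed_op[OF G S D Cons.prems(2) B(2)]
    have 6: "?G L / real D \<le> (1 + B) ^ length Ss * orthant n L / real D"
      using iter_sum_op_le[OF _ Cons.prems(2) B] Cons.prems(1) by (intro divide_right_mono) auto
    \<comment> \<open>For empty \<open>Ss\<close> the truncated exponent
      \<open>length Ss - 1\<close> is harmless, because its factor \<open>real (length Ss)\<close>
      is zero.\<close>
    have 7: "?e * ((1 + B) * orthant n L) + (1 + B) ^ length Ss * orthant n L / real D =
      real (length (S # Ss)) * (1 + B) ^ (length (S # Ss) - 1) / real D * orthant n L"
      by (cases Ss) (simp_all add: add_divide_distrib[symmetric] algebra_simps)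
    show ?case
      using 1 2 3 4 5 6 7 by (simp del: of_nat_Suc)
  qed
  thus "iter_op n (mixed_op D) Ss L \<le> iter_op n (sum_op N) Ss L"
    "iter_op n (sum_op N) Ss L - iter_op n (mixed_op D) Ss L
         \<le> real (length Ss) * (1 + B) ^ (length Ss - 1) / real D * orthant n L" by auto
qed

section \<open>Piecewise polynomial functions\<close>

definition lin_form :: "nat \<Rightarrow> (nat \<Rightarrow> real) \<Rightarrow> (nat \<Rightarrow> real) \<Rightarrow> real" where
  "lin_form n a L = (\<Sum>j=1..n. a j * L j)"

lemma lin_form_coord: "j \<in> {1..n} \<Longrightarrow> lin_form n (\<lambda>i. of_bool (i = j)) L = L j"
  unfolding lin_form_def by (simp add: of_bool_def if_distrib[of "\<lambda>x. x * _"] sum.delta cong: if_cong)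

lemma lin_form_sub: "lin_form n (\<lambda>j. a j - b j) L = lin_form n a L - lin_form n b L"
  by (simp add: lin_form_def algebra_simps sum_subtractf)

text \<open>The linear forms have no constant term, so all cutting hyperplanes pass through the
  origin. This is what later makes the thresholds in \<open>diag_poly\<close> proportional to the
  offset.\<close>

inductive pwpoly :: "nat \<Rightarrow> ((nat \<Rightarrow> real) \<Rightarrow> real) \<Rightarrow> bool" for n where
  const: "pwpoly n (\<lambda>L. c)"
| lin: "pwpoly n (\<lambda>L. lin_form n a L)"
| ind: "pwpoly n (\<lambda>L. of_bool (0 \<le> lin_form n a L))"
| add: "pwpoly n f \<Longrightarrow> pwpoly n g \<Longrightarrow> pwpoly n (\<lambda>L. f L + g L)"
| mult: "pwpoly n f \<Longrightarrow> pwpoly n g \<Longrightarrow> pwpoly n (\<lambda>L. f L * g L)"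

text \<open>
  The shape of a piecewise polynomial along a ray, up to finitely many points: since \<open>s \<le> a\<close> and \<open>s \<le> b\<close>
  combine to one of the two, depending on the sign of \<open>b - a\<close>, these forms are closed under products.
\<close>

inductive ray_form :: "nat \<Rightarrow> ((nat \<Rightarrow> real) \<Rightarrow> real \<Rightarrow> real) \<Rightarrow> bool" for n where
  mono: "pwpoly n c \<Longrightarrow> ray_form n (\<lambda>L s. c L * s ^ k)"
| cut: "pwpoly n c \<Longrightarrow> ray_form n (\<lambda>L s. c L * s ^ k * of_bool (s \<le> lin_form n a L))"
| add: "ray_form n f \<Longrightarrow> ray_form n g \<Longrightarrow> ray_form n (\<lambda>L s. f L s + g L s)"

lemma pwpoly_coord:
  assumes "j \<in> {1..n}"
  shows "pwpoly n (\<lambda>L. L j)" "pwpoly n (\<lambda>L. of_bool (0 \<le> L j))"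
proof -
  show "pwpoly n (\<lambda>L. L j)" "pwpoly n (\<lambda>L. of_bool (0 \<le> L j))"
    using pwpoly.lin[of n "\<lambda>i. of_bool (i = j)"] pwpoly.ind[of n "\<lambda>i. of_bool (i = j)"]
    by (simp_all only: lin_form_coord[OF assms])
qed

lemma pwpoly_power: "pwpoly n f \<Longrightarrow> pwpoly n (\<lambda>L. f L ^ k)"
  by (induction k) (auto intro: pwpoly.intros)

lemma pwpoly_prod:
  assumes "finite X" "\<And>x. x \<in> X \<Longrightarrow> pwpoly n (f x)"
  shows "pwpoly n (\<lambda>L. \<Prod>x\<in>X. f x L)"
  using assms by (induction rule: finite_induct) (auto intro: pwpoly.intros)

lemma pwpoly_orthant: "pwpoly n (orthant n)"
proof -
  have "orthant n = (\<lambda>L. \<Prod>j\<in>{1..n}. of_bool (0 \<le> L j))"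
    by (rule ext) (auto simp: orthant_def of_bool_def prod_zero_iff)
  thus ?thesis using pwpoly_coord by (auto intro!: pwpoly_prod)
qed

lemma pwpoly_le: "pwpoly n (\<lambda>L. of_bool (lin_form n a L \<le> lin_form n b L))"
  using pwpoly.ind[of n "\<lambda>j. b j - a j"] by (simp add: lin_form_sub)

lemma pwpoly_not: "pwpoly n (\<lambda>L. of_bool (P L)) \<Longrightarrow> pwpoly n (\<lambda>L. of_bool (\<not> P L))"
  using pwpoly.add[OF pwpoly.const[of n 1] pwpoly.mult[OF pwpoly.const[of n "-1"]], of "\<lambda>L. of_bool (P L)"]
  by (simp add: of_bool_not_iff)

lemma ray_form_cmult: "ray_form n f \<Longrightarrow> pwpoly n c \<Longrightarrow> ray_form n (\<lambda>L s. c L * s ^ k * f L s)"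
proof (induction rule: ray_form.induct)
  case (mono d l)
  then show ?case using ray_form.mono[OF pwpoly.mult[of n c d], of "k + l"] by (simp add: power_add mult_ac)
next
  case (cut d l a)
  then show ?case using ray_form.cut[OF pwpoly.mult[of n c d], of "k + l" a] by (simp add: power_add mult_ac)
next
  case (add f g)
  then show ?case using ray_form.add by (simp add: distrib_left)
qed

lemma ray_form_cut_mult:
  "ray_form n f \<Longrightarrow> pwpoly n c \<Longrightarrow> ray_form n (\<lambda>L s. c L * s ^ k * of_bool (s \<le> lin_form n a L) * f L s)"
proof (induction rule: ray_form.induct)
  case (mono d l)
  then show ?case using ray_form.cut[OF pwpoly.mult[of n c d], of "k + l" a] by (simp add: power_add mult_ac)
next
  case (cut d l b)
  let ?p = "\<lambda>L. of_bool (lin_form n a L \<le> lin_form n b L) :: real"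
  let ?q = "\<lambda>L. of_bool (\<not> lin_form n a L \<le> lin_form n b L) :: real"
  have *: "c L * s ^ k * of_bool (s \<le> lin_form n a L) * (d L * s ^ l * of_bool (s \<le> lin_form n b L)) =
     c L * d L * ?p L * s ^ (k + l) * of_bool (s \<le> lin_form n a L) +
     c L * d L * ?q L * s ^ (k + l) * of_bool (s \<le> lin_form n b L)" for L s
    by (simp add: power_add of_bool_def)
  have "pwpoly n (\<lambda>L. c L * d L * ?p L)" "pwpoly n (\<lambda>L. c L * d L * ?q L)"
    using cut by (auto intro!: pwpoly.mult pwpoly_le pwpoly_not)
  thus ?case unfolding * by (intro ray_form.add ray_form.cut)
next
  case (add f g)
  then show ?case using ray_form.add by (simp add: distrib_left)
qed

lemma ray_form_mult:
  assumes "ray_form n f" "ray_form n g"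
  shows "ray_form n (\<lambda>L s. f L s * g L s)"
  using assms
proof (induction rule: ray_form.induct)
  case (mono c k)
  then show ?case using ray_form_cmult by simp
next
  case (cut c k a)
  then show ?case using ray_form_cut_mult by simp
next
  case (add f g)
  then show ?case using ray_form.add by (simp add: distrib_right)
qed

lemma lin_form_shift: "lin_form n a (shift S s L) = lin_form n a L - s * lin_form n a (\<lambda>j. of_bool (j \<in> S))"
proof -
  have "lin_form n a (shift S s L) = (\<Sum>j=1..n. a j * L j - s * (a j * of_bool (j \<in> S)))"
    unfolding lin_form_def by (intro sum.cong) (auto simp: shift_def algebra_simps)
  thus ?thesis unfolding lin_form_def sum_distrib_left sum_subtractf .
qed

text \<open>Along a ray each linear form is affine in \<open>s\<close>, and its sign condition is a
  cut \<open>s \<le> c\<close>, the complement of a cut, or independent of \<open>s\<close>,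
  according to the sign of the slope.\<close>

lemma pwpoly_ray_form:
  assumes "pwpoly n f"
  shows "\<exists>g. ray_form n g \<and> (\<forall>L. \<forall>\<^sub>F s in cofinite. f (shift S s L) = g L s)"
  using assms
proof (induction rule: pwpoly.induct)
  case (const c)
  then show ?case using ray_form.mono[OF pwpoly.const[of n c], of 0] by (intro exI[of _ "\<lambda>L s. c"]) auto
next
  case (lin a)
  let ?al = "lin_form n a (\<lambda>j. of_bool (j \<in> S))"
  have "ray_form n (\<lambda>L s. lin_form n a L * s ^ 0 + (- ?al) * s ^ 1)"
    by (intro ray_form.add ray_form.mono pwpoly.intros)
  moreover have "lin_form n a (shift S s L) = lin_form n a L * s ^ 0 + (- ?al) * s ^ 1" for L s
    unfolding lin_form_shift by simp
  ultimately show ?case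
    by (intro exI[of _ "\<lambda>L s. lin_form n a L * s ^ 0 + (- ?al) * s ^ 1"]) auto
next
  case (ind a)
  define al where "al = lin_form n a (\<lambda>j. of_bool (j \<in> S))"
  have e: "lin_form n (\<lambda>j. a j / al) L = lin_form n a L / al" for L
    by (simp add: lin_form_def sum_divide_distrib)
  consider "al = 0" | "al > 0" | "al < 0" by linarith
  thus ?case
  proof cases
    case 1
    thus ?thesis using ray_form.mono[OF pwpoly.ind[of n a], of 0]
      by (intro exI[of _ "\<lambda>L s. of_bool (0 \<le> lin_form n a L)"]) (auto simp: lin_form_shift al_def)
  next
    case 2
    have "ray_form n (\<lambda>L s. 1 * s ^ 0 * of_bool (s \<le> lin_form n (\<lambda>j. a j / al) L))"
      by (intro ray_form.cut pwpoly.const)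
    moreover have "of_bool (0 \<le> lin_form n a (shift S s L)) = 1 * s ^ 0 * of_bool (s \<le> lin_form n (\<lambda>j. a j / al) L)" for L s
      unfolding lin_form_shift e al_def[symmetric] using 2 by (simp add: field_simps)
    ultimately show ?thesis
      by (intro exI[of _ "\<lambda>L s. 1 * s ^ 0 * of_bool (s \<le> lin_form n (\<lambda>j. a j / al) L)"]) auto
  next
    \<comment> \<open>For negative slope the condition is \<open>s \<ge> c\<close>, written as one
      minus the cut \<open>s \<le> c\<close>. The two differ at the single point
      \<open>s = c\<close>, which is why equality is claimed up to finitely many points.\<close>
    case 3
    let ?g = "\<lambda>L s. 1 * s ^ 0 + (- 1) * s ^ 0 * of_bool (s \<le> lin_form n (\<lambda>j. a j / al) L) :: real"
    have "ray_form n ?g"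
      by (intro ray_form.add ray_form.mono ray_form.cut pwpoly.const)
    moreover have "of_bool (0 \<le> lin_form n a (shift S s L)) = ?g L s" if "s \<notin> {lin_form n a L / al}" for L s
      unfolding lin_form_shift e al_def[symmetric] using 3 that by (auto simp: field_simps of_bool_def)
    note eq = this
    have "\<forall>\<^sub>F s in cofinite. of_bool (0 \<le> lin_form n a (shift S s L)) = ?g L s" for L
      unfolding eventually_cofinite by (rule finite_subset[of _ "{lin_form n a L / al}"]) (use eq in blast, simp)
    ultimately show ?thesis by (intro exI[of _ ?g] conjI allI)
  qed
next
  case (add f g)
  then obtain f' g' where *: "ray_form n f'" "ray_form n g'"
    "\<And>L. \<forall>\<^sub>F s in cofinite. f (shift S s L) = f' L s" "\<And>L. \<forall>\<^sub>F s in cofinite. g (shift S s L) = g' L s" by blast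
  have "\<forall>\<^sub>F s in cofinite. f (shift S s L) + g (shift S s L) = f' L s + g' L s" for L
    using *(3,4)[of L] by eventually_elim simp
  thus ?case using ray_form.add[OF *(1,2)] by blast
next
  case (mult f g)
  then obtain f' g' where *: "ray_form n f'" "ray_form n g'"
    "\<And>L. \<forall>\<^sub>F s in cofinite. f (shift S s L) = f' L s" "\<And>L. \<forall>\<^sub>F s in cofinite. g (shift S s L) = g' L s" by blast
  have "\<forall>\<^sub>F s in cofinite. f (shift S s L) * g (shift S s L) = f' L s * g' L s" for L
    using *(3,4)[of L] by eventually_elim simp
  thus ?case using ray_form_mult[OF *(1,2)] by blast
qed

section \<open>Integration of piecewise polynomials along rays\<close>

lemma power_interval_integral:
  fixes y :: real
  assumes "0 \<le> y"
  shows "(LINT s:{0..y}|lborel. s ^ k) = y ^ Suc k / real (Suc k)"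
  using integral_power[OF assms, of k] by (simp add: set_lebesgue_integral_def mult.commute)

lemma power_interval_integrable: "set_integrable lborel {a..b::real} (\<lambda>s. s ^ k)"
  by (intro borel_integrable_atLeastAtMost' continuous_intros)

text \<open>A cut turns the upper end into the minimum of \<open>y L\<close> and a linear form.
  Selecting the minimum and its sign requires exactly the comparisons that are assumed to be
  piecewise polynomial.\<close>

lemma ray_form_integral:
  assumes "ray_form n g" and y: "pwpoly n y" "pwpoly n (\<lambda>L. of_bool (0 \<le> y L))"
    and y': "\<And>a. pwpoly n (\<lambda>L. of_bool (y L \<le> lin_form n a L))"
  shows "set_integrable lborel {0..y L} (g L)"
    and "pwpoly n (\<lambda>L. of_bool (0 \<le> y L) * (LINT s:{0..y L}|lborel. g L s))"
proof -
  have "(\<forall>L. set_integrable lborel {0..y L} (g L)) \<and>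
        pwpoly n (\<lambda>L. of_bool (0 \<le> y L) * (LINT s:{0..y L}|lborel. g L s))"
    using assms(1)
  proof (induction rule: ray_form.induct)
    case (mono c k)
    have "set_integrable lborel {0..y L} (\<lambda>s. c L * s ^ k)" for L
      using power_interval_integrable[of 0 "y L" k] by simp
    moreover have "of_bool (0 \<le> y L) * (LINT s:{0..y L}|lborel. c L * s ^ k) =
        of_bool (0 \<le> y L) * (c L * (y L ^ Suc k * (1 / real (Suc k))))" for L
      using power_interval_integral[of "y L" k] by (simp add: of_bool_def)
    moreover have "pwpoly n (\<lambda>L. of_bool (0 \<le> y L) * (c L * (y L ^ Suc k * (1 / real (Suc k)))))"
      by (intro pwpoly.mult pwpoly.const pwpoly_power mono y)
    ultimately show ?case by simp
  next
    case (cut c k a)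
    have i: "indicator {0..y L} s *\<^sub>R (c L * s ^ k * of_bool (s \<le> lin_form n a L)) =
           indicator {0..min (y L) (lin_form n a L)} s *\<^sub>R (c L * s ^ k)" for L s
      by (auto simp: indicator_def)
    have "set_integrable lborel {0..min (y L) (lin_form n a L)} (\<lambda>s. c L * s ^ k)" for L
      using power_interval_integrable[of 0 "min (y L) (lin_form n a L)" k] by simp
    hence 1: "set_integrable lborel {0..y L} (\<lambda>s. c L * s ^ k * of_bool (s \<le> lin_form n a L))" for L
      unfolding set_integrable_def i .
    let ?A = "\<lambda>L. y L ^ Suc k * (1 / real (Suc k))" and ?B = "\<lambda>L. lin_form n a L ^ Suc k * (1 / real (Suc k))"
    have 2: "of_bool (0 \<le> y L) * (LINT s:{0..y L}|lborel. c L * s ^ k * of_bool (s \<le> lin_form n a L)) =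
        of_bool (0 \<le> y L) * (of_bool (0 \<le> lin_form n a L) * (c L * (of_bool (y L \<le> lin_form n a L) * ?A L +
          of_bool (\<not> y L \<le> lin_form n a L) * ?B L)))" for L
    proof (cases "0 \<le> y L \<and> 0 \<le> lin_form n a L")
      case True
      have "(LINT s:{0..y L}|lborel. c L * s ^ k * of_bool (s \<le> lin_form n a L)) =
            c L * (LINT s:{0..min (y L) (lin_form n a L)}|lborel. s ^ k)"
        unfolding set_integral_mult_right[symmetric] by (simp only: set_lebesgue_integral_def i)
      thus ?thesis
        using power_interval_integral[of "min (y L) (lin_form n a L)" k] True by (auto simp: of_bool_def min_def)
    next
      case False
      have "(LINT s:{0..y L}|lborel. c L * s ^ k * of_bool (s \<le> lin_form n a L)) = 0" if "\<not> 0 \<le> lin_form n a L"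
        by (rule set_integral_zero) (use that in auto)
      thus ?thesis using False by auto
    qed
    have "pwpoly n (\<lambda>L. of_bool (0 \<le> y L) * (of_bool (0 \<le> lin_form n a L) * (c L * (of_bool (y L \<le> lin_form n a L) * ?A L +
          of_bool (\<not> y L \<le> lin_form n a L) * ?B L))))"
      by (intro pwpoly.mult pwpoly.add pwpoly.ind pwpoly.const pwpoly.lin pwpoly_power cut y y' pwpoly_not)
    thus ?case using 1 unfolding 2 by blast
  next
    case (add f g)
    have "pwpoly n (\<lambda>L. of_bool (0 \<le> y L) * (LINT s:{0..y L}|lborel. f L s) +
             of_bool (0 \<le> y L) * (LINT s:{0..y L}|lborel. g L s))"
      by (intro pwpoly.add) (use add in auto)
    thus ?case
      using add by (simp add: set_integral_add(2) distrib_left)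
  qed
  thus "set_integrable lborel {0..y L} (g L)"
    "pwpoly n (\<lambda>L. of_bool (0 \<le> y L) * (LINT s:{0..y L}|lborel. g L s))" by auto
qed

text \<open>For any one \<open>j\<close> in \<open>S\<close> the ray is zero beyond
  \<open>L j\<close>, so the improper integral stops at a single coordinate, and
  \<open>ray_form_integral\<close> applies. The finitely many exceptional points of the ray form are
  a null set.\<close>

lemma pwpoly_int_op:
  assumes f: "pwpoly n f" "orthant_mono n f" and S: "face n S"
  shows "pwpoly n (int_op S f)"
proof -
  obtain j where j: "j \<in> S" "j \<in> {1..n}" using S unfolding face_def by blast
  obtain g where g: "ray_form n g" "\<And>L. finite {s. f (shift S s L) \<noteq> g L s}"
    using pwpoly_ray_form[OF f(1)] unfolding eventually_cofinite by blast
  have le: "pwpoly n (\<lambda>L. of_bool (L j \<le> lin_form n a L))" for a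
    using pwpoly_le[of n "\<lambda>i. of_bool (i = j)" a] by (simp only: lin_form_coord[OF j(2)])
  note * = ray_form_integral[OF g(1) pwpoly_coord[OF j(2)] le]
  have "int_op S f L = of_bool (0 \<le> L j) * (LINT s:{0..L j}|lborel. g L s)" for L
  proof -
    have z: "f (shift S s L) = 0" if "L j < s" for s
      using j that by (intro orthant_mono_zero[OF f(2), of j]) (auto simp: shift_def)
    have "int_op S f L = (LINT s|lborel. indicator {0..L j} s *\<^sub>R f (shift S s L))"
      unfolding int_op_def set_lebesgue_integral_def
      by (intro Bochner_Integration.integral_cong) (use z in \<open>auto simp: indicator_def\<close>)
    also have "\<dots> = (LINT s|lborel. indicator {0..L j} s *\<^sub>R g L s)"
    proof (rule integral_cong_AE)
      show "(\<lambda>s. indicator {0..L j} s *\<^sub>R f (shift S s L)) \<in> borel_measurable lborel"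
        using ray_measurable[OF f(2)] by simp
      show "(\<lambda>s. indicator {0..L j} s *\<^sub>R g L s) \<in> borel_measurable lborel"
        using *(1)[of L] unfolding set_integrable_def by (rule borel_measurable_integrable)
      have "AE s in lborel. s \<notin> {s. f (shift S s L) \<noteq> g L s}"
        using g(2) by (intro AE_not_in) (auto simp: null_sets_def emeasure_lborel_countable countable_finite finite_imp_closed)
      thus "AE s in lborel. indicator {0..L j} s *\<^sub>R f (shift S s L) = indicator {0..L j} s *\<^sub>R g L s"
        by eventually_elim auto
    qed
    finally show ?thesis
      by (auto simp: of_bool_def set_lebesgue_integral_def)
  qed
  thus ?thesis using *(2) by presburger
qed

lemma pwpoly_iter_int_op:
  assumes "\<forall>S\<in>set Ss. face n S"
  shows "pwpoly n (iter_op n int_op Ss)"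
  using assms
  by (induction Ss) (auto simp: pwpoly_orthant intro!: pwpoly_int_op orthant_mono_iter_op orthant_mono_int_op)

text \<open>
  Along the diagonal, every sign condition is eventually constant, with a threshold that is linear in the
  offset \<open>v\<close>.
\<close>

definition diag_poly where
  "diag_poly n K m B f \<longleftrightarrow> (\<forall>v. (\<forall>j\<in>{1..n}. \<bar>v j\<bar> \<le> B) \<longrightarrow>
     (\<exists>p. degree p \<le> m \<and> (\<forall>l > K * B. f (\<lambda>j. l - v j) = poly p l)))"
  for n m :: nat and K B :: real and f :: "(nat \<Rightarrow> real) \<Rightarrow> real"

lemma diag_polyD:
  assumes "diag_poly n K m B f" "\<forall>j\<in>{1..n}. \<bar>v j\<bar> \<le> B"
  obtains p where "degree p \<le> m" "\<And>l. l > K * B \<Longrightarrow> f (\<lambda>j. l - v j) = poly p l"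
  using assms unfolding diag_poly_def by blast

lemma diag_poly_mono:
  assumes "diag_poly n K m B f" "K \<le> K'" "m \<le> m'" "0 \<le> B"
  shows "diag_poly n K' m' B f"
  unfolding diag_poly_def
proof (intro allI impI)
  fix v :: "nat \<Rightarrow> real" assume v: "\<forall>j\<in>{1..n}. \<bar>v j\<bar> \<le> B"
  obtain p where p: "degree p \<le> m" "\<And>l. l > K * B \<Longrightarrow> f (\<lambda>j. l - v j) = poly p l"
    using diag_polyD[OF assms(1) v] by blast
  have "K * B \<le> K' * B" using assms by (intro mult_right_mono)
  thus "\<exists>p. degree p \<le> m' \<and> (\<forall>l > K' * B. f (\<lambda>j. l - v j) = poly p l)"
    using p assms(3) by (intro exI[of _ p]) auto
qed

lemma diag_poly_add_mult:
  assumes "\<exists>K\<ge>0. \<exists>m. \<forall>B\<ge>0. diag_poly n K m B f" "\<exists>K\<ge>0. \<exists>m. \<forall>B\<ge>0. diag_poly n K m B g"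
  shows "\<exists>K\<ge>0. \<exists>m. \<forall>B\<ge>0. diag_poly n K m B (\<lambda>L. f L + g L)"
    and "\<exists>K\<ge>0. \<exists>m. \<forall>B\<ge>0. diag_poly n K m B (\<lambda>L. f L * g L)"
proof -
  obtain K1 m1 K2 m2 where 0: "0 \<le> K1" "0 \<le> K2" and
    1: "\<And>B. 0 \<le> B \<Longrightarrow> diag_poly n K1 m1 B f" and 2: "\<And>B. 0 \<le> B \<Longrightarrow> diag_poly n K2 m2 B g"
    using assms by blast
  let ?K = "max K1 K2"
  have "diag_poly n ?K (m1 + m2) B (\<lambda>L. f L + g L) \<and> diag_poly n ?K (m1 + m2) B (\<lambda>L. f L * g L)"
    if B: "0 \<le> B" for B
    unfolding diag_poly_def
  proof (intro conjI allI impI)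
    fix v :: "nat \<Rightarrow> real" assume v: "\<forall>j\<in>{1..n}. \<bar>v j\<bar> \<le> B"
    obtain p where p: "degree p \<le> m1" "\<And>l. l > ?K * B \<Longrightarrow> f (\<lambda>j. l - v j) = poly p l"
      using diag_polyD[OF diag_poly_mono[OF 1[OF B], of ?K m1] v] B by auto
    obtain q where q: "degree q \<le> m2" "\<And>l. l > ?K * B \<Longrightarrow> g (\<lambda>j. l - v j) = poly q l"
      using diag_polyD[OF diag_poly_mono[OF 2[OF B], of ?K m2] v] B by auto
    show "\<exists>p. degree p \<le> m1 + m2 \<and> (\<forall>l > ?K * B. f (\<lambda>j. l - v j) + g (\<lambda>j. l - v j) = poly p l)"
      using p q by (intro exI[of _ "p + q"]) (auto intro: degree_add_le)
    show "\<exists>p. degree p \<le> m1 + m2 \<and> (\<forall>l > ?K * B. f (\<lambda>j. l - v j) * g (\<lambda>j. l - v j) = poly p l)"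
      using p q degree_mult_le[of p q] by (intro exI[of _ "p * q"]) auto
  qed
  moreover have "0 \<le> ?K" using 0 by simp
  ultimately show "\<exists>K\<ge>0. \<exists>m. \<forall>B\<ge>0. diag_poly n K m B (\<lambda>L. f L + g L)"
    "\<exists>K\<ge>0. \<exists>m. \<forall>B\<ge>0. diag_poly n K m B (\<lambda>L. f L * g L)"
    by (intro exI[of _ ?K] exI[of _ "m1 + m2"]; simp)+
qed

lemma pwpoly_diag_poly:
  assumes "pwpoly n f"
  shows "\<exists>K\<ge>0. \<exists>m. \<forall>B\<ge>0. diag_poly n K m B f"
  using assms
proof (induction rule: pwpoly.induct)
  case (const c)
  have "diag_poly n 0 0 B (\<lambda>L. c)" for B
    unfolding diag_poly_def by (auto intro!: exI[of _ "[:c:]"])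
  then show ?case by blast
next
  case (lin a)
  have "lin_form n a (\<lambda>j. l - v j) = poly [:- lin_form n a v, \<Sum>j=1..n. a j:] l" for v l
    by (simp add: lin_form_def algebra_simps sum_subtractf sum_distrib_left)
  hence "diag_poly n 0 1 B (\<lambda>L. lin_form n a L)" for B
    unfolding diag_poly_def by (metis degree_pCons_le degree_pCons_0 One_nat_def)
  then show ?case by blast
next
  case (ind a)
  define A where "A = (\<Sum>j=1..n. a j)"
  \<comment> \<open>At the point \<open>l - v\<close> the form has the value
    \<open>l * A - lin_form n a v\<close>, whose sign is that of \<open>A\<close> as soon as
    \<open>l * \<bar>A\<bar>\<close> exceeds \<open>B\<close> times the sum of the
    \<open>\<bar>a j\<bar>\<close>. If \<open>A = 0\<close>, the sign does not depend on
    \<open>l\<close>, and division by zero gives the admissible value \<open>K = 0\<close>.\<close>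
  define K where "K = (\<Sum>j=1..n. \<bar>a j\<bar>) / \<bar>A\<bar>"
  have e: "lin_form n a (\<lambda>j. l - v j) = l * A - lin_form n a v" for l v
    by (simp add: lin_form_def A_def algebra_simps sum_subtractf sum_distrib_left)
  have K: "0 \<le> K" by (simp add: K_def sum_nonneg)
  have "diag_poly n K 0 B (\<lambda>L. of_bool (0 \<le> lin_form n a L))" if B: "0 \<le> B" for B
    unfolding diag_poly_def
  proof (intro allI impI)
    fix v :: "nat \<Rightarrow> real" assume v: "\<forall>j\<in>{1..n}. \<bar>v j\<bar> \<le> B"
    have "\<bar>lin_form n a v\<bar> \<le> (\<Sum>j=1..n. \<bar>a j\<bar> * B)"
      unfolding lin_form_def using v by (intro order_trans[OF sum_abs] sum_mono) (auto simp: abs_mult intro!: mult_left_mono)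
    also have "\<dots> = (\<Sum>j=1..n. \<bar>a j\<bar>) * B" by (simp add: sum_distrib_right)
    finally have v': "\<bar>lin_form n a v\<bar> \<le> (\<Sum>j=1..n. \<bar>a j\<bar>) * B" .
    show "\<exists>p. degree p \<le> 0 \<and> (\<forall>l > K * B. of_bool (0 \<le> lin_form n a (\<lambda>j. l - v j)) = poly p l)"
    proof (cases "A = 0")
      case True
      thus ?thesis unfolding e by (intro exI[of _ "[:of_bool (0 \<le> - lin_form n a v):]"]) auto
    next
      case False
      have "0 \<le> lin_form n a (\<lambda>j. l - v j) \<longleftrightarrow> 0 < A" if "l > K * B" for l
      proof -
        have "\<bar>lin_form n a v\<bar> < l * \<bar>A\<bar>"
          using that v' False by (simp add: K_def field_simps)
        thus ?thesis unfolding e using False by (auto simp: abs_if split: if_splits)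
      qed
      thus ?thesis by (intro exI[of _ "[:of_bool (0 < A):]"]) auto
    qed
  qed
  then show ?case using K by blast
next
  case (add f g)
  show ?case by (rule diag_poly_add_mult(1)[OF add.IH])
next
  case (mult f g)
  show ?case by (rule diag_poly_add_mult(2)[OF mult.IH])
qed

text \<open>The number of terms may grow with \<open>D\<close>, but the base functions
  \<open>F\<close> do not depend on it. Degrees and threshold constants, which come from
  \<open>F\<close>, are therefore uniform in \<open>D\<close>.\<close>

inductive shift_comb :: "((nat \<Rightarrow> real) \<Rightarrow> real) set \<Rightarrow> real \<Rightarrow> ((nat \<Rightarrow> real) \<Rightarrow> real) \<Rightarrow> bool" for F B where
  zero: "shift_comb F B (\<lambda>_. 0)"
| step: "shift_comb F B g \<Longrightarrow> f \<in> F \<Longrightarrow> (\<forall>j. \<bar>v j\<bar> \<le> B) \<Longrightarrow> shift_comb F B (\<lambda>L. g L + c * f (\<lambda>j. L j - v j))"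

lemma shift_comb_add: "shift_comb F B g \<Longrightarrow> shift_comb F B h \<Longrightarrow> shift_comb F B (\<lambda>L. h L + g L)"
proof (induction rule: shift_comb.induct)
  case zero
  then show ?case by simp
next
  case (step g f v c)
  then show ?case using shift_comb.step[of F B "\<lambda>L. h L + g L" f v c] by (simp add: add.assoc)
qed

lemma shift_comb_cmult: "shift_comb F B g \<Longrightarrow> shift_comb F B (\<lambda>L. g L * d)"
proof (induction rule: shift_comb.induct)
  case zero
  then show ?case by (simp add: shift_comb.zero)
next
  case (step g f v c)
  then show ?case using shift_comb.step[of F B "\<lambda>L. g L * d" f v "c * d"] by (simp add: algebra_simps)
qed

lemma shift_comb_sum:
  assumes "finite X" "\<And>x. x \<in> X \<Longrightarrow> shift_comb F B (g x)"
  shows "shift_comb F B (\<lambda>L. \<Sum>x\<in>X. g x L)"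
  using assms
proof (induction rule: finite_induct)
  case empty
  then show ?case by (simp add: shift_comb.zero)
next
  case (insert x X)
  thus ?case using shift_comb_add[of F B "\<lambda>L. \<Sum>x\<in>X. g x L" "g x"] by simp
qed

lemma shift_comb_mono: "shift_comb F B g \<Longrightarrow> F \<subseteq> F' \<Longrightarrow> B \<le> B' \<Longrightarrow> shift_comb F' B' g"
  by (induction rule: shift_comb.induct) (auto intro!: shift_comb.intros intro: order_trans)

lemma shift_comb_shift: "shift_comb F B g \<Longrightarrow> 0 \<le> s \<Longrightarrow> s \<le> B' \<Longrightarrow> shift_comb F (B + B') (\<lambda>L. g (shift S s L))"
proof (induction rule: shift_comb.induct)
  case zero
  then show ?case by (simp add: shift_comb.zero)
next
  case (step g f v c)
  let ?w = "\<lambda>j. v j + s * of_bool (j \<in> S)"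
  have "\<forall>j. \<bar>?w j\<bar> \<le> B + B'"
  proof
    fix j show "\<bar>?w j\<bar> \<le> B + B'" using step.prems step.hyps(3)[rule_format, of j] by (auto simp: of_bool_def)
  qed
  moreover have "(\<lambda>j. shift S s L j - v j) = (\<lambda>j. L j - ?w j)" for L
    by (auto simp: shift_def)
  ultimately show ?case
    using shift_comb.step[of F "B + B'" _ f ?w c] step by simp
qed

lemma shift_diff: "(\<lambda>j. shift S s L j - v j) = shift S s (\<lambda>j. L j - v j)"
  by (auto simp: shift_def)

lemma shift_comb_int_op:
  assumes "shift_comb F B g" and F: "\<And>f. f \<in> F \<Longrightarrow> orthant_mono n f" and S: "face n S"
  shows "shift_comb (int_op S ` F) B (int_op S g)" and "set_integrable lborel {0..} (\<lambda>s. g (shift S s L))"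
proof -
  have "shift_comb (int_op S ` F) B (int_op S g) \<and> (\<forall>L. set_integrable lborel {0..} (\<lambda>s. g (shift S s L)))"
    using assms(1)
  proof (induction rule: shift_comb.induct)
    case zero
    have "int_op S (\<lambda>_. 0) = (\<lambda>_. 0)" by (auto simp: int_op_def set_lebesgue_integral_def)
    then show ?case by (simp add: shift_comb.zero set_integrable_def)
  next
    case (step g f v c)
    have i: "set_integrable lborel {0..} (\<lambda>s. c * f (\<lambda>j. shift S s L j - v j))" for L
      using ray_integrable[OF F[OF step.hyps(2)] S] unfolding shift_diff by simp
    have "int_op S (\<lambda>L. g L + c * f (\<lambda>j. L j - v j)) = (\<lambda>L. int_op S g L + c * int_op S f (\<lambda>j. L j - v j))"
    proof
      fix L
      show "int_op S (\<lambda>L. g L + c * f (\<lambda>j. L j - v j)) L = int_op S g L + c * int_op S f (\<lambda>j. L j - v j)"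
        using set_integral_add(2)[OF _ i, of "\<lambda>s. g (shift S s L)" L] step.IH
        unfolding int_op_def by (simp add: shift_diff)
    qed
    thus ?case using step i
      by (auto intro!: shift_comb.step set_integral_add(1))
  qed
  thus "shift_comb (int_op S ` F) B (int_op S g)" "set_integrable lborel {0..} (\<lambda>s. g (shift S s L))" by auto
qed

lemma shift_comb_mixed_op:
  assumes g: "shift_comb F B g" and F: "\<And>f. f \<in> F \<Longrightarrow> orthant_mono n f" and S: "face n S" and D: "1 \<le> D"
  shows "shift_comb (F \<union> int_op S ` F) (B + ln (real D)) (mixed_op D S g)"
proof -
  have "shift_comb F (B + ln (real D)) (\<lambda>L. \<Sum>d=1..<D. g (shift S (ln (real d)) L) * (1 / real d))"
    by (intro shift_comb_sum shift_comb_cmult shift_comb_shift g) auto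
  moreover have "shift_comb (int_op S ` F) (B + ln (real D)) (\<lambda>L. int_op S g (shift S (ln (real D)) L))"
    by (intro shift_comb_shift shift_comb_int_op[OF g F S]) (use D in auto)
  ultimately show ?thesis
    unfolding mixed_op_def by (intro shift_comb_add[of _ _ _ "\<lambda>L. \<Sum>d=1..<D. g (shift S (ln (real d)) L) / real d"])
      (auto intro: shift_comb_mono)
qed

text \<open>Each face contributes either a term of the initial sum, which is only a shift by at most
  \<open>ln D\<close>, or the shifted integral. The faces of the second kind form a subsequence of
  \<open>Ss\<close>.\<close>

lemma shift_comb_iter_mixed_op:
  assumes "\<forall>S\<in>set Ss. face n S" "1 \<le> D"
  shows "shift_comb (iter_op n int_op ` set (subseqs Ss)) (real (length Ss) * ln (real D)) (iter_op n (mixed_op D) Ss)"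
  using assms(1)
proof (induction Ss)
  case Nil
  show ?case
    using shift_comb.step[OF shift_comb.zero, of "orthant n" "{orthant n}" "\<lambda>_. 0" 0 1] by simp
next
  case (Cons S Ss)
  let ?F = "iter_op n int_op ` set (subseqs Ss)"
  have F: "orthant_mono n f" if "f \<in> ?F" for f
  proof -
    from that obtain Ts where Ts: "Ts \<in> set (subseqs Ss)" "f = iter_op n int_op Ts" by blast
    have "set Ts \<subseteq> set Ss" using Ts(1) by (metis PowI PowD subseqs_powset image_eqI)
    thus ?thesis unfolding Ts(2) using Cons.prems by (auto intro!: orthant_mono_iter_op orthant_mono_int_op)
  qed
  have "shift_comb (?F \<union> int_op S ` ?F) (real (length Ss) * ln (real D) + ln (real D)) (mixed_op D S (iter_op n (mixed_op D) Ss))"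
    using Cons F assms(2) by (intro shift_comb_mixed_op) auto
  thus ?case by (simp add: image_Un image_image Let_def Un_commute algebra_simps)
qed

lemma shift_comb_diag_poly:
  assumes "shift_comb F B g" "\<And>f. f \<in> F \<Longrightarrow> diag_poly n K m (B + C) f" "0 \<le> C"
    and v: "\<forall>j\<in>{1..n}. \<bar>v j\<bar> \<le> C"
  shows "\<exists>p. degree p \<le> m \<and> (\<forall>l > K * (B + C). g (\<lambda>j. l - v j) = poly p l)"
  using assms(1)
proof (induction rule: shift_comb.induct)
  case zero
  then show ?case by (intro exI[of _ 0]) auto
next
  case (step g f w c)
  from step.IH obtain p where p: "degree p \<le> m" "\<And>l. l > K * (B + C) \<Longrightarrow> g (\<lambda>j. l - v j) = poly p l" by blast
  have "\<forall>j\<in>{1..n}. \<bar>v j + w j\<bar> \<le> B + C"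
  proof
    fix j assume "j \<in> {1..n}"
    thus "\<bar>v j + w j\<bar> \<le> B + C" using v step.hyps(3)[rule_format, of j] abs_triangle_ineq[of "v j" "w j"] by force
  qed
  from diag_polyD[OF assms(2)[OF step.hyps(2)] this]
  obtain q where q: "degree q \<le> m" "\<And>l. l > K * (B + C) \<Longrightarrow> f (\<lambda>j. l - (v j + w j)) = poly q l" by blast
  show ?case
    using p q by (intro exI[of _ "p + smult c q"]) (auto intro!: degree_add_le simp: diff_diff_eq)
qed

text \<open>There are only finitely many subsequences, so maxima over them give one \<open>K\<close>
  and one degree bound \<open>m\<close> that serve all \<open>D\<close> and all offsets. This
  uniformity lets \<open>D\<close> grow with \<open>k\<close>.\<close>

lemma iter_mixed_op_diag_poly:
  assumes "\<forall>S\<in>set Ss. face n S"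
  shows "\<exists>K\<ge>0. \<exists>m. \<forall>D\<ge>1. \<forall>C\<ge>0. \<forall>v. (\<forall>j\<in>{1..n}. \<bar>v j\<bar> \<le> C) \<longrightarrow>
    (\<exists>p. degree p \<le> m \<and> (\<forall>l > K * (real (length Ss) * ln (real D) + C).
       iter_op n (mixed_op D) Ss (\<lambda>j. l - v j) = poly p l))"
proof -
  let ?F = "iter_op n int_op ` set (subseqs Ss)"
  have "\<exists>K\<ge>0. \<exists>m. \<forall>B\<ge>0. diag_poly n K m B f" if "f \<in> ?F" for f
  proof -
    from that obtain Ts where Ts: "Ts \<in> set (subseqs Ss)" "f = iter_op n int_op Ts" by blast
    have "set Ts \<subseteq> set Ss" using Ts(1) by (metis PowI PowD subseqs_powset image_eqI)
    thus ?thesis unfolding Ts(2) using assms by (intro pwpoly_diag_poly pwpoly_iter_int_op) auto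
  qed
  then obtain K m where K: "\<And>f. f \<in> ?F \<Longrightarrow> 0 \<le> K f" "\<And>f B. f \<in> ?F \<Longrightarrow> 0 \<le> B \<Longrightarrow> diag_poly n (K f) (m f) B f"
    by metis
  define K0 where "K0 = Max (insert 0 (K ` ?F))"
  define m0 where "m0 = Max (insert 0 (m ` ?F))"
  have K0: "0 \<le> K0" by (simp add: K0_def)
  have *: "diag_poly n K0 m0 B f" if "f \<in> ?F" "0 \<le> B" for f B
    using that by (intro diag_poly_mono[OF K(2)]) (auto simp: K0_def m0_def)
  show ?thesis
  proof (intro exI[of _ K0] exI[of _ m0] conjI allI impI K0)
    fix D :: nat and C :: real and v :: "nat \<Rightarrow> real"
    assume D: "1 \<le> D" and C: "0 \<le> C" and v: "\<forall>j\<in>{1..n}. \<bar>v j\<bar> \<le> C"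
    show "\<exists>p. degree p \<le> m0 \<and> (\<forall>l > K0 * (real (length Ss) * ln (real D) + C).
       iter_op n (mixed_op D) Ss (\<lambda>j. l - v j) = poly p l)"
      by (rule shift_comb_diag_poly[OF shift_comb_iter_mixed_op[OF assms D] _ C v]) (use D C in \<open>auto intro!: *\<close>)
  qed
qed

section \<open>Tuples with greatest common divisor one and nested families\<close>

definition proper_faces :: "nat \<Rightarrow> nat set set" where
  "proper_faces n = {S. S \<subseteq> {1..n} \<and> S \<noteq> {} \<and> S \<noteq> {1..n}}"

definition nested :: "'a set set \<Rightarrow> bool" where
  "nested X \<longleftrightarrow> (\<forall>S\<in>X. \<forall>T\<in>X. S \<subseteq> T \<or> T \<subseteq> S)"

abbreviation faces_at :: "nat \<Rightarrow> nat \<Rightarrow> nat set set" where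
  "faces_at n j \<equiv> {S. S \<in> proper_faces n \<and> j \<in> S}"

lemma finite_proper_faces [simp]: "finite (proper_faces n)"
  by (rule finite_subset[of _ "Pow {1..n}"]) (auto simp: proper_faces_def)

section \<open>Chains of sets and their multiplicities\<close>

lemma nested_subset: "nested X \<Longrightarrow> Y \<subseteq> X \<Longrightarrow> nested Y"
  unfolding nested_def by blast

lemma nested_Union_in:
  assumes "finite X" "X \<noteq> {}" "nested X"
  shows "\<Union>X \<in> X"
  using assms
proof (induction rule: finite_ne_induct)
  case (insert S X)
  hence "\<Union>X \<in> X" using nested_subset by blast
  hence "S \<subseteq> \<Union>X \<or> \<Union>X \<subseteq> S" using insert.prems unfolding nested_def by blast
  hence "\<Union>(insert S X) = S \<or> \<Union>(insert S X) = \<Union>X" by (auto simp del: Union_iff)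
  thus ?case
  proof
    assume "\<Union>(insert S X) = S" thus ?thesis by (simp only: insertI1)
  next
    assume "\<Union>(insert S X) = \<Union>X" thus ?thesis using \<open>\<Union>X \<in> X\<close> by (simp only: insertI2)
  qed
qed auto

lemma nested_Inter_in:
  assumes "finite X" "X \<noteq> {}" "nested X"
  shows "\<Inter>X \<in> X"
  using assms
proof (induction rule: finite_ne_induct)
  case (insert S X)
  hence "\<Inter>X \<in> X" using nested_subset by blast
  hence "S \<subseteq> \<Inter>X \<or> \<Inter>X \<subseteq> S" using insert.prems unfolding nested_def by blast
  hence "\<Inter>(insert S X) = S \<or> \<Inter>(insert S X) = \<Inter>X" by (auto simp del: Inter_iff)
  thus ?case
  proof
    assume "\<Inter>(insert S X) = S" thus ?thesis by (simp only: insertI1)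
  next
    assume "\<Inter>(insert S X) = \<Inter>X" thus ?thesis using \<open>\<Inter>X \<in> X\<close> by (simp only: insertI2)
  qed
qed auto

text \<open>The support of the sum is the union of the chain, and the union of a finite nonempty
  chain is its largest member.\<close>

lemma nested_coeffs_support:
  fixes c :: "'a set \<Rightarrow> nat"
  assumes J: "finite J" and "nested {S\<in>J. 0 < c S}" "S \<in> J" "0 < c S"
  shows "{j. 0 < (\<Sum>S | S \<in> J \<and> j \<in> S. c S)} \<in> {S\<in>J. 0 < c S}"
proof -
  have "(\<Sum>S | S \<in> J \<and> j \<in> S. c S) \<noteq> 0 \<longleftrightarrow> j \<in> \<Union>{S\<in>J. 0 < c S}" for j
    using J by (subst sum_eq_0_iff) auto
  hence "{j. 0 < (\<Sum>S | S \<in> J \<and> j \<in> S. c S)} = \<Union>{S\<in>J. 0 < c S}"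
    by (simp only: neq0_conv[symmetric] Collect_mem_eq)
  thus ?thesis using nested_Union_in[of "{S\<in>J. 0 < c S}"] assms by auto
qed

text \<open>The largest member \<open>M\<close> of the chain is visible from the sums alone, as
  their support. Hence both families have the same \<open>M\<close>; lowering both coefficients of
  \<open>M\<close> by one lowers the sums equally, and induction on the total applies.\<close>

lemma nested_coeffs_unique:
  fixes c c' :: "'a set \<Rightarrow> nat"
  assumes J: "finite J" "{} \<notin> J"
    and "nested {S\<in>J. 0 < c S}" "nested {S\<in>J. 0 < c' S}"
    and "\<And>j. (\<Sum>S | S \<in> J \<and> j \<in> S. c S) = (\<Sum>S | S \<in> J \<and> j \<in> S. c' S)"
    and "S \<in> J"
  shows "c S = c' S"
  using assms(3-)
proof (induction "sum c J" arbitrary: c c' S rule: less_induct)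
  case (less c c')
  show ?case
  proof (cases "\<exists>T\<in>J. 0 < c T \<or> 0 < c' T")
    case False
    thus ?thesis using less.prems by auto
  next
    case True
    have pos: "\<exists>j. 0 < (\<Sum>S | S \<in> J \<and> j \<in> S. b S)" if "T \<in> J" "0 < b T" for T and b :: "'a set \<Rightarrow> nat"
    proof -
      from J(2) that(1) obtain j where "j \<in> T" by (metis ex_in_conv)
      thus ?thesis using J(1) that by (intro exI[of _ j] sum_pos2[of _ T]) auto
    qed
    have ex: "\<exists>T\<in>J. 0 < b T" if "0 < (\<Sum>S | S \<in> J \<and> j \<in> S. b S)" for j and b :: "'a set \<Rightarrow> nat"
    proof (rule ccontr)
      assume "\<not> ?thesis"
      hence "(\<Sum>S | S \<in> J \<and> j \<in> S. b S) = 0" by (intro sum.neutral) auto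
      thus False using that by simp
    qed
    define M where "M = {j. 0 < (\<Sum>S | S \<in> J \<and> j \<in> S. c S)}"
    have M': "M = {j. 0 < (\<Sum>S | S \<in> J \<and> j \<in> S. c' S)}"
      unfolding M_def less.prems(3) ..
    from True obtain T where T: "T \<in> J" "0 < c T \<or> 0 < c' T" by blast
    have "\<exists>j. 0 < (\<Sum>S | S \<in> J \<and> j \<in> S. c S)"
      using T(2) pos[OF T(1), of c] pos[OF T(1), of c'] unfolding less.prems(3) by blast
    then obtain j where "0 < (\<Sum>S | S \<in> J \<and> j \<in> S. c S)" "0 < (\<Sum>S | S \<in> J \<and> j \<in> S. c' S)"
      unfolding less.prems(3) by blast
    hence "\<exists>T\<in>J. 0 < c T" "\<exists>T\<in>J. 0 < c' T"
      using ex by blast+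
    hence M: "M \<in> J" "0 < c M" "0 < c' M"
      using nested_coeffs_support[OF J(1) less.prems(1)] nested_coeffs_support[OF J(1) less.prems(2)]
      unfolding M_def[symmetric] M'[symmetric] by blast+
    define e where "e = c(M := c M - 1)"
    define e' where "e' = c'(M := c' M - 1)"
    have s: "(\<Sum>S | S \<in> J \<and> j \<in> S. b S) = (\<Sum>S | S \<in> J \<and> j \<in> S. (b(M := b M - 1)) S) + of_bool (j \<in> M)"
      if "0 < b M" for j and b :: "'a set \<Rightarrow> nat"
    proof -
      have "(\<Sum>S | S \<in> J \<and> j \<in> S. b S) = (\<Sum>S | S \<in> J \<and> j \<in> S. (b(M := b M - 1)) S + of_bool (S = M))"
        using that by (intro sum.cong) auto
      also have "(\<Sum>S | S \<in> J \<and> j \<in> S. of_bool (S = M)) = (of_bool (j \<in> M) :: nat)"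
        using J(1) M(1) by (auto simp: of_bool_def sum.delta)
      ultimately show ?thesis by (simp add: sum.distrib)
    qed
    have "sum e J < sum c J"
      using M J(1) by (intro sum_strict_mono_ex1) (auto simp: e_def intro!: bexI[of _ M])
    moreover have "nested {S\<in>J. 0 < e S}"
      by (rule nested_subset[OF less.prems(1)]) (use M in \<open>auto simp: e_def split: if_splits\<close>)
    moreover have "nested {S\<in>J. 0 < e' S}"
      by (rule nested_subset[OF less.prems(2)]) (use M in \<open>auto simp: e'_def split: if_splits\<close>)
    moreover have "(\<Sum>S | S \<in> J \<and> j \<in> S. e S) = (\<Sum>S | S \<in> J \<and> j \<in> S. e' S)" for j
      using s[where b = c, OF M(2), of j] s[where b = c', OF M(3), of j] less.prems(3)[of j] unfolding e_def e'_def by linarith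
    ultimately have "e S = e' S" using less.hyps[of e e' S] less.prems(4) by blast
    thus ?thesis using M by (auto simp: e_def e'_def split: if_splits)
  qed
qed

text \<open>
  The exponent of a prime in the factor \<open>d S\<close> of a tuple with exponents \<open>a\<close>: the number of levels
  \<open>t \<ge> 1\<close> whose level set is exactly \<open>S\<close>. Level sets are nested.
\<close>

definition level_count :: "nat \<Rightarrow> (nat \<Rightarrow> nat) \<Rightarrow> nat set \<Rightarrow> nat" where
  "level_count n a S = card {t. 1 \<le> t \<and> {j\<in>{1..n}. t \<le> a j} = S}"

lemma level_finite:
  fixes a :: "nat \<Rightarrow> nat"
  assumes "S \<noteq> {}"
  shows "finite {t. 1 \<le> t \<and> {j\<in>{1..n}. t \<le> a j} = S}"
proof -
  from assms obtain j where "j \<in> S" by blast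
  hence "{t. 1 \<le> t \<and> {j\<in>{1..n}. t \<le> a j} = S} \<subseteq> {..a j}" by blast
  thus ?thesis by (rule finite_subset) simp
qed

lemma nested_level_count: "nested {S\<in>proper_faces n. 0 < level_count n a S}"
proof -
  have ex: "\<exists>t. S = {j\<in>{1..n}. t \<le> a j}" if "0 < level_count n a S" for S
    using that unfolding level_count_def card_gt_0_iff by blast
  show ?thesis
    unfolding nested_def
  proof (intro ballI)
    fix S T assume "S \<in> {S\<in>proper_faces n. 0 < level_count n a S}" "T \<in> {S\<in>proper_faces n. 0 < level_count n a S}"
    then obtain t u where "S = {j\<in>{1..n}. t \<le> a j}" "T = {j\<in>{1..n}. u \<le> a j}" using ex by blast
    thus "S \<subseteq> T \<or> T \<subseteq> S" by (cases "t \<le> u") auto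
  qed
qed

text \<open>Each level \<open>t\<close> from \<open>1\<close> to \<open>a j\<close> has exactly one
  level set, and it contains \<open>j\<close>. The index \<open>i\<close> with
  \<open>a i = 0\<close> keeps every such level set proper.\<close>

lemma sum_level_count:
  assumes "i \<in> {1..n}" "a i = 0" and j: "j \<in> {1..n}"
  shows "(\<Sum>S\<in>faces_at n j. level_count n a S) = a j"
proof -
  let ?X = "faces_at n j"
  let ?A = "\<lambda>S. {t. 1 \<le> t \<and> {j\<in>{1..n}. t \<le> a j} = S}"
  have "{1..a j} = (\<Union>S\<in>?X. ?A S)"
  proof (intro equalityI subsetI)
    fix t assume t: "t \<in> {1..a j}"
    have "i \<notin> {j\<in>{1..n}. t \<le> a j}" "j \<in> {j\<in>{1..n}. t \<le> a j}" using assms t by auto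
    hence "{j\<in>{1..n}. t \<le> a j} \<in> ?X" using assms(1) unfolding proper_faces_def by blast
    thus "t \<in> (\<Union>S\<in>?X. ?A S)" using t by auto
  next
    fix t assume "t \<in> (\<Union>S\<in>?X. ?A S)"
    thus "t \<in> {1..a j}" by auto
  qed
  hence "a j = card (\<Union>S\<in>?X. ?A S)" by (metis card_atLeastAtMost diff_Suc_1)
  also have "\<dots> = (\<Sum>S\<in>?X. card (?A S))"
  proof (rule card_UN_disjoint)
    show "\<forall>S\<in>?X. finite (?A S)" by (intro ballI level_finite) (auto simp: proper_faces_def)
  qed auto
  finally show ?thesis by (simp add: level_count_def)
qed

section \<open>Parametrization of tuples by their factors\<close>

definition face_prod :: "nat \<Rightarrow> (nat set \<Rightarrow> nat) \<Rightarrow> nat \<Rightarrow> nat" where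
  "face_prod n d j = (\<Prod>S\<in>faces_at n j. d S)"

text \<open>This says prime by prime that \<open>d S\<close> and \<open>d T\<close> are coprime for
  incomparable \<open>S\<close> and \<open>T\<close>; the local form is the one to which Moebius
  inversion applies.\<close>

definition nested_tuple :: "nat \<Rightarrow> (nat set \<Rightarrow> nat) \<Rightarrow> bool" where
  "nested_tuple n d \<longleftrightarrow> (\<forall>p. prime p \<longrightarrow> nested {S\<in>proper_faces n. p dvd d S})"

lemma multiplicity_prod_pos:
  fixes d :: "'a \<Rightarrow> nat"
  assumes "finite X" "\<And>S. S \<in> X \<Longrightarrow> 0 < d S" "prime p"
  shows "multiplicity p (\<Prod>S\<in>X. d S) = (\<Sum>S\<in>X. multiplicity p (d S))"
proof (rule prime_elem_multiplicity_prod_distrib)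
  show "0 \<notin> d ` X" using assms(2) by force
qed (use assms in auto)

lemma multiplicity_pos_iff: "prime p \<Longrightarrow> 0 < d \<Longrightarrow> 0 < multiplicity p d \<longleftrightarrow> p dvd (d::nat)"
  by (subst multiplicity_gt_zero_iff) auto

text \<open>A prime dividing every entry would have its faces cover all of \<open>{1..n}\<close>,
  but their union is the largest face of a chain and therefore proper.\<close>

lemma face_prod_Gcd:
  assumes n: "1 \<le> n" and d: "nested_tuple n d"
  shows "Gcd (face_prod n d ` {1..n}) = 1"
proof (rule ccontr)
  assume "Gcd (face_prod n d ` {1..n}) \<noteq> 1"
  then obtain p where p: "prime p" "p dvd Gcd (face_prod n d ` {1..n})"
    by (metis prime_factor_nat)
  let ?X = "{S\<in>proper_faces n. p dvd d S}"
  have *: "j \<in> \<Union>?X" if j: "j \<in> {1..n}" for j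
  proof -
    have "p dvd face_prod n d j" using p(2) j by (meson Gcd_dvd dvd_trans imageI)
    thus ?thesis unfolding face_prod_def using p(1) by (auto simp: prime_dvd_prod_iff)
  qed
  have "\<Union>?X \<in> ?X"
    using * [of 1] n d p by (intro nested_Union_in) (auto simp: nested_tuple_def)
  thus False using * by (auto simp: proper_faces_def)
qed

text \<open>For a given prime, choose \<open>j\<close> in the smallest face whose factor it divides.
  Then \<open>j\<close> lies in the whole chain, so the single entry at \<open>j\<close> already
  carries the full power of the prime in the product.\<close>

lemma face_prod_Lcm:
  assumes n: "1 \<le> n" and d: "nested_tuple n d" and pos: "\<And>S. S \<in> proper_faces n \<Longrightarrow> 0 < d S"
  shows "Lcm (face_prod n d ` {1..n}) = (\<Prod>S\<in>proper_faces n. d S)"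
proof (rule dvd_antisym)
  show "Lcm (face_prod n d ` {1..n}) dvd (\<Prod>S\<in>proper_faces n. d S)"
  proof (rule Lcm_least)
    fix a assume "a \<in> face_prod n d ` {1..n}"
    then obtain j where "a = face_prod n d j" by blast
    thus "a dvd (\<Prod>S\<in>proper_faces n. d S)"
      unfolding face_prod_def by (simp only:) (rule prod_dvd_prod_subset, auto)
  qed
  have d0: "d S \<noteq> 0" if "S \<in> proper_faces n" for S using pos[OF that] by simp
  have nz: "Lcm (face_prod n d ` {1..n}) \<noteq> 0"
    by (auto simp: Lcm_0_iff face_prod_def d0)
  have pn: "(\<Prod>S\<in>proper_faces n. d S) \<noteq> 0" by (auto simp: d0)
  show "(\<Prod>S\<in>proper_faces n. d S) dvd Lcm (face_prod n d ` {1..n})"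
  proof (rule multiplicity_le_imp_dvd[OF pn])
    fix p :: nat assume p: "prime p"
    let ?X = "{S\<in>proper_faces n. p dvd d S}"
    have e: "multiplicity p (\<Prod>S\<in>proper_faces n. d S) = (\<Sum>S\<in>?X. multiplicity p (d S))"
    proof -
      have "multiplicity p (\<Prod>S\<in>proper_faces n. d S) = (\<Sum>S\<in>proper_faces n. multiplicity p (d S))"
        by (rule multiplicity_prod_pos) (use pos p in auto)
      also have "\<dots> = (\<Sum>S\<in>?X. multiplicity p (d S))"
        by (intro sum.mono_neutral_right) (auto simp: not_dvd_imp_multiplicity_0)
      finally show ?thesis .
    qed
    show "multiplicity p (\<Prod>S\<in>proper_faces n. d S) \<le> multiplicity p (Lcm (face_prod n d ` {1..n}))"
    proof (cases "?X = {}")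
      case True
      show ?thesis unfolding e True by simp
    next
      case False
      hence "\<Inter>?X \<in> ?X" using d p by (intro nested_Inter_in) (auto simp: nested_tuple_def)
      then obtain j where j: "j \<in> {1..n}" "j \<in> \<Inter>?X" unfolding proper_faces_def by blast
      have "(\<Sum>S\<in>?X. multiplicity p (d S)) \<le> (\<Sum>S\<in>faces_at n j. multiplicity p (d S))"
        using j(2) by (intro sum_mono2) auto
      also have "\<dots> = multiplicity p (face_prod n d j)"
        unfolding face_prod_def by (rule multiplicity_prod_pos[symmetric]) (use pos p in auto)
      also have "\<dots> \<le> multiplicity p (Lcm (face_prod n d ` {1..n}))"
        using j(1) nz by (intro dvd_imp_multiplicity_le dvd_Lcm) auto
      finally show ?thesis unfolding e .
    qed
  qed
qed

text \<open>Both directions compare exponents prime by prime: injectivity is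
  \<open>nested_coeffs_unique\<close>, and surjectivity takes the level counts of the exponents of
  \<open>m\<close>. The bound \<open>x\<close> on \<open>d S\<close> follows since
  \<open>d S\<close> divides an entry of the tuple.\<close>

lemma face_prod_bij:
  fixes x :: real
  assumes n: "1 \<le> n"
  shows "bij_betw (\<lambda>d. restrict (face_prod n d) {1..n})
    {d \<in> proper_faces n \<rightarrow>\<^sub>E {k. 1 \<le> k \<and> real k \<le> x}. nested_tuple n d \<and> (\<forall>j\<in>{1..n}. real (face_prod n d j) \<le> x)}
    {m \<in> {1..n} \<rightarrow>\<^sub>E {k. 1 \<le> k \<and> real k \<le> x}. Gcd (m ` {1..n}) = 1}"
    (is "bij_betw ?F ?A ?B")
  unfolding bij_betw_def
proof
  show "inj_on ?F ?A"
  proof (rule inj_onI)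
    fix d e assume d: "d \<in> ?A" and e: "e \<in> ?A" and eq: "?F d = ?F e"
    have pos: "0 < d S" "0 < e S" if "S \<in> proper_faces n" for S
      using d e that by (force simp: PiE_def Pi_def)+
    have "d S = e S" if S: "S \<in> proper_faces n" for S
    proof (rule multiplicity_eq_nat)
      fix p :: nat assume p: "prime p"
      have "(\<Sum>S\<in>faces_at n j. multiplicity p (d S)) =
            (\<Sum>S\<in>faces_at n j. multiplicity p (e S))" for j
      proof (cases "j \<in> {1..n}")
        case True
        hence "face_prod n d j = face_prod n e j" using fun_cong[OF eq, of j] by simp
        moreover have "multiplicity p (face_prod n d j) = (\<Sum>S\<in>faces_at n j. multiplicity p (d S))"
          "multiplicity p (face_prod n e j) = (\<Sum>S\<in>faces_at n j. multiplicity p (e S))"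
          unfolding face_prod_def by (rule multiplicity_prod_pos; use pos p in auto)+
        ultimately show ?thesis by simp
      next
        case False
        hence "faces_at n j = {}" by (auto simp: proper_faces_def)
        thus ?thesis by (simp only: sum.empty)
      qed
      moreover have "{S \<in> proper_faces n. 0 < multiplicity p (d S)} = {S \<in> proper_faces n. p dvd d S}"
        "{S \<in> proper_faces n. 0 < multiplicity p (e S)} = {S \<in> proper_faces n. p dvd e S}"
        using pos p by (auto simp: multiplicity_pos_iff)
      moreover have "{} \<notin> proper_faces n" by (simp add: proper_faces_def)
      moreover have "nested {S \<in> proper_faces n. p dvd d S}" "nested {S \<in> proper_faces n. p dvd e S}"
        using d e p by (auto simp: nested_tuple_def)
      ultimately show "multiplicity p (d S) = multiplicity p (e S)"
        using nested_coeffs_unique[of "proper_faces n" "\<lambda>S. multiplicity p (d S)" "\<lambda>S. multiplicity p (e S)", OF finite_proper_faces _ _ _ _ S]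
        by presburger
    qed (use pos S in auto)
    thus "d = e" using d e by (auto intro: PiE_ext)
  qed
  show "?F ` ?A = ?B"
  proof (intro equalityI subsetI)
    fix m assume "m \<in> ?F ` ?A"
    then obtain d where d: "d \<in> ?A" "m = ?F d" by blast
    have "0 < d S" if "S \<in> proper_faces n" for S
      using d that by (force simp: PiE_def Pi_def)
    hence "1 \<le> face_prod n d j" for j
      unfolding face_prod_def by (simp add: Suc_le_eq prod_pos)
    moreover have "m ` {1..n} = face_prod n d ` {1..n}" unfolding d(2) by simp
    hence "Gcd (m ` {1..n}) = 1"
      using d face_prod_Gcd[OF n] by simp
    ultimately show "m \<in> ?B" using d by auto
  next
    fix m assume m: "m \<in> ?B"
    have mpos: "0 < m j" "real (m j) \<le> x" if "j \<in> {1..n}" for j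
      using m that by (force simp: PiE_def Pi_def)+
    define P where "P = prime_factors (\<Prod>j\<in>{1..n}. m j)"
    define c where "c = (\<lambda>p. level_count n (\<lambda>j. multiplicity p (m j)))"
    define d where "d = (\<lambda>S\<in>proper_faces n. \<Prod>p\<in>P. p ^ c p S)"
    have P: "finite P" "\<And>p. p \<in> P \<Longrightarrow> prime p" by (auto simp: P_def)
    have pos: "0 < d S" if "S \<in> proper_faces n" for S
      using that P(2) by (auto simp: d_def prime_gt_0_nat intro!: prod_pos)
    have mult_d: "multiplicity p (d S) = c p S" if p: "prime p" and S: "S \<in> proper_faces n" for p S
    proof (cases "p \<in> P")
      case True
      thus ?thesis using p S P by (simp add: d_def multiplicity_prod_prime_powers)
    next
      case False
      have "\<not> p dvd m j" if j: "j \<in> {1..n}" for j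
      proof
        assume "p dvd m j"
        hence "p dvd (\<Prod>j\<in>{1..n}. m j)" using j by (meson dvd_prodI dvd_trans finite_atLeastAtMost)
        moreover have "(\<Prod>j\<in>{1..n}. m j) \<noteq> 0" using mpos by force
        ultimately show False using False p by (simp add: P_def prime_factors_dvd)
      qed
      hence "{j\<in>{1..n}. t \<le> multiplicity p (m j)} = {}" if "1 \<le> t" for t
        using that by (auto simp: not_dvd_imp_multiplicity_0)
      hence "{t. 1 \<le> t \<and> {j\<in>{1..n}. t \<le> multiplicity p (m j)} = S} = {}"
        using S unfolding proper_faces_def by fastforce
      hence "c p S = 0" by (simp only: c_def level_count_def card.empty)
      thus ?thesis using False p S P by (simp add: d_def multiplicity_prod_prime_powers)
    qed
    \<comment> \<open>Here the greatest common divisor enters: it provides the entry with exponent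
      zero that \<open>sum_level_count\<close> requires.\<close>
    have ex0: "\<exists>i\<in>{1..n}. multiplicity p (m i) = 0" if p: "prime p" for p
    proof (rule ccontr)
      assume "\<not> ?thesis"
      hence "\<forall>i\<in>{1..n}. p dvd m i" using not_dvd_imp_multiplicity_0 by blast
      hence "p dvd Gcd (m ` {1..n})" by (auto intro: Gcd_greatest)
      thus False using m p by auto
    qed
    have fp: "face_prod n d j = m j" if j: "j \<in> {1..n}" for j
    proof (rule multiplicity_eq_nat)
      show "0 < face_prod n d j" using pos by (auto simp: face_prod_def intro: prod_pos)
      show "0 < m j" using mpos j by auto
      fix p :: nat assume p: "prime p"
      obtain i where i: "i \<in> {1..n}" "multiplicity p (m i) = 0" using ex0[OF p] by blast
      have "multiplicity p (face_prod n d j) = (\<Sum>S\<in>faces_at n j. multiplicity p (d S))"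
        unfolding face_prod_def using pos p by (intro multiplicity_prod_pos) auto
      also have "\<dots> = (\<Sum>S\<in>faces_at n j. level_count n (\<lambda>j. multiplicity p (m j)) S)"
        using mult_d[OF p] by (intro sum.cong) (auto simp: c_def)
      also have "\<dots> = multiplicity p (m j)"
        by (rule sum_level_count[OF i(1) _ j]) (rule i(2))
      finally show "multiplicity p (face_prod n d j) = multiplicity p (m j)" .
    qed
    have "nested_tuple n d"
      unfolding nested_tuple_def
    proof (intro allI impI)
      fix p :: nat assume p: "prime p"
      have "p dvd d S \<longleftrightarrow> 0 < c p S" if "S \<in> proper_faces n" for S
        using mult_d[OF p that] multiplicity_pos_iff[OF p pos[OF that]] by simp
      hence "{S \<in> proper_faces n. p dvd d S} = {S \<in> proper_faces n. 0 < c p S}" by auto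
      thus "nested {S \<in> proper_faces n. p dvd d S}"
        unfolding c_def using nested_level_count by simp
    qed
    moreover have "real (d S) \<le> x" if S: "S \<in> proper_faces n" for S
    proof -
      from S obtain j where j: "j \<in> S" "j \<in> {1..n}" unfolding proper_faces_def by blast
      have "d S dvd face_prod n d j" unfolding face_prod_def using S j by (intro dvd_prodI) auto
      hence "d S \<le> m j" using fp[OF j(2)] mpos[OF j(2)] by (auto intro: dvd_imp_le)
      thus ?thesis using mpos(2)[OF j(2)] by linarith
    qed
    moreover have "d \<in> extensional (proper_faces n)" by (simp add: d_def)
    ultimately have "d \<in> ?A" using pos fp mpos by (auto simp: PiE_def Suc_le_eq)
    moreover have "m = ?F d" using m fp by (auto intro!: PiE_ext[of _ "{1..n}"] simp: restrict_def PiE_def extensional_def fun_eq_iff)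
    ultimately show "m \<in> ?F ` ?A" by blast
  qed
qed

text \<open>The range \<open>{1..N}\<close> for an arbitrary \<open>N \<ge> x\<close> detaches the
  index set from \<open>x\<close>; larger values of \<open>d S\<close> are excluded by the
  conditions on the entries.\<close>

lemma U_nested:
  assumes n: "1 \<le> n" and N: "x \<le> real N"
  shows "U n x = (\<Sum>d \<in> proper_faces n \<rightarrow>\<^sub>E {1..N}. of_bool (nested_tuple n d) *
     (of_bool (\<forall>j\<in>{1..n}. real (face_prod n d j) \<le> x) * (\<Prod>S\<in>proper_faces n. 1 / real (d S))))"
proof -
  let ?J = "proper_faces n"
  let ?A = "{d \<in> ?J \<rightarrow>\<^sub>E {k. 1 \<le> k \<and> real k \<le> x}. nested_tuple n d \<and> (\<forall>j\<in>{1..n}. real (face_prod n d j) \<le> x)}"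
  let ?F = "\<lambda>d. restrict (face_prod n d) {1..n}"
  have "U n x = (\<Sum>d\<in>?A. 1 / real (Lcm (?F d ` {1..n})))"
    unfolding U_def using sum.reindex_bij_betw[OF face_prod_bij[OF n, of x], of "\<lambda>m. 1 / real (Lcm (m ` {1..n}))"] by simp
  also have "\<dots> = (\<Sum>d\<in>?A. \<Prod>S\<in>?J. 1 / real (d S))"
  proof (rule sum.cong)
    fix d assume d: "d \<in> ?A"
    have "?F d ` {1..n} = face_prod n d ` {1..n}" by simp
    moreover have "0 < d S" if "S \<in> ?J" for S
      using d that by (force simp: PiE_def Pi_def)
    ultimately show "1 / real (Lcm (?F d ` {1..n})) = (\<Prod>S\<in>?J. 1 / real (d S))"
      using face_prod_Lcm[OF n, of d] d by (simp add: prod_dividef)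
  qed simp
  also have "?A = {d \<in> ?J \<rightarrow>\<^sub>E {1..N}. nested_tuple n d \<and> (\<forall>j\<in>{1..n}. real (face_prod n d j) \<le> x)}"
  proof (intro equalityI subsetI)
    fix d assume "d \<in> ?A"
    thus "d \<in> {d \<in> ?J \<rightarrow>\<^sub>E {1..N}. nested_tuple n d \<and> (\<forall>j\<in>{1..n}. real (face_prod n d j) \<le> x)}"
      using N by (force simp: PiE_def Pi_def)
  next
    fix d assume d: "d \<in> {d \<in> ?J \<rightarrow>\<^sub>E {1..N}. nested_tuple n d \<and> (\<forall>j\<in>{1..n}. real (face_prod n d j) \<le> x)}"
    have pos: "0 < d S" if "S \<in> ?J" for S
      using d that by (force simp: PiE_def Pi_def)
    have "real (d S) \<le> x" if S: "S \<in> ?J" for S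
    proof -
      from S obtain j where j: "j \<in> S" "j \<in> {1..n}" unfolding proper_faces_def by blast
      have "d S dvd face_prod n d j" unfolding face_prod_def using S j by (intro dvd_prodI) auto
      moreover have "0 < face_prod n d j" unfolding face_prod_def using pos by (auto intro: prod_pos)
      ultimately have "d S \<le> face_prod n d j" by (rule dvd_imp_le)
      thus ?thesis using d j(2) by (smt (verit) mem_Collect_eq of_nat_mono)
    qed
    thus "d \<in> ?A" using d by (auto simp: PiE_def Pi_def)
  qed
  also have "(\<Sum>d\<in>\<dots>. \<Prod>S\<in>?J. 1 / real (d S)) = (\<Sum>d \<in> ?J \<rightarrow>\<^sub>E {1..N}. of_bool (nested_tuple n d) *
     (of_bool (\<forall>j\<in>{1..n}. real (face_prod n d j) \<le> x) * (\<Prod>S\<in>?J. 1 / real (d S))))"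
    by (intro sum.mono_neutral_cong_left) (auto intro!: finite_PiE)
  finally show ?thesis .
qed

section \<open>Expansion into harmonic sums\<close>

text \<open>
  The weights that turn the indicator of nestedness into a divisor sum; they vanish on singletons, so
  the Euler product of the weights still converges absolutely after multiplication by small powers.
\<close>

definition nested_mobius :: "'a set set \<Rightarrow> real" where
  "nested_mobius X = (\<Sum>Y\<in>Pow X. (- 1) ^ (card X + card Y) * of_bool (nested Y))"

lemma sum_nested_mobius:
  assumes "finite X"
  shows "(\<Sum>Y\<in>Pow X. nested_mobius Y) = of_bool (nested X)"
  using inclusion_exclusion_symmetric[OF refl assms, of "\<lambda>X. of_bool (nested X) :: real"]
  by (simp add: nested_mobius_def power_add sum_distrib_left mult.assoc)

lemma prod_primes_dvd_iff:
  assumes "finite A" "\<And>p. p \<in> A \<Longrightarrow> prime p"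
  shows "\<Prod>A dvd d \<longleftrightarrow> (\<forall>p\<in>A. p dvd (d::nat))"
  using assms
proof (induction rule: finite_induct)
  case (insert p A)
  have "coprime p (\<Prod>A)"
    using insert by (intro prod_coprime_right) (auto intro!: primes_coprime)
  hence "p * \<Prod>A dvd d \<longleftrightarrow> p dvd d \<and> \<Prod>A dvd d"
    by (auto intro: divides_mult dvd_mult_left dvd_mult_right)
  thus ?case using insert by simp
qed simp

text \<open>A map \<sigma> records, for each prime \<open>p\<close>, the set of faces chosen in the
  Moebius expansion at \<open>p\<close>; \<open>face_divisor\<close> is the resulting squarefree
  divisor demanded of \<open>d S\<close>.\<close>

definition face_divisor :: "nat set \<Rightarrow> (nat \<Rightarrow> nat set set) \<Rightarrow> nat set \<Rightarrow> nat" where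
  "face_divisor P \<sigma> S = \<Prod>{p\<in>P. S \<in> \<sigma> p}"

text \<open>This is the logarithm of the product of all divisors
  \<open>face_divisor P \<sigma> S\<close> with \<open>j\<close> in \<open>S\<close>, that is, the
  amount by which the \<open>j\<close>-th bound drops when they are divided out.\<close>

definition face_shift :: "nat set \<Rightarrow> (nat \<Rightarrow> nat set set) \<Rightarrow> nat \<Rightarrow> real" where
  "face_shift P \<sigma> j = (\<Sum>p\<in>P. real (card {S\<in>\<sigma> p. j \<in> S}) * ln (real p))"

text \<open>A prime above \<open>N\<close> divides no \<open>d S\<close> and imposes no condition.
  For the others the indicator is a product of local divisor sums, and multiplying out yields one
  term for each choice \<sigma>.\<close>

lemma nested_tuple_expand:
  assumes d: "d \<in> proper_faces n \<rightarrow>\<^sub>E {1..N}" and P: "P = {p. prime p \<and> p \<le> N}"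
  shows "of_bool (nested_tuple n d) = (\<Sum>\<sigma>\<in>PiE P (\<lambda>_. Pow (proper_faces n)).
    (\<Prod>p\<in>P. nested_mobius (\<sigma> p)) * of_bool (\<forall>S\<in>proper_faces n. face_divisor P \<sigma> S dvd d S))"
proof -
  let ?J = "proper_faces n"
  let ?K = "\<lambda>p. {S\<in>?J. p dvd d S}"
  have fP: "finite P" by (rule finite_subset[of _ "{..N}"]) (auto simp: P)
  have "nested_tuple n d \<longleftrightarrow> (\<forall>p\<in>P. nested (?K p))"
  proof -
    have "nested (?K p)" if "prime p" "p \<notin> P" for p
    proof -
      have "\<not> p dvd d S" if S: "S \<in> ?J" for S
      proof
        assume "p dvd d S"
        moreover have "1 \<le> d S" "d S \<le> N" using d S by (auto simp: PiE_def Pi_def)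
        ultimately have "p \<le> N" using dvd_imp_le[of p "d S"] by linarith
        thus False using that \<open>prime p\<close> \<open>p \<notin> P\<close> by (simp add: P)
      qed
      thus ?thesis unfolding nested_def by blast
    qed
    thus ?thesis unfolding nested_tuple_def P by blast
  qed
  hence "of_bool (nested_tuple n d) = (\<Prod>p\<in>P. of_bool (nested (?K p)) :: real)"
    using fP by (auto simp: of_bool_def prod_zero_iff)
  also have "\<dots> = (\<Prod>p\<in>P. \<Sum>Y\<in>Pow ?J. nested_mobius Y * of_bool (Y \<subseteq> ?K p))"
  proof (rule prod.cong)
    fix p
    have "(\<Sum>Y\<in>Pow ?J. nested_mobius Y * of_bool (Y \<subseteq> ?K p)) = (\<Sum>Y\<in>Pow (?K p). nested_mobius Y)"
      by (rule sum.mono_neutral_cong_right) auto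
    also have "\<dots> = of_bool (nested (?K p))" by (intro sum_nested_mobius) auto
    finally show "of_bool (nested (?K p)) = (\<Sum>Y\<in>Pow ?J. nested_mobius Y * of_bool (Y \<subseteq> ?K p))" ..
  qed simp
  also have "\<dots> = (\<Sum>\<sigma>\<in>PiE P (\<lambda>_. Pow ?J). \<Prod>p\<in>P. nested_mobius (\<sigma> p) * of_bool (\<sigma> p \<subseteq> ?K p))"
    by (rule prod_sum_PiE) (auto simp: fP)
  also have "\<dots> = (\<Sum>\<sigma>\<in>PiE P (\<lambda>_. Pow ?J). (\<Prod>p\<in>P. nested_mobius (\<sigma> p)) *
      of_bool (\<forall>S\<in>?J. face_divisor P \<sigma> S dvd d S))"
  proof (rule sum.cong)
    fix \<sigma> assume \<sigma>: "\<sigma> \<in> PiE P (\<lambda>_. Pow ?J)"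
    have "(\<forall>S\<in>?J. face_divisor P \<sigma> S dvd d S) \<longleftrightarrow> (\<forall>S\<in>?J. \<forall>p\<in>{p\<in>P. S \<in> \<sigma> p}. p dvd d S)"
      unfolding face_divisor_def using fP by (intro ball_cong refl prod_primes_dvd_iff) (auto simp: P)
    also have "\<dots> \<longleftrightarrow> (\<forall>p\<in>P. \<sigma> p \<subseteq> ?K p)"
      using \<sigma> by (auto simp: PiE_def Pi_def)
    finally have "(\<Prod>p\<in>P. of_bool (\<sigma> p \<subseteq> ?K p)) = (of_bool (\<forall>S\<in>?J. face_divisor P \<sigma> S dvd d S) :: real)"
      using fP by (auto simp: of_bool_def prod_zero_iff)
    thus "(\<Prod>p\<in>P. nested_mobius (\<sigma> p) * of_bool (\<sigma> p \<subseteq> ?K p)) =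
      (\<Prod>p\<in>P. nested_mobius (\<sigma> p)) * of_bool (\<forall>S\<in>?J. face_divisor P \<sigma> S dvd d S)"
      by (simp only: prod.distrib)
  qed simp
  finally show ?thesis .
qed

text \<open>Substitute \<open>d S = k S * l S\<close>. The sum over \<open>l\<close> keeps the full
  range \<open>{1..N}\<close>, because the condition on the entries already forces
  \<open>k S * l S \<le> N\<close>.\<close>

lemma sum_multiples_rescale:
  fixes k :: "nat set \<Rightarrow> nat"
  assumes k: "\<And>S. S \<in> proper_faces n \<Longrightarrow> 1 \<le> k S" and x: "0 < x" "x \<le> real N"
  shows "(\<Sum>d \<in> proper_faces n \<rightarrow>\<^sub>E {1..N}. of_bool (\<forall>S\<in>proper_faces n. k S dvd d S) *
      (of_bool (\<forall>j\<in>{1..n}. real (face_prod n d j) \<le> x) * (\<Prod>S\<in>proper_faces n. 1 / real (d S)))) =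
    (\<Prod>S\<in>proper_faces n. 1 / real (k S)) *
    (\<Sum>l \<in> proper_faces n \<rightarrow>\<^sub>E {1..N}. (\<Prod>S\<in>proper_faces n. 1 / real (l S)) *
      orthant n (\<lambda>j. ln x - (\<Sum>S\<in>faces_at n j. ln (real (k S)))
        - (\<Sum>S\<in>faces_at n j. ln (real (l S)))))"
proof -
  let ?J = "proper_faces n"
  let ?X = "?J \<rightarrow>\<^sub>E {1..N}"
  let ?w = "\<lambda>d. \<Prod>S\<in>?J. 1 / real (d S)"
  let ?c = "\<lambda>d. \<forall>j\<in>{1..n}. real (face_prod n d j) \<le> x"
  let ?T1 = "{d\<in>?X. (\<forall>S\<in>?J. k S dvd d S) \<and> ?c d}"
  let ?T2 = "{l\<in>?X. ?c (\<lambda>S. k S * l S)}"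
  let ?f = "\<lambda>l. \<lambda>S\<in>?J. k S * l S"
  have fX: "finite ?X" by (intro finite_PiE) auto
  have fpf: "face_prod n (?f l) = face_prod n (\<lambda>S. k S * l S)" for l
    by (auto simp: face_prod_def fun_eq_iff intro!: prod.cong)
  have bij: "bij_betw ?f ?T2 ?T1"
  proof (rule bij_betw_byWitness[where f' = "\<lambda>d. \<lambda>S\<in>?J. d S div k S"])
    show "\<forall>l\<in>?T2. (\<lambda>S\<in>?J. ?f l S div k S) = l"
    proof
      fix l assume l: "l \<in> ?T2"
      have "l \<in> extensional ?J" using l by (simp add: PiE_def)
      thus "(\<lambda>S\<in>?J. ?f l S div k S) = l"
        using k by (intro extensionalityI[of _ ?J]) (force simp: Suc_le_eq)+
    qed
    show "\<forall>d\<in>?T1. ?f (\<lambda>S\<in>?J. d S div k S) = d"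
    proof
      fix d assume d: "d \<in> ?T1"
      have "d \<in> extensional ?J" using d by (simp add: PiE_def)
      thus "?f (\<lambda>S\<in>?J. d S div k S) = d"
        using d by (intro extensionalityI[of _ ?J]) auto
    qed
    show "?f ` ?T2 \<subseteq> ?T1"
    proof
      fix d assume "d \<in> ?f ` ?T2"
      then obtain l where l: "l \<in> ?T2" "d = ?f l" by blast
      have pos: "1 \<le> k S * l S" if "S \<in> ?J" for S
      proof -
        have "1 \<le> l S" using l that by (auto simp: PiE_def Pi_def)
        thus ?thesis using k[OF that] by (simp add: Suc_le_eq)
      qed
      have "k S * l S \<le> N" if S: "S \<in> ?J" for S
      proof -
        from S obtain j where j: "j \<in> S" "j \<in> {1..n}" unfolding proper_faces_def by blast
        have "k S * l S dvd face_prod n (\<lambda>S. k S * l S) j"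
          unfolding face_prod_def using S j by (intro dvd_prodI[of _ _ "\<lambda>S. k S * l S"]) auto
        moreover have "0 < face_prod n (\<lambda>S. k S * l S) j"
          unfolding face_prod_def using pos by (intro prod_pos) (auto simp: Suc_le_eq)
        ultimately have "k S * l S \<le> face_prod n (\<lambda>S. k S * l S) j" by (rule dvd_imp_le)
        moreover have "real (face_prod n (\<lambda>S. k S * l S) j) \<le> real N"
          using l j x by force
        ultimately show ?thesis by linarith
      qed
      thus "d \<in> ?T1" unfolding l(2) using pos l(1) by (auto simp: fpf)
    qed
    show "(\<lambda>d. \<lambda>S\<in>?J. d S div k S) ` ?T1 \<subseteq> ?T2"
    proof
      fix l assume "l \<in> (\<lambda>d. \<lambda>S\<in>?J. d S div k S) ` ?T1"
      then obtain d where d: "d \<in> ?T1" "l = (\<lambda>S\<in>?J. d S div k S)" by blast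
      have "1 \<le> d S div k S \<and> d S div k S \<le> N" if S: "S \<in> ?J" for S
      proof -
        have *: "1 \<le> d S" "d S \<le> N" "k S dvd d S" using d S by (auto simp: PiE_def Pi_def)
        from *(3) obtain e where "d S = k S * e" by (elim dvdE)
        hence "1 \<le> d S div k S" using k[OF S] *(1) by (auto simp: Suc_le_eq)
        thus ?thesis using *(2) div_le_dividend[of "d S" "k S"] by linarith
      qed
      moreover have "face_prod n (\<lambda>S. k S * l S) = face_prod n d"
        using d by (auto simp: face_prod_def fun_eq_iff intro!: prod.cong)
      ultimately show "l \<in> ?T2" using d by auto
    qed
  qed
  have or: "of_bool (?c (\<lambda>S. k S * l S)) =
     orthant n (\<lambda>j. ln x - (\<Sum>S | S \<in> ?J \<and> j \<in> S. ln (real (k S))) - (\<Sum>S | S \<in> ?J \<and> j \<in> S. ln (real (l S))))"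
    if l: "l \<in> ?X" for l
  proof -
    have pos: "0 < real (k S)" "0 < real (l S)" if "S \<in> ?J" for S
      using l that k[OF that] by (auto simp: PiE_def Pi_def Suc_le_eq)
    have "real (face_prod n (\<lambda>S. k S * l S) j) \<le> x \<longleftrightarrow>
      0 \<le> ln x - (\<Sum>S | S \<in> ?J \<and> j \<in> S. ln (real (k S))) - (\<Sum>S | S \<in> ?J \<and> j \<in> S. ln (real (l S)))" for j
    proof -
      have p: "0 < (\<Prod>S | S \<in> ?J \<and> j \<in> S. real (k S) * real (l S))"
        using pos by (intro prod_pos) auto
      have "real (face_prod n (\<lambda>S. k S * l S) j) \<le> x \<longleftrightarrow> ln (\<Prod>S | S \<in> ?J \<and> j \<in> S. real (k S) * real (l S)) \<le> ln x"
        using p x by (simp add: face_prod_def)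
      also have "ln (\<Prod>S | S \<in> ?J \<and> j \<in> S. real (k S) * real (l S)) =
        (\<Sum>S | S \<in> ?J \<and> j \<in> S. ln (real (k S) * real (l S)))"
        using pos by (intro ln_prod) auto
      also have "\<dots> = (\<Sum>S | S \<in> ?J \<and> j \<in> S. ln (real (k S))) + (\<Sum>S | S \<in> ?J \<and> j \<in> S. ln (real (l S)))"
        unfolding sum.distrib[symmetric] using pos by (intro sum.cong) (auto simp: ln_mult_pos)
      finally show ?thesis by linarith
    qed
    thus ?thesis unfolding orthant_def by simp
  qed
  have "(\<Sum>d\<in>?X. of_bool (\<forall>S\<in>?J. k S dvd d S) * (of_bool (?c d) * ?w d)) = (\<Sum>d\<in>?T1. ?w d)"
    by (intro sum.mono_neutral_cong_right) (use fX in auto)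
  also have "\<dots> = (\<Sum>l\<in>?T2. ?w (?f l))"
    by (rule sum.reindex_bij_betw[OF bij, symmetric])
  also have "\<dots> = (\<Sum>l\<in>?T2. ?w k * ?w l)"
    unfolding prod.distrib[symmetric] by (intro sum.cong prod.cong) auto
  also have "\<dots> = (\<Sum>l\<in>?X. ?w k * (?w l * of_bool (?c (\<lambda>S. k S * l S))))"
    by (intro sum.mono_neutral_cong_left) (use fX in auto)
  also have "\<dots> = ?w k * (\<Sum>l\<in>?X. ?w l * of_bool (?c (\<lambda>S. k S * l S)))"
    by (rule sum_distrib_left[symmetric])
  finally show ?thesis using or by simp
qed

lemma iter_sum_op_eq:
  assumes "distinct Ss"
  shows "iter_op n (sum_op N) Ss L = (\<Sum>l \<in> set Ss \<rightarrow>\<^sub>E {1..N}. (\<Prod>S\<in>set Ss. 1 / real (l S)) *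
      orthant n (\<lambda>j. L j - (\<Sum>S | S \<in> set Ss \<and> j \<in> S. ln (real (l S)))))"
  using assms
proof (induction Ss arbitrary: L)
  case Nil
  then show ?case by simp
next
  case (Cons S Ss)
  let ?X = "set Ss \<rightarrow>\<^sub>E {1..N}"
  have S: "S \<notin> set Ss" using Cons.prems by simp
  have "(\<Sum>l \<in> set (S # Ss) \<rightarrow>\<^sub>E {1..N}. (\<Prod>T\<in>set (S # Ss). 1 / real (l T)) *
      orthant n (\<lambda>j. L j - (\<Sum>T | T \<in> set (S # Ss) \<and> j \<in> T. ln (real (l T))))) =
    (\<Sum>(d, l) \<in> {1..N} \<times> ?X. (\<Prod>T\<in>insert S (set Ss). 1 / real ((l(S := d)) T)) *
      orthant n (\<lambda>j. L j - (\<Sum>T | T \<in> insert S (set Ss) \<and> j \<in> T. ln (real ((l(S := d)) T)))))"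
    unfolding list.set(2) PiE_insert_eq sum.reindex[OF inj_combinator[OF S, of "\<lambda>_. {1..N}"]]
    by (simp add: case_prod_unfold o_def)
  also have "\<dots> = (\<Sum>(d, l) \<in> {1..N} \<times> ?X. 1 / real d * ((\<Prod>T\<in>set Ss. 1 / real (l T)) *
      orthant n (\<lambda>j. shift S (ln (real d)) L j - (\<Sum>T | T \<in> set Ss \<and> j \<in> T. ln (real (l T))))))"
  proof (rule sum.cong, simp, clarify)
    fix d l assume "d \<in> {1..N}" "l \<in> ?X"
    have 1: "(\<Prod>T\<in>insert S (set Ss). 1 / real ((l(S := d)) T)) = 1 / real d * (\<Prod>T\<in>set Ss. 1 / real (l T))"
      using S by (simp add: prod.insert) (intro disjI2 prod.cong, auto)
    have 2: "L j - (\<Sum>T | T \<in> insert S (set Ss) \<and> j \<in> T. ln (real ((l(S := d)) T))) =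
      shift S (ln (real d)) L j - (\<Sum>T | T \<in> set Ss \<and> j \<in> T. ln (real (l T)))" for j
    proof (cases "j \<in> S")
      case True
      have "{T. T \<in> insert S (set Ss) \<and> j \<in> T} = insert S {T. T \<in> set Ss \<and> j \<in> T}" using True by auto
      hence "(\<Sum>T | T \<in> insert S (set Ss) \<and> j \<in> T. ln (real ((l(S := d)) T))) =
        ln (real d) + (\<Sum>T | T \<in> set Ss \<and> j \<in> T. ln (real ((l(S := d)) T)))"
        using S by simp
      also have "(\<Sum>T | T \<in> set Ss \<and> j \<in> T. ln (real ((l(S := d)) T))) = (\<Sum>T | T \<in> set Ss \<and> j \<in> T. ln (real (l T)))"
        using S by (intro sum.cong) auto
      finally show ?thesis using True by (simp add: shift_def)
    next
      case False
      hence "(\<Sum>T | T \<in> insert S (set Ss) \<and> j \<in> T. ln (real ((l(S := d)) T))) =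
        (\<Sum>T | T \<in> set Ss \<and> j \<in> T. ln (real (l T)))"
        using S by (intro sum.cong) auto
      thus ?thesis using False by (simp add: shift_def)
    qed
    show "(\<Prod>T\<in>insert S (set Ss). 1 / real ((l(S := d)) T)) *
      orthant n (\<lambda>j. L j - (\<Sum>T | T \<in> insert S (set Ss) \<and> j \<in> T. ln (real ((l(S := d)) T)))) =
      1 / real d * ((\<Prod>T\<in>set Ss. 1 / real (l T)) *
      orthant n (\<lambda>j. shift S (ln (real d)) L j - (\<Sum>T | T \<in> set Ss \<and> j \<in> T. ln (real (l T)))))"
      unfolding 1 2 by (simp only: mult.assoc)
  qed
  also have "\<dots> = (\<Sum>d=1..N. 1 / real d * iter_op n (sum_op N) Ss (shift S (ln (real d)) L))"
    using Cons by (simp add: sum.cartesian_product[symmetric] sum_distrib_left)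
  finally show ?case by (simp add: sum_op_def[of N S])
qed

lemma ln_face_divisor_sum:
  assumes fP: "finite P" "\<And>p. p \<in> P \<Longrightarrow> prime p" and \<sigma>: "\<And>p. p \<in> P \<Longrightarrow> \<sigma> p \<subseteq> J" and J: "finite J"
  shows "(\<Sum>S | S \<in> J \<and> j \<in> S. ln (real (face_divisor P \<sigma> S))) = face_shift P \<sigma> j"
proof -
  have "(\<Sum>S | S \<in> J \<and> j \<in> S. ln (real (face_divisor P \<sigma> S))) =
        (\<Sum>S | S \<in> J \<and> j \<in> S. \<Sum>p | p \<in> P \<and> S \<in> \<sigma> p. ln (real p))"
    unfolding face_divisor_def of_nat_prod
    by (intro sum.cong refl ln_prod) (use fP in \<open>auto simp: prime_gt_0_nat\<close>)
  also have "\<dots> = (\<Sum>p\<in>P. \<Sum>S | S \<in> {S. S \<in> J \<and> j \<in> S} \<and> S \<in> \<sigma> p. ln (real p))"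
    by (rule sum.swap_restrict) (use fP J in auto)
  also have "\<dots> = face_shift P \<sigma> j"
    unfolding face_shift_def
  proof (rule sum.cong)
    fix p assume p: "p \<in> P"
    have "{S. S \<in> {S. S \<in> J \<and> j \<in> S} \<and> S \<in> \<sigma> p} = {S\<in>\<sigma> p. j \<in> S}" using \<sigma>[OF p] by auto
    thus "(\<Sum>S | S \<in> {S. S \<in> J \<and> j \<in> S} \<and> S \<in> \<sigma> p. ln (real p)) = real (card {S\<in>\<sigma> p. j \<in> S}) * ln (real p)"
      by (simp only: sum_constant)
  qed simp
  finally show ?thesis .
qed

lemma prod_face_divisor:
  assumes fP: "finite P" and \<sigma>: "\<And>p. p \<in> P \<Longrightarrow> \<sigma> p \<subseteq> J" and J: "finite J"
  shows "(\<Prod>S\<in>J. 1 / real (face_divisor P \<sigma> S)) = (\<Prod>p\<in>P. 1 / real p ^ card (\<sigma> p))"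
proof -
  have "(\<Prod>S\<in>J. real (face_divisor P \<sigma> S)) = (\<Prod>S\<in>J. \<Prod>p | p \<in> P \<and> S \<in> \<sigma> p. real p)"
    by (simp add: face_divisor_def)
  also have "\<dots> = (\<Prod>p\<in>P. \<Prod>S | S \<in> J \<and> S \<in> \<sigma> p. real p)"
    by (rule prod.swap_restrict[OF J fP])
  also have "\<dots> = (\<Prod>p\<in>P. real p ^ card (\<sigma> p))"
  proof (rule prod.cong)
    fix p assume p: "p \<in> P"
    have "{S. S \<in> J \<and> S \<in> \<sigma> p} = \<sigma> p" using \<sigma>[OF p] by auto
    thus "(\<Prod>S | S \<in> J \<and> S \<in> \<sigma> p. real p) = real p ^ card (\<sigma> p)" by simp
  qed simp
  finally show ?thesis by (simp add: prod_dividef)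
qed

lemma U_expansion:
  assumes n: "1 \<le> n" and x: "0 < x" "x \<le> real N" and Ss: "distinct Ss" "set Ss = proper_faces n"
    and P: "P = {p. prime p \<and> p \<le> N}"
  shows "U n x = (\<Sum>\<sigma>\<in>PiE P (\<lambda>_. Pow (proper_faces n)).
    (\<Prod>p\<in>P. nested_mobius (\<sigma> p) / real p ^ card (\<sigma> p)) *
    iter_op n (sum_op N) Ss (\<lambda>j. ln x - face_shift P \<sigma> j))"
proof -
  let ?J = "proper_faces n"
  let ?X = "?J \<rightarrow>\<^sub>E {1..N}"
  let ?Y = "PiE P (\<lambda>_. Pow ?J)"
  let ?g = "\<lambda>\<sigma>. \<Prod>p\<in>P. nested_mobius (\<sigma> p)"
  let ?h = "\<lambda>d. of_bool (\<forall>j\<in>{1..n}. real (face_prod n d j) \<le> x) * (\<Prod>S\<in>?J. 1 / real (d S))"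
  have fP: "finite P" by (rule finite_subset[of _ "{..N}"]) (auto simp: P)
  have "U n x = (\<Sum>d\<in>?X. of_bool (nested_tuple n d) * ?h d)"
    by (rule U_nested[OF n x(2)])
  also have "\<dots> = (\<Sum>d\<in>?X. \<Sum>\<sigma>\<in>?Y. ?g \<sigma> * (of_bool (\<forall>S\<in>?J. face_divisor P \<sigma> S dvd d S) * ?h d))"
    by (rule sum.cong[OF refl]) (simp only: nested_tuple_expand[OF _ P] sum_distrib_right mult.assoc)
  also have "\<dots> = (\<Sum>\<sigma>\<in>?Y. ?g \<sigma> * (\<Sum>d\<in>?X. of_bool (\<forall>S\<in>?J. face_divisor P \<sigma> S dvd d S) * ?h d))"
    unfolding sum_distrib_left by (rule sum.swap)
  also have "\<dots> = (\<Sum>\<sigma>\<in>?Y. (\<Prod>p\<in>P. nested_mobius (\<sigma> p) / real p ^ card (\<sigma> p)) *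
    iter_op n (sum_op N) Ss (\<lambda>j. ln x - face_shift P \<sigma> j))"
  proof (rule sum.cong)
    fix \<sigma> assume \<sigma>: "\<sigma> \<in> ?Y"
    have sub: "\<sigma> p \<subseteq> ?J" if "p \<in> P" for p using \<sigma> that by (auto simp: PiE_def Pi_def)
    have k: "1 \<le> face_divisor P \<sigma> S" for S
      unfolding face_divisor_def by (simp add: Suc_le_eq prod_pos P prime_gt_0_nat)
    have "(\<Sum>d\<in>?X. of_bool (\<forall>S\<in>?J. face_divisor P \<sigma> S dvd d S) * ?h d) =
      (\<Prod>S\<in>?J. 1 / real (face_divisor P \<sigma> S)) *
      (\<Sum>l\<in>?X. (\<Prod>S\<in>?J. 1 / real (l S)) *
      orthant n (\<lambda>j. ln x - (\<Sum>S | S \<in> ?J \<and> j \<in> S. ln (real (face_divisor P \<sigma> S)))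
        - (\<Sum>S | S \<in> ?J \<and> j \<in> S. ln (real (l S)))))"
      by (rule sum_multiples_rescale[OF k x])
    also have "\<dots> = (\<Prod>p\<in>P. 1 / real p ^ card (\<sigma> p)) * iter_op n (sum_op N) Ss (\<lambda>j. ln x - face_shift P \<sigma> j)"
      unfolding iter_sum_op_eq[OF Ss(1)] Ss(2)
      by (subst prod_face_divisor[OF fP sub], assumption, simp,
          subst ln_face_divisor_sum[OF fP _ sub], simp add: P, assumption, simp, simp)
    finally show "?g \<sigma> * (\<Sum>d\<in>?X. of_bool (\<forall>S\<in>?J. face_divisor P \<sigma> S dvd d S) * ?h d) =
       (\<Prod>p\<in>P. nested_mobius (\<sigma> p) / real p ^ card (\<sigma> p)) *
         iter_op n (sum_op N) Ss (\<lambda>j. ln x - face_shift P \<sigma> j)"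
      by (simp add: prod_dividef)
  qed simp
  finally show ?thesis .
qed

section \<open>The Euler product\<close>

definition proper_subsets :: "'a set \<Rightarrow> 'a set set" where
  "proper_subsets X = {S. S \<subset> X \<and> S \<noteq> {}}"

definition chain_sum :: "'a set \<Rightarrow> real \<Rightarrow> real" where
  "chain_sum X y = (\<Sum>\<sigma> | \<sigma> \<subseteq> proper_subsets X \<and> nested \<sigma>. y ^ card \<sigma>)"

lemma finite_proper_subsets: "finite X \<Longrightarrow> finite (proper_subsets X)"
  by (rule finite_subset[of _ "Pow X"]) (auto simp: proper_subsets_def)

text \<open>A nonempty chain is split into its largest member \<open>S\<close> and a chain of proper
  nonempty subsets of \<open>S\<close>.\<close>

lemma chain_sum_rec:
  assumes X: "finite X"
  shows "chain_sum X y = 1 + y * (\<Sum>S\<in>proper_subsets X. chain_sum S y)"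
proof -
  let ?C = "\<lambda>X. {\<sigma>. \<sigma> \<subseteq> proper_subsets X \<and> nested \<sigma>}"
  let ?A = "\<lambda>S. insert S ` ?C S"
  have fC: "finite (?C S)" if "finite S" for S :: "'a set"
    by (rule finite_subset[of _ "Pow (proper_subsets S)"]) (auto simp: finite_proper_subsets that)
  have fS: "finite S" if "S \<in> proper_subsets X" for S
    using that X by (auto simp: proper_subsets_def intro: finite_subset)
  have un: "\<Union>(insert S \<tau>) = S" if "\<tau> \<in> ?C S" for S :: "'a set" and \<tau>
    using that by (auto simp: proper_subsets_def)
  have nin: "S \<notin> \<tau>" if "\<tau> \<in> ?C S" for S :: "'a set" and \<tau>
    using that by (auto simp: proper_subsets_def)
  have "?C X = insert {} (\<Union>S\<in>proper_subsets X. ?A S)"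
  proof (intro equalityI subsetI)
    fix \<sigma> assume \<sigma>: "\<sigma> \<in> ?C X"
    show "\<sigma> \<in> insert {} (\<Union>S\<in>proper_subsets X. ?A S)"
    proof (cases "\<sigma> = {}")
      case False
      have "finite \<sigma>" using \<sigma> X by (auto intro: finite_subset finite_proper_subsets)
      hence U: "\<Union>\<sigma> \<in> \<sigma>" using \<sigma> False by (intro nested_Union_in) auto
      have "\<sigma> - {\<Union>\<sigma>} \<in> ?C (\<Union>\<sigma>)"
        using \<sigma> nested_subset[of \<sigma> "\<sigma> - {\<Union>\<sigma>}"] by (auto simp: proper_subsets_def)
      moreover have "\<sigma> = insert (\<Union>\<sigma>) (\<sigma> - {\<Union>\<sigma>})" using U by blast
      ultimately have "\<sigma> \<in> ?A (\<Union>\<sigma>)" by blast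
      moreover have "\<Union>\<sigma> \<in> proper_subsets X" using U \<sigma> by blast
      ultimately show ?thesis by blast
    qed simp
  next
    fix \<sigma> assume "\<sigma> \<in> insert {} (\<Union>S\<in>proper_subsets X. ?A S)"
    then consider "\<sigma> = {}" | S \<tau> where "S \<in> proper_subsets X" "\<tau> \<in> ?C S" "\<sigma> = insert S \<tau>" by blast
    thus "\<sigma> \<in> ?C X"
    proof cases
      case 2
      thus ?thesis by (auto simp: proper_subsets_def nested_def)
    qed (simp add: nested_def)
  qed
  hence "chain_sum X y = (\<Sum>\<sigma>\<in>insert {} (\<Union>S\<in>proper_subsets X. ?A S). y ^ card \<sigma>)"
    by (simp add: chain_sum_def)
  also have "\<dots> = 1 + (\<Sum>\<sigma>\<in>(\<Union>S\<in>proper_subsets X. ?A S). y ^ card \<sigma>)"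
    by (subst sum.insert) (auto simp: finite_proper_subsets X fC fS)
  also have "(\<Sum>\<sigma>\<in>(\<Union>S\<in>proper_subsets X. ?A S). y ^ card \<sigma>) = (\<Sum>S\<in>proper_subsets X. \<Sum>\<sigma>\<in>?A S. y ^ card \<sigma>)"
  proof (rule sum.UNION_disjoint)
    show "\<forall>S\<in>proper_subsets X. \<forall>T\<in>proper_subsets X. S \<noteq> T \<longrightarrow> ?A S \<inter> ?A T = {}"
    proof (intro ballI impI)
      fix S T :: "'a set" assume "S \<noteq> T"
      show "?A S \<inter> ?A T = {}"
      proof (rule ccontr)
        assume "?A S \<inter> ?A T \<noteq> {}"
        then obtain \<tau> \<rho> where "\<tau> \<in> ?C S" "\<rho> \<in> ?C T" "insert S \<tau> = insert T \<rho>" by blast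
        thus False using un[of \<tau> S] un[of \<rho> T] \<open>S \<noteq> T\<close> by metis
      qed
    qed
  qed (auto simp: finite_proper_subsets X fC fS)
  also have "\<dots> = (\<Sum>S\<in>proper_subsets X. y * chain_sum S y)"
  proof (rule sum.cong)
    fix S assume S: "S \<in> proper_subsets X"
    have "inj_on (insert S) (?C S)"
    proof (rule inj_onI)
      fix \<tau> \<rho> assume "\<tau> \<in> ?C S" "\<rho> \<in> ?C S" "insert S \<tau> = insert S \<rho>"
      thus "\<tau> = \<rho>" using nin[of \<tau> S] nin[of \<rho> S] by (simp add: insert_ident)
    qed
    hence "(\<Sum>\<sigma>\<in>?A S. y ^ card \<sigma>) = (\<Sum>\<tau>\<in>?C S. y ^ card (insert S \<tau>))"
      by (simp add: sum.reindex o_def)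
    also have "\<dots> = (\<Sum>\<tau>\<in>?C S. y * y ^ card \<tau>)"
    proof (rule sum.cong)
      fix \<tau> assume \<tau>: "\<tau> \<in> ?C S"
      have "finite \<tau>" using \<tau> finite_proper_subsets[OF fS[OF S]] by (auto intro: finite_subset)
      thus "y ^ card (insert S \<tau>) = y * y ^ card \<tau>" using nin[OF \<tau>] by simp
    qed simp
    finally show "(\<Sum>\<sigma>\<in>?A S. y ^ card \<sigma>) = y * chain_sum S y"
      by (simp add: chain_sum_def sum_distrib_left)
  qed simp
  finally show ?thesis by (simp add: sum_distrib_left)
qed

lemma summable_power_geometric:
  fixes q :: real
  assumes "\<bar>q\<bar> < 1"
  shows "summable (\<lambda>k. real k ^ m * q ^ k)"
  using assms
proof (induction m arbitrary: q)
  case 0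
  then show ?case by (simp add: summable_geometric)
next
  case (Suc m)
  \<comment> \<open>Termwise differentiation raises the power of \<open>k\<close> by one.\<close>
  have "summable (\<lambda>k. diffs (\<lambda>k. real k ^ m) k * q ^ k)"
    by (rule termdiff_converges[where K = 1]) (use Suc in auto)
  from summable_mult[OF this, of q] have "summable (\<lambda>k. real (Suc k) ^ Suc m * q ^ Suc k)"
    by (simp add: diffs_def mult_ac)
  thus ?case using summable_Suc_iff[of "\<lambda>k. real k ^ Suc m * q ^ k"] by blast
qed

lemma summable_power_diff_geometric:
  fixes q :: real
  assumes "\<bar>q\<bar> < 1" "q \<noteq> 0"
  shows "summable (\<lambda>k. (real k + 1) ^ n * q ^ k)"
    and "summable (\<lambda>k. ((real k + 1) ^ n - real k ^ n) * q ^ k)"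
proof -
  have "summable (\<lambda>k. real (Suc k) ^ n * q ^ Suc k)"
    using summable_power_geometric[OF assms(1), of n] summable_Suc_iff[of "\<lambda>k. real k ^ n * q ^ k"] by blast
  from summable_mult[OF this, of "1 / q"] show "summable (\<lambda>k. (real k + 1) ^ n * q ^ k)"
    using assms(2) by (simp add: mult_ac add.commute)
  from summable_diff[OF this summable_power_geometric[OF assms(1), of n]]
  show "summable (\<lambda>k. ((real k + 1) ^ n - real k ^ n) * q ^ k)"
    by (simp add: left_diff_distrib)
qed

text \<open>The series satisfies the recursion of \<open>chain_sum_rec\<close>: expanding
  \<open>(k + 1) ^ card X\<close> over the subsets of \<open>X\<close> expresses it by the power
  series \<open>\<Theta>\<close> of the smaller cardinalities, and an index shift converts these
  back.\<close>

lemma chain_sum_eq_series: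
  fixes q :: real
  assumes X: "finite X" "X \<noteq> {}" and q: "0 < q" "q < 1"
  shows "chain_sum X (q / (1 - q)) = (1 - q) * (\<Sum>k. ((real k + 1) ^ card X - real k ^ card X) * q ^ k)"
proof -
  define \<Theta> where "\<Theta> m = (\<Sum>k. real k ^ m * q ^ k)" for m
  define G where "G m = (1 - q) * (\<Sum>k. ((real k + 1) ^ m - real k ^ m) * q ^ k)" for m
  have q': "\<bar>q\<bar> < 1" "q \<noteq> 0" using q by auto
  have pf: "Pow X = insert X (insert {} (proper_subsets X))" for X :: "'a set"
    by (auto simp: proper_subsets_def)
  have s1: "(\<Sum>k. (real k + 1) ^ card X * q ^ k) = (\<Sum>S\<in>Pow X. \<Theta> (card S))" if "finite X" for X :: "'a set"
  proof -
    have "(real k + 1) ^ card X * q ^ k = (\<Sum>S\<in>Pow X. real k ^ card S * q ^ k)" for k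
      using prod_add[OF that, of "\<lambda>_. real k" "\<lambda>_. 1"] by (simp add: sum_distrib_right)
    thus ?thesis
      unfolding \<Theta>_def by (simp add: suminf_sum summable_power_geometric[OF q'(1)])
  qed
  \<comment> \<open>The index shift drops the term \<open>k = 0\<close>, which vanishes only for
    positive \<open>m\<close>; the case \<open>m = 0\<close> is \<open>th0\<close> and supplies the
    summand \<open>1\<close> of the recursion.\<close>
  have s2: "q * (\<Sum>k. (real k + 1) ^ m * q ^ k) = \<Theta> m" if "m > 0" for m
  proof -
    have "\<Theta> m = (\<Sum>k. real (Suc k) ^ m * q ^ Suc k)"
      unfolding \<Theta>_def using suminf_split_head[OF summable_power_geometric[OF q'(1), of m]] that by simp
    also have "\<dots> = (\<Sum>k. q * ((real k + 1) ^ m * q ^ k))" by (simp add: mult_ac add.commute)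
    also have "\<dots> = q * (\<Sum>k. (real k + 1) ^ m * q ^ k)"
      by (rule suminf_mult[OF summable_power_diff_geometric(1)[OF q']])
    finally show ?thesis ..
  qed
  have s3: "G m = (1 - q) * ((\<Sum>k. (real k + 1) ^ m * q ^ k) - \<Theta> m)" for m
    unfolding G_def \<Theta>_def
    using suminf_diff[OF summable_power_diff_geometric(1)[OF q', of m] summable_power_geometric[OF q'(1), of m]]
    by (simp only: left_diff_distrib[of "(real k + 1) ^ m" "real k ^ m" "q ^ k" for k])
  have s4: "(1 - q) * \<Theta> m = q / (1 - q) * G m" if "m > 0" for m
  proof -
    have "q / (1 - q) * G m = q * ((\<Sum>k. (real k + 1) ^ m * q ^ k) - \<Theta> m)"
      using q by (simp add: s3)
    thus ?thesis using s2[OF that] by (simp add: algebra_simps)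
  qed
  have th0: "(1 - q) * \<Theta> 0 = 1"
    using q suminf_geometric[of q] by (simp add: \<Theta>_def)
  have Grec: "G (card X) = 1 + q / (1 - q) * (\<Sum>S\<in>proper_subsets X. G (card S))"
    if X: "finite X" "X \<noteq> {}" for X :: "'a set"
  proof -
    have "(\<Sum>S\<in>Pow X. \<Theta> (card S)) = \<Theta> (card X) + (\<Theta> 0 + (\<Sum>S\<in>proper_subsets X. \<Theta> (card S)))"
      unfolding pf using X finite_proper_subsets[OF X(1)]
      by (subst sum.insert; simp add: proper_subsets_def)
    hence "G (card X) = (1 - q) * (\<Theta> 0 + (\<Sum>S\<in>proper_subsets X. \<Theta> (card S)))"
      unfolding s3 s1[OF X(1)] by simp
    also have "\<dots> = 1 + (\<Sum>S\<in>proper_subsets X. (1 - q) * \<Theta> (card S))"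
      by (simp add: distrib_left th0 sum_distrib_left)
    also have "(\<Sum>S\<in>proper_subsets X. (1 - q) * \<Theta> (card S)) = (\<Sum>S\<in>proper_subsets X. q / (1 - q) * G (card S))"
    proof (rule sum.cong)
      fix S assume "S \<in> proper_subsets X"
      hence "0 < card S" using X by (auto simp: proper_subsets_def card_gt_0_iff intro: finite_subset)
      thus "(1 - q) * \<Theta> (card S) = q / (1 - q) * G (card S)" by (rule s4)
    qed simp
    finally show ?thesis by (simp add: sum_distrib_left)
  qed
  have "chain_sum X (q / (1 - q)) = G (card X)"
    using X
  proof (induction "card X" arbitrary: X rule: less_induct)
    case less
    have "(\<Sum>S\<in>proper_subsets X. chain_sum S (q / (1 - q))) = (\<Sum>S\<in>proper_subsets X. G (card S))"
    proof (rule sum.cong)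
      fix S assume "S \<in> proper_subsets X"
      thus "chain_sum S (q / (1 - q)) = G (card S)"
        using less.prems by (intro less.hyps) (auto simp: proper_subsets_def psubset_card_mono intro: finite_subset)
    qed simp
    thus ?case using chain_sum_rec[OF less.prems(1)] Grec[OF less.prems] by simp
  qed
  thus ?thesis by (simp add: G_def)
qed

text \<open>For \<open>0 \<le> q\<close> both sides are the probability that a random subset of
  \<open>J\<close>, containing each element independently with probability \<open>q\<close>, is
  nested. The proof is the corresponding exchange of summation.\<close>

lemma sum_nested_mobius_power:
  fixes q :: real
  assumes J: "finite J" and q: "q < 1"
  shows "(\<Sum>X\<in>Pow J. nested_mobius X * q ^ card X) =
    (1 - q) ^ card J * (\<Sum>Y | Y \<subseteq> J \<and> nested Y. (q / (1 - q)) ^ card Y)"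
proof -
  have "(1 - q) ^ card J * (\<Sum>Y | Y \<subseteq> J \<and> nested Y. (q / (1 - q)) ^ card Y) =
    (1 - q) ^ card J * (\<Sum>Y\<in>Pow J. of_bool (nested Y) * (q / (1 - q)) ^ card Y)"
    using J by (intro arg_cong[where f = "\<lambda>x. (1 - q) ^ card J * x"] sum.mono_neutral_cong_left) auto
  also have "\<dots> = (\<Sum>Y\<in>Pow J. of_bool (nested Y) * (q ^ card Y * (1 - q) ^ card (J - Y)))"
    unfolding sum_distrib_left
  proof (rule sum.cong)
    fix Y assume "Y \<in> Pow J"
    hence Y: "Y \<subseteq> J" "finite Y" using J finite_subset by auto
    have "card J = card Y + card (J - Y)" using Y J by (simp add: card_Diff_subset card_mono)
    thus "(1 - q) ^ card J * (of_bool (nested Y) * (q / (1 - q)) ^ card Y) =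
      of_bool (nested Y) * (q ^ card Y * (1 - q) ^ card (J - Y))"
      using q by (simp add: power_add power_divide)
  qed simp
  also have "\<dots> = (\<Sum>Y\<in>Pow J. \<Sum>X | X \<in> Pow J \<and> X \<subseteq> Y. nested_mobius X * (q ^ card Y * (1 - q) ^ card (J - Y)))"
  proof (rule sum.cong)
    fix Y assume Y: "Y \<in> Pow J"
    have "{X. X \<in> Pow J \<and> X \<subseteq> Y} = Pow Y" using Y by auto
    thus "of_bool (nested Y) * (q ^ card Y * (1 - q) ^ card (J - Y)) =
      (\<Sum>X | X \<in> Pow J \<and> X \<subseteq> Y. nested_mobius X * (q ^ card Y * (1 - q) ^ card (J - Y)))"
      using sum_nested_mobius[of Y] Y J by (simp add: sum_distrib_right[symmetric] finite_subset)
  qed simp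
  also have "\<dots> = (\<Sum>X\<in>Pow J. \<Sum>Y | Y \<in> Pow J \<and> X \<subseteq> Y. nested_mobius X * (q ^ card Y * (1 - q) ^ card (J - Y)))"
    by (rule sum.swap_restrict) (use J in auto)
  also have "\<dots> = (\<Sum>X\<in>Pow J. nested_mobius X * q ^ card X)"
  proof (rule sum.cong)
    fix X assume "X \<in> Pow J"
    hence X: "X \<subseteq> J" "finite X" using J finite_subset by auto
    have "bij_betw (\<lambda>Z. X \<union> Z) (Pow (J - X)) {Y. Y \<in> Pow J \<and> X \<subseteq> Y}"
      by (rule bij_betw_byWitness[where f' = "\<lambda>Y. Y - X"]) (use X in auto)
    hence "(\<Sum>Y | Y \<in> Pow J \<and> X \<subseteq> Y. q ^ card Y * (1 - q) ^ card (J - Y)) =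
      (\<Sum>Z\<in>Pow (J - X). q ^ card (X \<union> Z) * (1 - q) ^ card (J - (X \<union> Z)))"
      by (rule sum.reindex_bij_betw[symmetric])
    also have "\<dots> = (\<Sum>Z\<in>Pow (J - X). q ^ card X * (q ^ card Z * (1 - q) ^ card (J - X - Z)))"
    proof (rule sum.cong)
      fix Z assume "Z \<in> Pow (J - X)"
      hence "card (X \<union> Z) = card X + card Z"
        using X J by (intro card_Un_disjoint) (auto intro: finite_subset)
      thus "q ^ card (X \<union> Z) * (1 - q) ^ card (J - (X \<union> Z)) =
        q ^ card X * (q ^ card Z * (1 - q) ^ card (J - X - Z))"
        by (simp add: power_add Diff_eq Int_assoc)
    qed simp
    also have "\<dots> = q ^ card X"
      unfolding sum_distrib_left[symmetric]
      using prod_add[of "J - X" "\<lambda>_. q" "\<lambda>_. 1 - q"] J by simp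
    finally show "(\<Sum>Y | Y \<in> Pow J \<and> X \<subseteq> Y. nested_mobius X * (q ^ card Y * (1 - q) ^ card (J - Y))) =
      nested_mobius X * q ^ card X"
      by (simp add: sum_distrib_left[symmetric])
  qed simp
  finally show ?thesis ..
qed

section \<open>Local factors and convergence of the product\<close>

lemma card_proper_faces:
  assumes "1 \<le> n"
  shows "card (proper_faces n) = 2 ^ n - 2"
proof -
  have "proper_faces n = Pow {1..n} - {{}, {1..n}}" by (auto simp: proper_faces_def)
  moreover have "card {{}, {1..n}} = 2" using assms by auto
  ultimately show ?thesis by (simp add: card_Diff_subset card_Pow)
qed

lemma local_term_eq: "local_term n p k = ((real k + 1) ^ n - real k ^ n) * (1 / real p) ^ k"
  by (simp add: local_term_def power_divide)

lemma summable_local_term: "prime p \<Longrightarrow> summable (local_term n p)"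
  unfolding local_term_eq[abs_def]
  by (rule summable_power_diff_geometric) (use prime_gt_1_nat[of p] in auto)

abbreviation mobius_factor :: "nat \<Rightarrow> nat \<Rightarrow> real" where
  "mobius_factor n p \<equiv> (\<Sum>X\<in>Pow (proper_faces n). nested_mobius X / real p ^ card X)"

text \<open>Of the \<open>2 ^ n - 1\<close> factors \<open>1 - 1 / p\<close>, all but one come from
  the proper faces through \<open>sum_nested_mobius_power\<close>; the last one comes from the chain
  series.\<close>

lemma euler_factor_eq:
  assumes n: "1 \<le> n" and p: "prime p"
  shows "euler_factor n p = mobius_factor n p"
proof -
  define q where "q = 1 / real p"
  have q: "0 < q" "q < 1" using prime_gt_1_nat[OF p] by (auto simp: q_def)
  have J: "proper_faces n = proper_subsets {1..n}" by (auto simp: proper_faces_def proper_subsets_def)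
  have "mobius_factor n p =
     (\<Sum>X\<in>Pow (proper_faces n). nested_mobius X * q ^ card X)"
    by (simp add: q_def power_divide)
  also have "\<dots> = (1 - q) ^ (2 ^ n - 2) * chain_sum {1..n} (q / (1 - q))"
    using sum_nested_mobius_power[OF finite_proper_faces q(2), of n]
    by (simp only: card_proper_faces[OF n, unfolded J] chain_sum_def J)
  also have "\<dots> = (1 - q) ^ (2 ^ n - 2) * ((1 - q) * (\<Sum>k. ((real k + 1) ^ n - real k ^ n) * q ^ k))"
    using chain_sum_eq_series[of "{1..n}" q] q n by simp
  also have "\<dots> = (1 - q) ^ Suc (2 ^ n - 2) * (\<Sum>k. local_term n p k)"
    by (simp add: local_term_eq q_def mult_ac)
  also have "Suc (2 ^ n - 2) = 2 ^ n - (1::nat)"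
    using n self_le_power[of "2::nat" n] by simp
  finally show ?thesis using p by (simp add: euler_factor_def q_def)
qed

lemma euler_factor_pos:
  assumes n: "1 \<le> n"
  shows "0 < euler_factor n p"
proof (cases "prime p")
  case True
  have "0 < (\<Sum>k. local_term n p k)"
  proof (rule suminf_pos2[OF summable_local_term[OF True], of _ 0])
    show "0 \<le> local_term n p k" for k
      by (simp add: local_term_def power_mono)
    show "0 < local_term n p 0" using n by (simp add: local_term_def power_0_left)
  qed
  thus ?thesis using True prime_gt_1_nat[OF True] by (auto simp: euler_factor_def intro!: mult_pos_pos zero_less_power)
qed (simp add: euler_factor_def)

lemma nested_mobius_small: "nested_mobius {} = 1" "nested_mobius {S} = 0"
proof -
  show "nested_mobius {} = 1" by (simp add: nested_mobius_def nested_def)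
  have "Pow {S} = {{}, {S}}" by auto
  thus "nested_mobius {S} = 0" by (simp add: nested_mobius_def nested_def)
qed

text \<open>Singletons have weight zero, so beyond the empty set only sets with at least two
  elements contribute, and for these \<open>t ^ card X \<le> t\<^sup>2\<close>.\<close>

lemma nested_mobius_sum_bounds:
  fixes t :: real
  assumes J: "finite J" and t: "0 \<le> t" "t \<le> 1"
  shows "(\<Sum>X\<in>Pow J. \<bar>nested_mobius X\<bar> * t ^ card X) \<le> 1 + (\<Sum>X\<in>Pow J. \<bar>nested_mobius X\<bar>) * t\<^sup>2"
    and "\<bar>(\<Sum>X\<in>Pow J. nested_mobius X * t ^ card X) - 1\<bar> \<le> (\<Sum>X\<in>Pow J. \<bar>nested_mobius X\<bar>) * t\<^sup>2"
proof -
  let ?P = "Pow J - {{}}"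
  have b: "\<bar>nested_mobius X\<bar> * t ^ card X \<le> \<bar>nested_mobius X\<bar> * t\<^sup>2" if X: "X \<in> ?P" for X
  proof (cases "card X \<ge> 2")
    case True
    thus ?thesis using t by (intro mult_left_mono power_decreasing) auto
  next
    case False
    moreover have "finite X" using X J by (auto intro: finite_subset)
    ultimately have "card X = 1" using X by (metis Diff_iff One_nat_def Suc_1 card_0_eq insertCI less_2_cases not_le)
    then obtain S where "X = {S}" by (auto simp: card_1_singleton_iff)
    thus ?thesis by (simp add: nested_mobius_small)
  qed
  have P: "Pow J = insert {} ?P" by auto
  have c: "(\<Sum>X\<in>?P. \<bar>nested_mobius X\<bar> * t ^ card X) \<le> (\<Sum>X\<in>Pow J. \<bar>nested_mobius X\<bar>) * t\<^sup>2"
  proof -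
    have "(\<Sum>X\<in>?P. \<bar>nested_mobius X\<bar> * t ^ card X) \<le> (\<Sum>X\<in>?P. \<bar>nested_mobius X\<bar> * t\<^sup>2)"
      by (rule sum_mono[OF b])
    also have "\<dots> \<le> (\<Sum>X\<in>Pow J. \<bar>nested_mobius X\<bar> * t\<^sup>2)"
      using J by (intro sum_mono2) auto
    finally show ?thesis by (simp add: sum_distrib_right)
  qed
  have "(\<Sum>X\<in>Pow J. \<bar>nested_mobius X\<bar> * t ^ card X) = 1 + (\<Sum>X\<in>?P. \<bar>nested_mobius X\<bar> * t ^ card X)"
    using J by (subst P, subst sum.insert) (auto simp: nested_mobius_small)
  thus "(\<Sum>X\<in>Pow J. \<bar>nested_mobius X\<bar> * t ^ card X) \<le> 1 + (\<Sum>X\<in>Pow J. \<bar>nested_mobius X\<bar>) * t\<^sup>2"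
    using c by simp
  have "(\<Sum>X\<in>Pow J. nested_mobius X * t ^ card X) = 1 + (\<Sum>X\<in>?P. nested_mobius X * t ^ card X)"
    using J by (subst P, subst sum.insert) (auto simp: nested_mobius_small)
  hence "\<bar>(\<Sum>X\<in>Pow J. nested_mobius X * t ^ card X) - 1\<bar> \<le> (\<Sum>X\<in>?P. \<bar>nested_mobius X * t ^ card X\<bar>)"
    using sum_abs[of "\<lambda>X. nested_mobius X * t ^ card X" ?P] by simp
  also have "\<dots> = (\<Sum>X\<in>?P. \<bar>nested_mobius X\<bar> * t ^ card X)" using t by (simp add: abs_mult)
  finally show "\<bar>(\<Sum>X\<in>Pow J. nested_mobius X * t ^ card X) - 1\<bar> \<le> (\<Sum>X\<in>Pow J. \<bar>nested_mobius X\<bar>) * t\<^sup>2"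
    using c by simp
qed

lemma convergent_prod_euler_factor:
  assumes n: "1 \<le> n"
  shows "convergent_prod (euler_factor n)"
proof -
  let ?C = "\<Sum>X\<in>Pow (proper_faces n). \<bar>nested_mobius X\<bar>"
  have "norm (euler_factor n p - 1) \<le> ?C * (1 / real p ^ 2)" for p
  proof (cases "prime p")
    case True
    have "1 / real p \<le> 1" using prime_gt_0_nat[OF True] by simp
    thus ?thesis
      using nested_mobius_sum_bounds(2)[OF finite_proper_faces, of "1 / real p" n]
      by (simp add: euler_factor_eq[OF n True] power_divide)
  qed (simp add: euler_factor_def sum_nonneg)
  moreover have "summable (\<lambda>p. ?C * (1 / real p ^ 2))"
    using inverse_power_summable[of 2, where 'a = real] by (intro summable_mult) (simp add: inverse_eq_divide power_divide)
  ultimately have "summable (\<lambda>p. norm (euler_factor n p - 1))"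
    using summable_comparison_test'[of "\<lambda>p. ?C * (1 / real p ^ 2)" 0 "\<lambda>p. norm (euler_factor n p - 1)"]
    by (simp only: real_norm_def abs_idempotent)
  thus ?thesis
    by (intro abs_convergent_prod_imp_convergent_prod) (simp add: abs_convergent_prod_conv_summable)
qed

lemma euler_product_tendsto:
  assumes n: "1 \<le> n"
  shows "(\<lambda>N. \<Prod>p | prime p \<and> p \<le> N. mobius_factor n p)
           \<longlonglongrightarrow> C_const n"
proof -
  have "(\<Prod>p | prime p \<and> p \<le> N. mobius_factor n p) =
    (\<Prod>p\<le>N. euler_factor n p)" for N
  proof (rule prod.mono_neutral_cong_left)
    show "\<forall>p\<in>{..N} - {p. prime p \<and> p \<le> N}. euler_factor n p = 1"
      by (auto simp: euler_factor_def)
  qed (auto simp: euler_factor_eq[OF n])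
  thus ?thesis
    using convergent_prod_LIMSEQ[OF convergent_prod_euler_factor[OF n]] by (simp add: C_const_def)
qed

lemma C_const_pos:
  assumes n: "1 \<le> n"
  shows "0 < C_const n"
proof -
  have "0 \<le> C_const n"
    unfolding C_const_def
    by (rule LIMSEQ_le_const[OF convergent_prod_LIMSEQ[OF convergent_prod_euler_factor[OF n]]])
       (intro exI[of _ 0] allI impI prod_nonneg less_imp_le[OF euler_factor_pos[OF n]])
  \<comment> \<open>Positive factors alone leave zero as a possible limit; convergence in the strict
    sense of infinite products excludes it.\<close>
  moreover have "C_const n \<noteq> 0"
    unfolding C_const_def
    by (rule prodinf_nonzero[OF convergent_prod_euler_factor[OF n]]) (use euler_factor_pos[OF n] in \<open>auto simp: less_imp_neq[THEN not_sym]\<close>)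
  ultimately show ?thesis by simp
qed

section \<open>The integral as an iterated logarithmic integral\<close>

text \<open>The orthant is a cone, and each substitution \<open>s \<mapsto> t * s\<close>
  contributes one factor \<open>t\<close>.\<close>

lemma iter_int_op_scale:
  assumes t: "0 < t"
  shows "iter_op n int_op Ss (\<lambda>j. t * L j) = t ^ length Ss * iter_op n int_op Ss L"
proof (induction Ss arbitrary: L)
  case Nil
  have "0 \<le> t * L j \<longleftrightarrow> 0 \<le> L j" for j using t by (simp add: zero_le_mult_iff)
  then show ?case by (simp add: orthant_def)
next
  case (Cons S Ss)
  let ?f = "iter_op n int_op Ss"
  have shift: "shift S (t * s) (\<lambda>j. t * L j) = (\<lambda>j. t * shift S s L j)" for s
    by (auto simp: shift_def algebra_simps)
  have "int_op S ?f (\<lambda>j. t * L j) = (LINT s|lborel. indicator {0..} s *\<^sub>R ?f (shift S s (\<lambda>j. t * L j)))"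
    by (simp add: int_op_def set_lebesgue_integral_def)
  also have "\<dots> = t * (LINT s|lborel. indicator {0..} (0 + t * s) *\<^sub>R ?f (shift S (0 + t * s) (\<lambda>j. t * L j)))"
    using t by (subst lborel_integral_real_affine[where c = t and t = 0]) auto
  also have "\<dots> = t * (LINT s|lborel. t ^ length Ss * (indicator {0..} s *\<^sub>R ?f (shift S s L)))"
    using t by (intro arg_cong[where f = "\<lambda>x. t * x"] Bochner_Integration.integral_cong)
      (auto simp: shift Cons.IH indicator_def zero_le_mult_iff)
  also have "\<dots> = t * (t ^ length Ss * int_op S ?f L)"
    by (simp add: int_op_def set_lebesgue_integral_def)
  finally show ?case by simp
qed

text \<open>A cube of side \<open>c\<close> fits into the polytope: restricting every integral to
  \<open>[0, c]\<close> lowers each coordinate by at most \<open>length Ss * c\<close> in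
  total.\<close>

lemma iter_int_op_lower:
  assumes "\<forall>S\<in>set Ss. face n S" and c: "0 \<le> c"
  shows "c ^ length Ss * orthant n (\<lambda>j. L j - real (length Ss) * c) \<le> iter_op n int_op Ss L"
  using assms(1)
proof (induction Ss arbitrary: L)
  case Nil
  then show ?case by simp
next
  case (Cons S Ss)
  let ?f = "iter_op n int_op Ss"
  have S: "face n S" using Cons.prems by simp
  have f: "orthant_mono n ?f" using Cons.prems by (intro orthant_mono_iter_op orthant_mono_int_op) auto
  have "c ^ length (S # Ss) * orthant n (\<lambda>j. L j - real (length (S # Ss)) * c)
    = c * (c ^ length Ss * orthant n (\<lambda>j. (L j - c) - real (length Ss) * c))"
    by (simp add: algebra_simps)
  also have "\<dots> \<le> c * ?f (\<lambda>j. L j - c)"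
    using Cons c by (intro mult_left_mono) auto
  also have "\<dots> \<le> c * ?f (shift S c L)"
    using c by (intro mult_left_mono orthant_mono_mono[OF f]) (auto simp: shift_def)
  also have "\<dots> \<le> int_op S ?f L"
    using int_op_step(2)[OF f S c, of L] int_op_nonneg[OF f, of S "shift S c L"] by (simp add: mult.commute)
  finally show ?case by simp
qed

lemma exp_substitution:
  assumes f: "orthant_mono n f" and S: "face n S"
  shows "(\<integral>\<^sup>+y. ennreal (indicator {1..} y / y * f (shift S (ln y) L)) \<partial>lborel) = ennreal (int_op S f L)"
proof -
  define B where "B = Max (insert 0 (L ` {1..n})) + 1"
  have B: "\<forall>j\<in>{1..n}. L j \<le> B - 1" "0 \<le> B"
  proof -
    have "a \<le> B - 1" if "a \<in> insert 0 (L ` {1..n})" for a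
      using Max_ge[OF _ that] by (simp add: B_def)
    from this[of 0] this[of "L j" for j] show "\<forall>j\<in>{1..n}. L j \<le> B - 1" "0 \<le> B" by auto
  qed
  have z: "f (shift S s L) = 0" if "s > B - 1" for s
    by (rule ray_zero[OF f S B(1) that])
  let ?F = "\<lambda>y. f (shift S (ln y) L) / y"
  have m: "?F \<in> borel_measurable borel"
    using measurable_compose[OF borel_measurable_ln[OF measurable_ident] ray_measurable[OF f, of S L]]
    by (intro borel_measurable_divide) auto
  have "(\<integral>\<^sup>+y. ennreal (indicator {1..} y / y * f (shift S (ln y) L)) \<partial>lborel) =
    (\<integral>\<^sup>+y. ennreal (?F y * indicator {exp 0..exp B} y) \<partial>lborel)"
  proof (rule nn_integral_cong)
    fix y :: real
    have "f (shift S (ln y) L) = 0" if "exp B < y"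
    proof (rule z)
      have "B < ln y" using that by (metis exp_gt_zero less_trans ln_exp ln_less_cancel_iff)
      thus "B - 1 < ln y" by simp
    qed
    thus "ennreal (indicator {1..} y / y * f (shift S (ln y) L)) = ennreal (?F y * indicator {exp 0..exp B} y)"
      by (auto simp: indicator_def)
  qed
  also have "\<dots> = (\<integral>\<^sup>+s. ennreal (?F (exp s) * exp s * indicator {0..B} s) \<partial>lborel)"
  proof (rule nn_integral_substitution)
    show "set_borel_measurable borel {exp 0..exp B} ?F"
      unfolding set_borel_measurable_def using m by (intro borel_measurable_scaleR borel_measurable_indicator) auto
  qed (use B in \<open>auto intro!: derivative_eq_intros continuous_intros\<close>)
  also have "\<dots> = (\<integral>\<^sup>+s. ennreal (indicator {0..} s * f (shift S s L)) \<partial>lborel)"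
  proof (rule nn_integral_cong)
    fix s :: real
    show "ennreal (?F (exp s) * exp s * indicator {0..B} s) = ennreal (indicator {0..} s * f (shift S s L))"
      using z[of s] by (auto simp: indicator_def)
  qed
  also have "\<dots> = ennreal (int_op S f L)"
    using ray_integrable[OF f S, of 0 L] orthant_mono_nonneg[OF f]
    unfolding int_op_def set_lebesgue_integral_def set_integrable_def
    by (subst nn_integral_eq_integral) auto
  finally show ?thesis .
qed

lemma orthant_eq_prod: "orthant n L = (\<Prod>j\<in>{1..n}. indicator {0..} (L j))"
  by (auto simp: orthant_def of_bool_def indicator_def prod_zero_iff)

text \<open>The index type is left open so that the variables of \<open>int_I\<close>, which are
  pairs, can be used directly, with \<open>w\<close> assigning a face to each. The indicator factors
  remove the points where the logarithm has no meaning.\<close>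

definition box_integrand :: "nat \<Rightarrow> 'i set \<Rightarrow> ('i \<Rightarrow> nat set) \<Rightarrow> (nat \<Rightarrow> real) \<Rightarrow> ('i \<Rightarrow> real) \<Rightarrow> real" where
  "box_integrand n I w L y = (\<Prod>i\<in>I. indicator {1..} (y i) / y i) *
     orthant n (\<lambda>j. L j - (\<Sum>i | i \<in> I \<and> j \<in> w i. ln (y i)))"

lemma box_integrand_measurable:
  assumes "finite I"
  shows "box_integrand n I w L \<in> borel_measurable (Pi\<^sub>M I (\<lambda>_. lborel))"
proof -
  have c: "(\<lambda>y. y i) \<in> borel_measurable (Pi\<^sub>M I (\<lambda>_. lborel))" if "i \<in> I" for i
    using measurable_component_singleton[OF that, of "\<lambda>_. lborel"] by simp
  have g: "(\<lambda>y. L j - (\<Sum>i | i \<in> I \<and> j \<in> w i. ln (y i))) \<in> borel_measurable (Pi\<^sub>M I (\<lambda>_. lborel))" for j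
    by (intro borel_measurable_diff borel_measurable_sum borel_measurable_ln c) auto
  have h: "indicator A \<in> borel_measurable borel" if "A \<in> sets borel" for A :: "real set"
    using that by simp
  show ?thesis
    unfolding box_integrand_def[abs_def] orthant_eq_prod
    by (intro borel_measurable_times borel_measurable_prod borel_measurable_divide c
        measurable_compose[OF g h] measurable_compose[OF c h]) auto
qed

text \<open>Nonnegative integrals allow Tonelli without prior integrability; peeling off one
  variable and substituting \<open>y = exp s\<close> is one application of
  \<open>int_op\<close>.\<close>

lemma nn_integral_iter_int_op:
  assumes "distinct vs" "\<forall>v\<in>set vs. face n (w v)"
  shows "(\<integral>\<^sup>+y. ennreal (box_integrand n (set vs) w L y) \<partial>(Pi\<^sub>M (set vs) (\<lambda>_. lborel)))
    = ennreal (iter_op n int_op (map w vs) L)"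
  using assms
proof (induction vs arbitrary: L)
  case Nil
  interpret product_sigma_finite "\<lambda>_. lborel :: real measure" by standard
  show ?case unfolding list.set(1) by (subst nn_integral_empty) (simp_all add: box_integrand_def)
next
  case (Cons v vs)
  interpret product_sigma_finite "\<lambda>_. lborel :: real measure" by standard
  have v: "v \<notin> set vs" using Cons.prems by simp
  let ?J = "set vs"
  let ?f = "iter_op n int_op (map w vs)"
  have f: "orthant_mono n ?f" using Cons.prems by (intro orthant_mono_iter_op orthant_mono_int_op) auto
  have "(\<integral>\<^sup>+y. ennreal (box_integrand n (set (v # vs)) w L y) \<partial>(Pi\<^sub>M (set (v # vs)) (\<lambda>_. lborel)))
    = (\<integral>\<^sup>+t. (\<integral>\<^sup>+y. ennreal (box_integrand n (insert v ?J) w L (y(v := t))) \<partial>(Pi\<^sub>M ?J (\<lambda>_. lborel))) \<partial>lborel)"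
    unfolding list.set(2)
    by (rule product_nn_integral_insert_rev) (use v box_integrand_measurable[of "insert v ?J"] in auto)
  also have "\<dots> = (\<integral>\<^sup>+t. ennreal (indicator {1..} t / t * ?f (shift (w v) (ln t) L)) \<partial>lborel)"
  proof (rule nn_integral_cong)
    fix t :: real
    have 1: "(\<Prod>i\<in>insert v ?J. indicator {1..} ((y(v := t)) i) / (y(v := t)) i) =
      indicator {1..} t / t * (\<Prod>i\<in>?J. indicator {1..} (y i) / y i)" for y :: "'a \<Rightarrow> real"
    proof -
      have "(\<Prod>i\<in>?J. indicator {1..} ((y(v := t)) i) / (y(v := t)) i) = (\<Prod>i\<in>?J. indicator {1..} (y i) / y i)"
        using v by (intro prod.cong) auto
      thus ?thesis using v by simp
    qed
    have 2: "L j - (\<Sum>i | i \<in> insert v ?J \<and> j \<in> w i. ln ((y(v := t)) i)) =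
      shift (w v) (ln t) L j - (\<Sum>i | i \<in> ?J \<and> j \<in> w i. ln (y i))" for j and y :: "'a \<Rightarrow> real"
    proof -
      have e: "(\<Sum>i | i \<in> ?J \<and> j \<in> w i. ln ((y(v := t)) i)) = (\<Sum>i | i \<in> ?J \<and> j \<in> w i. ln (y i))"
        using v by (intro sum.cong) auto
      show ?thesis
      proof (cases "j \<in> w v")
        case True
        have "{i. i \<in> insert v ?J \<and> j \<in> w i} = insert v {i. i \<in> ?J \<and> j \<in> w i}" using True by auto
        hence "(\<Sum>i | i \<in> insert v ?J \<and> j \<in> w i. ln ((y(v := t)) i)) = ln t + (\<Sum>i | i \<in> ?J \<and> j \<in> w i. ln ((y(v := t)) i))"
          using v by simp
        thus ?thesis using True e by (simp add: shift_def)
      next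
        case False
        hence "{i. i \<in> insert v ?J \<and> j \<in> w i} = {i. i \<in> ?J \<and> j \<in> w i}" by auto
        thus ?thesis using False e by (simp only: shift_def if_False)
      qed
    qed
    have "(\<integral>\<^sup>+y. ennreal (box_integrand n (insert v ?J) w L (y(v := t))) \<partial>(Pi\<^sub>M ?J (\<lambda>_. lborel)))
      = (\<integral>\<^sup>+y. ennreal (indicator {1..} t / t) * ennreal (box_integrand n ?J w (shift (w v) (ln t) L) y) \<partial>(Pi\<^sub>M ?J (\<lambda>_. lborel)))"
      unfolding box_integrand_def 1 2 mult.assoc by (intro nn_integral_cong ennreal_mult') (auto simp: indicator_def)
    also have "\<dots> = ennreal (indicator {1..} t / t) * (\<integral>\<^sup>+y. ennreal (box_integrand n ?J w (shift (w v) (ln t) L) y) \<partial>(Pi\<^sub>M ?J (\<lambda>_. lborel)))"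
      by (intro nn_integral_cmult measurable_compose[OF box_integrand_measurable measurable_ennreal]) simp
    also have "\<dots> = ennreal (indicator {1..} t / t) * ennreal (?f (shift (w v) (ln t) L))"
      using Cons by simp
    also have "\<dots> = ennreal (indicator {1..} t / t * ?f (shift (w v) (ln t) L))"
      by (rule ennreal_mult'[symmetric]) (auto simp: indicator_def)
    finally show "(\<integral>\<^sup>+y. ennreal (box_integrand n (insert v ?J) w L (y(v := t))) \<partial>(Pi\<^sub>M ?J (\<lambda>_. lborel)))
      = ennreal (indicator {1..} t / t * ?f (shift (w v) (ln t) L))" .
  qed
  also have "\<dots> = ennreal (int_op (w v) ?f L)"
    using Cons.prems by (intro exp_substitution[OF f]) auto
  finally show ?case by simp
qed

text \<open>The support of the 0-1 vector; the second component, the number of the copy, is always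
  \<open>1\<close> here.\<close>

definition pair_face :: "nat \<Rightarrow> (nat \<Rightarrow> nat) \<times> nat \<Rightarrow> nat set" where
  "pair_face n v = {j\<in>{1..n}. fst v j = 1}"

lemma pair_face_bij:
  assumes "1 \<le> n"
  shows "bij_betw (pair_face n) (int_vars (cube_I n) (\<lambda>_. 1)) (proper_faces n)"
proof -
  let ?g = "\<lambda>S. (\<lambda>j\<in>{1..n}. of_bool (j \<in> S) :: nat, 1 :: nat)"
  show ?thesis
  proof (rule bij_betw_byWitness[where f' = ?g])
    show "\<forall>v\<in>int_vars (cube_I n) (\<lambda>_. 1). ?g (pair_face n v) = v"
    proof
      fix v assume v: "v \<in> int_vars (cube_I n) (\<lambda>_. 1)"
      then obtain \<nu> where \<nu>: "v = (\<nu>, 1)" "\<nu> \<in> {1..n} \<rightarrow>\<^sub>E {0, 1}" by (auto simp: int_vars_def cube_I_def)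
      have "(\<lambda>j\<in>{1..n}. of_bool (j \<in> pair_face n v)) = \<nu>"
      proof (rule extensionalityI[of _ "{1..n}"])
        fix j assume j: "j \<in> {1..n}"
        hence "\<nu> j = 0 \<or> \<nu> j = 1" using \<nu>(2) by (auto simp: PiE_def Pi_def)
        thus "(\<lambda>j\<in>{1..n}. of_bool (j \<in> pair_face n v)) j = \<nu> j" using j by (auto simp: \<nu>(1) pair_face_def)
      qed (use \<nu>(2) in \<open>auto simp: PiE_def\<close>)
      thus "?g (pair_face n v) = v" using \<nu>(1) by simp
    qed
    show "\<forall>S\<in>proper_faces n. pair_face n (?g S) = S"
      by (auto simp: pair_face_def proper_faces_def)
    show "pair_face n ` int_vars (cube_I n) (\<lambda>_. 1) \<subseteq> proper_faces n"
    proof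
      fix S assume "S \<in> pair_face n ` int_vars (cube_I n) (\<lambda>_. 1)"
      then obtain \<nu> where \<nu>: "\<nu> \<in> cube_I n" "S = {j\<in>{1..n}. \<nu> j = 1}"
        by (auto simp: int_vars_def pair_face_def)
      have b: "\<nu> j = 0 \<or> \<nu> j = 1" if "j \<in> {1..n}" for j
        using \<nu>(1) that by (auto simp: cube_I_def PiE_def Pi_def)
      have e: "\<nu> \<in> extensional {1..n}" using \<nu>(1) by (auto simp: cube_I_def PiE_def)
      have "S \<noteq> {}"
      proof
        assume "S = {}"
        hence "\<nu> = (\<lambda>i\<in>{1..n}. 0)" using b \<nu>(2) e by (intro extensionalityI[of _ "{1..n}"]) auto
        thus False using \<nu>(1) by (simp add: cube_I_def)
      qed
      moreover have "S \<noteq> {1..n}"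
      proof
        assume "S = {1..n}"
        hence "\<nu> j = 1" if "j \<in> {1..n}" for j using that \<nu>(2) by blast
        hence "\<nu> = (\<lambda>i\<in>{1..n}. 1)" using e by (intro extensionalityI[of _ "{1..n}"]) auto
        thus False using \<nu>(1) by (simp add: cube_I_def)
      qed
      ultimately show "S \<in> proper_faces n" using \<nu>(2) by (auto simp: proper_faces_def)
    qed
    show "?g ` proper_faces n \<subseteq> int_vars (cube_I n) (\<lambda>_. 1)"
    proof
      fix v assume "v \<in> ?g ` proper_faces n"
      then obtain S where S: "S \<in> proper_faces n" "v = ?g S" by blast
      obtain i where i: "i \<in> {1..n}" "i \<in> S" using S(1) unfolding proper_faces_def by blast
      obtain k where k: "k \<in> {1..n}" "k \<notin> S" using S(1) unfolding proper_faces_def by blast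
      let ?\<nu> = "\<lambda>j\<in>{1..n}. of_bool (j \<in> S) :: nat"
      have "?\<nu> \<noteq> (\<lambda>i\<in>{1..n}. 0)"
      proof
        assume "?\<nu> = (\<lambda>i\<in>{1..n}. 0)"
        from fun_cong[OF this, of i] show False using i by simp
      qed
      moreover have "?\<nu> \<noteq> (\<lambda>i\<in>{1..n}. 1)"
      proof
        assume "?\<nu> = (\<lambda>i\<in>{1..n}. 1)"
        from fun_cong[OF this, of k] show False using k by simp
      qed
      moreover have "?\<nu> \<in> {1..n} \<rightarrow>\<^sub>E {0, 1}" by auto
      ultimately have "?\<nu> \<in> cube_I n" unfolding cube_I_def by blast
      thus "v \<in> int_vars (cube_I n) (\<lambda>_. 1)" using S(2) by (simp add: int_vars_def)
    qed
  qed
qed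

lemma int_I_eq_iter_int_op:
  assumes n: "1 \<le> n" and x: "0 < x"
    and vs: "distinct vs" "set vs = int_vars (cube_I n) (\<lambda>_. 1)"
  shows "int_I n (cube_I n) (\<lambda>_. 1) (\<lambda>_. 0) x = iter_op n int_op (map (pair_face n) vs) (\<lambda>_. ln x)"
proof -
  let ?V = "set vs"
  let ?M = "Pi\<^sub>M ?V (\<lambda>_. lborel :: real measure)"
  let ?h = "box_integrand n ?V (pair_face n) (\<lambda>_. ln x)"
  have V: "?V = (\<lambda>\<nu>. (\<nu>, 1)) ` cube_I n" by (auto simp: vs(2) int_vars_def)
  have inj: "inj_on (\<lambda>\<nu>. (\<nu>, 1::nat)) (cube_I n)" by (auto simp: inj_on_def)
  have face: "\<forall>v\<in>?V. face n (pair_face n v)"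
    using pair_face_bij[OF n] by (auto simp: vs(2) bij_betw_def face_def proper_faces_def)
  have eq: "indicator (int_domain n (cube_I n) (\<lambda>_. 1) x) y *\<^sub>R
      (1 / (\<Prod>\<nu>\<in>cube_I n. \<Prod>l\<in>{1..1}. y (\<nu>, l) powr (1 - inner_n n \<nu> (\<lambda>_. 0)))) = ?h y"
    if y: "y \<in> space ?M" for y
  proof (cases "\<forall>i\<in>?V. 1 \<le> y i")
    case False
    then obtain i where i: "i \<in> ?V" "\<not> 1 \<le> y i" by blast
    have "y \<notin> int_domain n (cube_I n) (\<lambda>_. 1) x"
    proof
      assume "y \<in> int_domain n (cube_I n) (\<lambda>_. 1) x"
      hence "y \<in> ?V \<rightarrow>\<^sub>E {1..}" unfolding int_domain_def vs(2) by blast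
      from PiE_mem[OF this i(1)] i(2) show False by simp
    qed
    moreover have "(\<Prod>i\<in>?V. indicator {1..} (y i) / y i) = 0" using i by (intro prod_zero) (auto intro!: bexI[of _ i])
    ultimately show ?thesis by (simp add: box_integrand_def)
  next
    case True
    \<comment> \<open>Membership in \<open>int_domain\<close> includes extensionality, which holds
      because \<open>y\<close> is a point of the product space.\<close>
    have ext: "y \<in> extensional ?V" using y by (simp add: space_PiM PiE_def)
    have pos: "0 < y i" if "i \<in> ?V" for i using True that by force
    have 1: "(\<Prod>\<nu>\<in>cube_I n. \<Prod>l\<in>{1..1}. y (\<nu>, l) powr (1 - inner_n n \<nu> (\<lambda>_. 0))) = (\<Prod>i\<in>?V. y i)"
      unfolding V prod.reindex[OF inj] o_def
    proof (rule prod.cong)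
      fix \<nu> assume "\<nu> \<in> cube_I n"
      hence "0 < y (\<nu>, 1)" by (intro pos) (auto simp: V)
      thus "(\<Prod>l\<in>{1..1}. y (\<nu>, l) powr (1 - inner_n n \<nu> (\<lambda>_. 0))) = y (\<nu>, 1)"
        by (simp add: inner_n_def)
    qed simp
    have 2: "(\<Prod>\<nu>\<in>cube_I n. \<Prod>l\<in>{1..1}. y (\<nu>, l) ^ \<nu> j) \<le> x \<longleftrightarrow>
       0 \<le> ln x - (\<Sum>i | i \<in> ?V \<and> j \<in> pair_face n i. ln (y i))" if j: "j \<in> {1..n}" for j
    proof -
      have "(\<Prod>\<nu>\<in>cube_I n. \<Prod>l\<in>{1..1}. y (\<nu>, l) ^ \<nu> j) = (\<Prod>i\<in>?V. y i ^ fst i j)"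
        unfolding V prod.reindex[OF inj] by simp
      also have "\<dots> = (\<Prod>i | i \<in> ?V \<and> j \<in> pair_face n i. y i)"
      proof (rule prod.mono_neutral_cong_right)
        have b: "fst i j = 0 \<or> fst i j = 1" if "i \<in> ?V" for i
          using that j by (auto simp: V cube_I_def PiE_def Pi_def)
        show "\<forall>i\<in>?V - {i. i \<in> ?V \<and> j \<in> pair_face n i}. y i ^ fst i j = 1"
        proof
          fix i assume i: "i \<in> ?V - {i. i \<in> ?V \<and> j \<in> pair_face n i}"
          hence "fst i j = 0" using b[of i] j by (auto simp: pair_face_def)
          thus "y i ^ fst i j = 1" by simp
        qed
        show "y i ^ fst i j = y i" if "i \<in> {i. i \<in> ?V \<and> j \<in> pair_face n i}" for i
          using that by (simp add: pair_face_def)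
      qed auto
      finally have e: "(\<Prod>\<nu>\<in>cube_I n. \<Prod>l\<in>{1..1}. y (\<nu>, l) ^ \<nu> j) = (\<Prod>i | i \<in> ?V \<and> j \<in> pair_face n i. y i)" .
      have "0 < (\<Prod>i | i \<in> ?V \<and> j \<in> pair_face n i. y i)" using pos by (intro prod_pos) auto
      hence "(\<Prod>i | i \<in> ?V \<and> j \<in> pair_face n i. y i) \<le> x \<longleftrightarrow> ln (\<Prod>i | i \<in> ?V \<and> j \<in> pair_face n i. y i) \<le> ln x"
        using x by simp
      also have "ln (\<Prod>i | i \<in> ?V \<and> j \<in> pair_face n i. y i) = (\<Sum>i | i \<in> ?V \<and> j \<in> pair_face n i. ln (y i))"
      proof (rule ln_prod)
        fix i assume "i \<in> {i. i \<in> ?V \<and> j \<in> pair_face n i}"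
        thus "y i \<noteq> 0" using pos[of i] by simp
      qed simp
      finally show ?thesis unfolding e by linarith
    qed
    have 3: "indicator (int_domain n (cube_I n) (\<lambda>_. 1) x) y =
       orthant n (\<lambda>j. ln x - (\<Sum>i | i \<in> ?V \<and> j \<in> pair_face n i. ln (y i)))"
    proof -
      have "y \<in> ?V \<rightarrow>\<^sub>E {1..}" using True ext by (simp add: PiE_iff)
      hence "y \<in> int_domain n (cube_I n) (\<lambda>_. 1) x \<longleftrightarrow>
        (\<forall>j\<in>{1..n}. (\<Prod>\<nu>\<in>cube_I n. \<Prod>l\<in>{1..1}. y (\<nu>, l) ^ \<nu> j) \<le> x)"
        unfolding int_domain_def vs(2) by blast
      thus ?thesis unfolding orthant_def using 2 by (simp only: indicator_def cong: ball_cong)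
    qed
    have 4: "(\<Prod>i\<in>?V. indicator {1..} (y i) / y i) = 1 / (\<Prod>i\<in>?V. y i)"
      using True by (simp add: prod_dividef)
    show ?thesis unfolding box_integrand_def 1 3 4 by simp
  qed
  have nn: "0 \<le> ?h y" for y
    unfolding box_integrand_def by (intro mult_nonneg_nonneg prod_nonneg) (auto simp: indicator_def orthant_def)
  have "int_I n (cube_I n) (\<lambda>_. 1) (\<lambda>_. 0) x = integral\<^sup>L ?M ?h"
    unfolding int_I_def set_lebesgue_integral_def vs(2)[symmetric]
    by (rule Bochner_Integration.integral_cong[OF refl eq])
  also have "\<dots> = enn2real (\<integral>\<^sup>+y. ennreal (?h y) \<partial>?M)"
    by (rule integral_eq_nn_integral[OF box_integrand_measurable]) (use nn in auto)
  also have "\<dots> = iter_op n int_op (map (pair_face n) vs) (\<lambda>_. ln x)"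
    unfolding nn_integral_iter_int_op[OF vs(1) face]
    by (rule enn2real_ennreal, rule orthant_mono_nonneg, rule orthant_mono_iter_op)
      (use face in \<open>auto intro: orthant_mono_int_op\<close>)
  finally show ?thesis .
qed

text \<open>Homogeneity of degree \<open>2 ^ n - 2\<close> cancels the power of \<open>ln x\<close>
  exactly, so the quotient is constant for \<open>x > 1\<close> and its limit is the volume of the
  unit polytope.\<close>

lemma K_quot_eq:
  assumes n: "1 \<le> n" and vs: "distinct vs" "set vs = int_vars (cube_I n) (\<lambda>_. 1)"
    and len: "length vs = 2 ^ n - 2" and x: "1 < x"
  shows "K_quot n x = iter_op n int_op (map (pair_face n) vs) (\<lambda>_. 1)"
proof -
  have l: "0 < ln x" using x by simp
  have "(2::nat) \<le> 2 ^ n" using self_le_power[of "2::nat" n] n by simp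
  hence "- (2 ^ n) + 2 = - int (2 ^ n - 2)" by (simp add: of_nat_diff)
  hence "ln x powi (- (2 ^ n) + 2) = inverse (ln x ^ (2 ^ n - 2))"
    by (simp only: power_int_minus power_int_of_nat)
  moreover have "int_I n (cube_I n) (\<lambda>_. 1) (\<lambda>_. 0) x =
      ln x ^ (2 ^ n - 2) * iter_op n int_op (map (pair_face n) vs) (\<lambda>_. 1)"
    using iter_int_op_scale[OF l, of n "map (pair_face n) vs" "\<lambda>_. 1"] int_I_eq_iter_int_op[OF n _ vs, of x] x
    by (simp only: mult_1_right length_map len)
  ultimately show ?thesis unfolding K_quot_def using l by simp
qed

lemma iter_int_op_pos:
  assumes "\<forall>S\<in>set Ss. face n S"
  shows "0 < iter_op n int_op Ss (\<lambda>_. 1)"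
proof -
  define c where "c = 1 / real (Suc (length Ss))"
  have c: "0 < c" "real (length Ss) * c \<le> 1" by (auto simp: c_def field_simps)
  have "0 < c ^ length Ss * orthant n (\<lambda>j. 1 - real (length Ss) * c)"
    using c by (simp add: orthant_def)
  also have "\<dots> \<le> iter_op n int_op Ss (\<lambda>_. 1)"
    using iter_int_op_lower[OF assms, of c "\<lambda>_. 1"] c by simp
  finally show ?thesis .
qed

section \<open>Gluing local polynomial approximations\<close>

text \<open>Lagrange basis for the nodes \<open>a, a + 1, ..., a + m\<close>.\<close>

definition lagrange_basis :: "nat \<Rightarrow> real \<Rightarrow> nat \<Rightarrow> real poly" where
  "lagrange_basis m a i = (\<Prod>j\<in>{..m} - {i}. smult (1 / (real i - real j)) [:- (a + real j), 1:])"

lemma poly_lagrange_basis: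
  "poly (lagrange_basis m a i) x = (\<Prod>j\<in>{..m} - {i}. (x - a - real j) / (real i - real j))"
  unfolding lagrange_basis_def poly_prod
  by (intro prod.cong) (auto simp: diff_divide_distrib add_divide_distrib)

lemma degree_lagrange_basis:
  assumes "i \<le> m"
  shows "degree (lagrange_basis m a i) \<le> m"
proof -
  have "degree (lagrange_basis m a i) \<le> (\<Sum>j\<in>{..m} - {i}. degree (smult (1 / (real i - real j)) [:- (a + real j), 1:]))"
    unfolding lagrange_basis_def by (rule degree_prod_sum_le[unfolded o_def]) simp
  also have "\<dots> \<le> (\<Sum>j\<in>{..m} - {i}. 1)"
    by (intro sum_mono order_trans[OF degree_smult_le]) simp
  also have "\<dots> = m" using assms by simp
  finally show ?thesis .
qed

lemma lagrange_basis_node: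
  assumes "i \<le> m" "k \<le> m"
  shows "poly (lagrange_basis m a i) (a + real k) = of_bool (i = k)"
proof (cases "i = k")
  case True
  thus ?thesis by (auto simp: poly_lagrange_basis intro!: prod.neutral)
next
  case False
  thus ?thesis using assms by (auto simp: poly_lagrange_basis prod_zero_iff)
qed

lemma lagrange_interpolation:
  fixes q :: "real poly"
  assumes "degree q \<le> m"
  shows "poly q x = (\<Sum>i\<le>m. poly q (a + real i) * poly (lagrange_basis m a i) x)"
proof -
  define r where "r = (\<Sum>i\<le>m. smult (poly q (a + real i)) (lagrange_basis m a i))"
  have "q = r"
  proof (rule poly_eqI_degree[where A = "(\<lambda>k. a + real k) ` {..m}"])
    fix x assume "x \<in> (\<lambda>k. a + real k) ` {..m}"
    then obtain k where k: "k \<le> m" "x = a + real k" by auto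
    have "poly r x = (\<Sum>i\<le>m. poly q (a + real i) * of_bool (i = k))"
      unfolding r_def poly_sum using k by (intro sum.cong) (auto simp: lagrange_basis_node)
    also have "\<dots> = poly q x" using k by (simp add: of_bool_def if_distrib[of "\<lambda>x. _ * x"] cong: if_cong)
    finally show "poly q x = poly r x" ..
  next
    have c: "card ((\<lambda>k. a + real k) ` {..m}) = Suc m" by (subst card_image) (auto simp: inj_on_def)
    show "degree q < card ((\<lambda>k. a + real k) ` {..m})" using assms c by simp
    have "degree r \<le> m"
      unfolding r_def by (intro degree_sum_le) (auto intro: order_trans[OF degree_smult_le] degree_lagrange_basis)
    thus "degree r < card ((\<lambda>k. a + real k) ` {..m})" using c by simp
  qed
  hence "poly q x = poly r x" by simp
  thus ?thesis by (simp add: r_def poly_sum)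
qed

lemma poly_bound_from_nodes:
  fixes q :: "real poly"
  assumes "degree q \<le> m" and e: "\<And>i. i \<le> m \<Longrightarrow> \<bar>poly q (a + real i)\<bar> \<le> e"
  shows "\<bar>poly q x\<bar> \<le> real (Suc m) * e * (\<bar>x - a\<bar> + real m) ^ m"
proof -
  have e0: "0 \<le> e" using e[of 0] by force
  have "\<bar>poly (lagrange_basis m a i) x\<bar> \<le> (\<bar>x - a\<bar> + real m) ^ m" if "i \<le> m" for i
  proof -
    have "\<bar>poly (lagrange_basis m a i) x\<bar> = (\<Prod>j\<in>{..m} - {i}. \<bar>x - a - real j\<bar> / \<bar>real i - real j\<bar>)"
      by (simp add: poly_lagrange_basis abs_prod)
    also have "\<dots> \<le> (\<Prod>j\<in>{..m} - {i}. \<bar>x - a\<bar> + real m)"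
    proof (rule prod_mono)
      fix j assume j: "j \<in> {..m} - {i}"
      hence "1 \<le> \<bar>real i - real j\<bar>" by (auto simp: abs_if)
      hence "\<bar>x - a - real j\<bar> / \<bar>real i - real j\<bar> \<le> \<bar>x - a - real j\<bar>"
        using divide_left_mono[of 1 "\<bar>real i - real j\<bar>" "\<bar>x - a - real j\<bar>"] by simp
      also have "\<dots> \<le> \<bar>x - a\<bar> + real m" using j by auto
      finally show "0 \<le> \<bar>x - a - real j\<bar> / \<bar>real i - real j\<bar> \<and>
        \<bar>x - a - real j\<bar> / \<bar>real i - real j\<bar> \<le> \<bar>x - a\<bar> + real m" by simp
    qed
    also have "\<dots> = (\<bar>x - a\<bar> + real m) ^ m" using that by simp
    finally show ?thesis .
  qed
  hence "\<bar>poly q x\<bar> \<le> (\<Sum>i\<le>m. e * (\<bar>x - a\<bar> + real m) ^ m)"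
    unfolding lagrange_interpolation[OF assms(1), of x a]
    using e e0 by (intro order_trans[OF sum_abs] sum_mono) (auto simp: abs_mult intro!: mult_mono)
  thus ?thesis by (simp add: mult_ac)
qed

lemma power_le_exp:
  fixes y c :: real
  assumes "0 \<le> y" "0 < c"
  shows "y ^ m \<le> (real m / c) ^ m * exp (c * y)"
proof (cases "m = 0")
  case False
  \<comment> \<open>The inequality \<open>t \<le> exp t\<close> at \<open>t = c * y / m\<close>, to
    be raised to the power \<open>m\<close>.\<close>
  have "c * y / real m \<le> exp (c * y / real m)"
    using exp_ge_add_one_self[of "c * y / real m"] by linarith
  hence "y \<le> real m / c * exp (c * y / real m)"
    using False assms by (simp add: field_simps)
  hence "y ^ m \<le> (real m / c * exp (c * y / real m)) ^ m"
    using assms by (intro power_mono)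
  moreover have "exp (c * y / real m) ^ m = exp (c * y)"
    using False by (simp add: exp_of_nat_mult[symmetric])
  hence "(real m / c * exp (c * y / real m)) ^ m = (real m / c) ^ m * exp (c * y)"
    by (simp only: power_mult_distrib)
  ultimately show ?thesis by simp
qed (use assms in simp)

lemma poly_mult_exp_bound:
  fixes a b \<mu> :: real
  assumes "0 \<le> a" "0 \<le> b" "0 < \<mu>"
  shows "\<exists>A\<ge>0. \<forall>k::nat. (a * real k + b) ^ m * exp (- \<mu> * real k) \<le> A * exp (- (\<mu> / 2) * real k)"
proof -
  \<comment> \<open>Chosen so that \<open>c * a \<le> \<mu> / 2\<close>: half of the decay pays for
    the polynomial factor. The summand \<open>1\<close> keeps the denominator positive.\<close>
  define c where "c = \<mu> / (2 * (a + 1))"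
  have c: "0 < c" using assms by (simp add: c_def)
  define A where "A = (real m / c) ^ m * exp (c * b)"
  have "(a * real k + b) ^ m * exp (- \<mu> * real k) \<le> A * exp (- (\<mu> / 2) * real k)" for k
  proof -
    have "c * a \<le> \<mu> / 2" using assms by (simp add: c_def field_simps)
    hence ca: "c * a * real k \<le> \<mu> / 2 * real k" by (intro mult_right_mono) auto
    have "(a * real k + b) ^ m * exp (- \<mu> * real k) \<le> (real m / c) ^ m * exp (c * (a * real k + b)) * exp (- \<mu> * real k)"
      using assms by (intro mult_right_mono power_le_exp c) auto
    also have "\<dots> = A * exp (c * a * real k - \<mu> * real k)"
      by (simp add: A_def mult_ac algebra_simps flip: exp_add)
    also have "\<dots> \<le> A * exp (- (\<mu> / 2) * real k)"
      using ca c by (intro mult_left_mono) (auto simp: A_def)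
    finally show ?thesis .
  qed
  moreover have "0 \<le> A" using c by (simp add: A_def)
  ultimately show ?thesis by blast
qed

text \<open>Polynomials for \<open>k\<close> and \<open>k + 1\<close> are close at
  \<open>m + 1\<close> common nodes, hence close on \<open>\<bar>x\<bar> \<le> k + 1\<close> up to a
  polynomial factor in \<open>k\<close>, which costs half of the rate. The differences are then
  dominated by a geometric series.\<close>

lemma local_poly_approx_imp_global:
  fixes F :: "real \<Rightarrow> real"
  assumes \<mu>: "0 < \<mu>" and C: "0 \<le> C"
    and approx: "\<And>k. k \<ge> k0 \<Longrightarrow> \<exists>p. degree p \<le> m \<and>
      (\<forall>l\<in>{real k..2 * real k}. \<bar>F l - poly p l\<bar> \<le> C * exp (- \<mu> * real k))"
  shows "\<exists>P C'. \<forall>\<^sub>F l in at_top. \<bar>F l - poly P l\<bar> \<le> C' * exp (- (\<mu> / 2) * l)"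
proof -
  obtain p where p: "\<And>k. k \<ge> k0 \<Longrightarrow> degree (p k) \<le> m"
    "\<And>k l. k \<ge> k0 \<Longrightarrow> real k \<le> l \<Longrightarrow> l \<le> 2 * real k \<Longrightarrow> \<bar>F l - poly (p k) l\<bar> \<le> C * exp (- \<mu> * real k)"
    using approx by (metis atLeastAtMost_iff)
  \<comment> \<open>For \<open>k \<ge> m + 1\<close> the nodes \<open>k + 1, ..., k + 1 + m\<close>
    lie in both \<open>[k, 2 k]\<close> and \<open>[k + 1, 2 k + 2]\<close>.\<close>
  define k1 where "k1 = max k0 (m + 1)"
  define r where "r = exp (- (\<mu> / 2))"
  have r: "0 < r" "r < 1" using \<mu> by (auto simp: r_def)
  have rk: "r ^ k = exp (- (\<mu> / 2) * real k)" for k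
    by (simp add: r_def exp_of_nat_mult[symmetric] mult_ac)
  obtain A0 where A0: "0 \<le> A0" "\<And>k::nat. (2 * real k + (real m + 2)) ^ m * exp (- \<mu> * real k) \<le> A0 * exp (- (\<mu> / 2) * real k)"
    using poly_mult_exp_bound[of 2 "real m + 2" \<mu> m] \<mu> by auto
  define A where "A = real (Suc m) * (2 * C) * A0"
  have A: "0 \<le> A" using C A0 by (simp add: A_def)
  have step: "\<bar>poly (p (Suc k)) x - poly (p k) x\<bar> \<le> A * r ^ k" if k: "k1 \<le> k" and x: "\<bar>x\<bar> \<le> real k + 1" for k x
  proof -
    have k': "k0 \<le> k" "m + 1 \<le> k" using k by (auto simp: k1_def)
    have "\<bar>poly (p (Suc k) - p k) (real (Suc k) + real i)\<bar> \<le> 2 * C * exp (- \<mu> * real k)" if i: "i \<le> m" for i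
    proof -
      let ?y = "real (Suc k) + real i"
      have "\<bar>F ?y - poly (p (Suc k)) ?y\<bar> \<le> C * exp (- \<mu> * real (Suc k))"
        using k' i by (intro p(2)) auto
      also have "\<dots> \<le> C * exp (- \<mu> * real k)"
        using C \<mu> by (intro mult_left_mono) auto
      finally have "\<bar>F ?y - poly (p (Suc k)) ?y\<bar> \<le> C * exp (- \<mu> * real k)" .
      moreover have "\<bar>F ?y - poly (p k) ?y\<bar> \<le> C * exp (- \<mu> * real k)"
        using k' i by (intro p(2)) auto
      ultimately show ?thesis by simp
    qed
    moreover have "degree (p (Suc k) - p k) \<le> m"
      using k' p(1)[of k] p(1)[of "Suc k"] by (intro degree_diff_le) auto
    ultimately have "\<bar>poly (p (Suc k) - p k) x\<bar> \<le>
      real (Suc m) * (2 * C * exp (- \<mu> * real k)) * (\<bar>x - real (Suc k)\<bar> + real m) ^ m"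
      by (intro poly_bound_from_nodes)
    also have "\<dots> \<le> real (Suc m) * (2 * C * exp (- \<mu> * real k)) * (2 * real k + (real m + 2)) ^ m"
      using x C by (intro mult_left_mono power_mono) auto
    also have "\<dots> = real (Suc m) * (2 * C) * ((2 * real k + (real m + 2)) ^ m * exp (- \<mu> * real k))"
      by (simp add: mult_ac)
    also have "\<dots> \<le> real (Suc m) * (2 * C) * (A0 * exp (- (\<mu> / 2) * real k))"
      using C by (intro mult_left_mono A0) auto
    finally show ?thesis by (simp add: A_def rk mult_ac)
  qed
  have tail: "\<bar>poly (p M) x - poly (p k) x\<bar> \<le> A * (r ^ k - r ^ M) / (1 - r)"
    if k: "k1 \<le> k" and x: "\<bar>x\<bar> \<le> real k + 1" and "k \<le> M" for k x M
    using \<open>k \<le> M\<close>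
  proof (induction M rule: dec_induct)
    case base
    then show ?case by simp
  next
    case (step M)
    have "\<bar>poly (p (Suc M)) x - poly (p M) x\<bar> \<le> A * r ^ M"
      using step k x by (intro \<open>\<And>k x. k1 \<le> k \<Longrightarrow> \<bar>x\<bar> \<le> real k + 1 \<Longrightarrow> \<bar>poly (p (Suc k)) x - poly (p k) x\<bar> \<le> A * r ^ k\<close>) auto
    moreover have "A * r ^ M + A * (r ^ k - r ^ M) / (1 - r) = A * (r ^ k - r ^ Suc M) / (1 - r)"
      using r by (simp add: field_simps)
    ultimately show ?case using step.IH by linarith
  qed
  have tail': "\<bar>poly (p M) x - poly (p k) x\<bar> \<le> A / (1 - r) * r ^ k"
    if "k1 \<le> k" "\<bar>x\<bar> \<le> real k + 1" "k \<le> M" for k x M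
  proof -
    have "A * (r ^ k - r ^ M) / (1 - r) \<le> A / (1 - r) * r ^ k"
    proof -
      have "0 \<le> A / (1 - r) * r ^ M" using A r by simp
      thus ?thesis by (simp add: diff_divide_distrib right_diff_distrib)
    qed
    thus ?thesis using tail[OF that] by linarith
  qed
  have conv: "convergent (\<lambda>k. poly (p k) x)" for x
  proof -
    have "Cauchy (\<lambda>k. poly (p k) x)"
    proof (rule metric_CauchyI)
      fix e :: real assume e: "0 < e"
      have "(\<lambda>k. 2 * (A / (1 - r)) * r ^ k) \<longlonglongrightarrow> 2 * (A / (1 - r)) * 0"
        by (intro tendsto_intros LIMSEQ_realpow_zero) (use r in auto)
      hence "\<forall>\<^sub>F k in sequentially. 2 * (A / (1 - r)) * r ^ k < e"
        using e by (simp add: order_tendstoD)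
      then obtain k where k: "k \<ge> max k1 (nat \<lceil>\<bar>x\<bar>\<rceil>)" "2 * (A / (1 - r)) * r ^ k < e"
        by (metis (no_types, lifting) eventually_sequentially max.cobounded1 max.cobounded2)
      have x: "\<bar>x\<bar> \<le> real k + 1" "k1 \<le> k" using k(1) by linarith+
      have "dist (poly (p a) x) (poly (p b) x) < e" if "a \<ge> k" "b \<ge> k" for a b
        using tail'[OF x(2,1) that(1)] tail'[OF x(2,1) that(2)] k(2) by (simp add: dist_real_def)
      thus "\<exists>M. \<forall>a\<ge>M. \<forall>b\<ge>M. dist (poly (p a) x) (poly (p b) x) < e" by blast
    qed
    thus ?thesis by (rule Cauchy_convergent)
  qed
  define g where "g x = lim (\<lambda>k. poly (p k) x)" for x
  have g: "(\<lambda>k. poly (p k) x) \<longlonglongrightarrow> g x" for x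
    using conv by (simp add: g_def convergent_LIMSEQ_iff)
  \<comment> \<open>The pointwise limit is again a polynomial, since interpolation at the fixed
    nodes \<open>0, ..., m\<close> passes to the limit.\<close>
  define P where "P = (\<Sum>i\<le>m. smult (g (real i)) (lagrange_basis m 0 i))"
  have P: "poly P x = g x" for x
  proof (rule LIMSEQ_unique[OF _ g])
    have lim: "(\<lambda>k. \<Sum>i\<le>m. poly (p k) (real i) * poly (lagrange_basis m 0 i) x) \<longlonglongrightarrow>
          (\<Sum>i\<le>m. g (real i) * poly (lagrange_basis m 0 i) x)"
      by (intro tendsto_intros g)
    have ev: "\<forall>\<^sub>F k in sequentially. (\<Sum>i\<le>m. poly (p k) (real i) * poly (lagrange_basis m 0 i) x) = poly (p k) x"
      using eventually_ge_at_top[of k0]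
      by eventually_elim (use lagrange_interpolation[OF p(1), of _ x 0] in simp)
    have "(\<Sum>i\<le>m. g (real i) * poly (lagrange_basis m 0 i) x) = poly P x"
      by (simp add: P_def poly_sum)
    thus "(\<lambda>k. poly (p k) x) \<longlonglongrightarrow> poly P x"
      using Lim_transform_eventually[OF lim ev] by (simp only:)
  qed
  have Pk: "\<bar>poly P x - poly (p k) x\<bar> \<le> A / (1 - r) * r ^ k" if "k1 \<le> k" "\<bar>x\<bar> \<le> real k + 1" for k x
  proof (rule LIMSEQ_le_const2)
    show "(\<lambda>M. \<bar>poly (p M) x - poly (p k) x\<bar>) \<longlonglongrightarrow> \<bar>poly P x - poly (p k) x\<bar>"
      unfolding P by (intro tendsto_intros g)
    show "\<exists>N. \<forall>M\<ge>N. \<bar>poly (p M) x - poly (p k) x\<bar> \<le> A / (1 - r) * r ^ k"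
      using tail'[OF that] by blast
  qed
  define B where "B = (C + A / (1 - r)) * exp (\<mu> / 2)"
  have "\<bar>F l - poly P l\<bar> \<le> B * exp (- (\<mu> / 2) * l)" if l: "l \<ge> real k1 + 1" for l
  proof -
    define k where "k = nat \<lfloor>l\<rfloor>"
    have k: "real k \<le> l" "l < real k + 1" "k1 \<le> k" "1 \<le> k" using l unfolding k_def by linarith+
    have "\<bar>F l - poly (p k) l\<bar> \<le> C * exp (- \<mu> * real k)"
      using k by (intro p(2)) (auto simp: k1_def)
    also have "\<dots> \<le> C * r ^ k"
      unfolding rk using C \<mu> by (intro mult_left_mono) auto
    finally have "\<bar>F l - poly P l\<bar> \<le> (C + A / (1 - r)) * r ^ k"
      using Pk[OF k(3), of l] k by (simp add: distrib_right)
    also have "\<dots> \<le> (C + A / (1 - r)) * (exp (\<mu> / 2) * exp (- (\<mu> / 2) * l))"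
    proof (rule mult_left_mono)
      have "\<mu> / 2 * l \<le> \<mu> / 2 * (real k + 1)" using k \<mu> by (intro mult_left_mono) auto
      thus "r ^ k \<le> exp (\<mu> / 2) * exp (- (\<mu> / 2) * l)"
        unfolding rk exp_add[symmetric] by (simp add: algebra_simps)
      show "0 \<le> C + A / (1 - r)" using C A r by simp
    qed
    finally show ?thesis by (simp add: B_def)
  qed
  hence "\<forall>\<^sub>F l in at_top. \<bar>F l - poly P l\<bar> \<le> B * exp (- (\<mu> / 2) * l)"
    using eventually_at_top_linorder by blast
  thus ?thesis by blast
qed

text \<open>A degree below \<open>R\<close> would make the limit zero, contrary to
  \<open>c \<noteq> 0\<close>; a degree above \<open>R\<close> would make the leading coefficient
  zero.\<close>

lemma poly_over_power_tendsto:
  fixes p :: "real poly"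
  assumes lim: "((\<lambda>x. poly p x / x ^ R) \<longlongrightarrow> c) at_top" and c: "c \<noteq> 0"
  shows "degree p = R" and "lead_coeff p = c"
proof -
  have L: "((\<lambda>x. poly p x / x ^ degree p) \<longlongrightarrow> lead_coeff p) at_top"
    using poly_divide_tendsto_aux[of p] at_top_le_at_infinity tendsto_mono by blast
  have z: "((\<lambda>x::real. 1 / x ^ k) \<longlongrightarrow> 0) at_top" if "0 < k" for k
    using that by (intro tendsto_divide_0[OF tendsto_const] filterlim_at_top_imp_at_infinity
        filterlim_pow_at_top filterlim_ident)
  have "\<not> degree p < R"
  proof
    assume "degree p < R"
    hence "((\<lambda>x. poly p x / x ^ degree p * (1 / x ^ (R - degree p))) \<longlongrightarrow> lead_coeff p * 0) at_top"
      by (intro tendsto_mult L z) simp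
    moreover have "poly p x / x ^ degree p * (1 / x ^ (R - degree p)) = poly p x / x ^ R" for x
      using \<open>degree p < R\<close> by (simp add: power_add[symmetric])
    ultimately have "((\<lambda>x. poly p x / x ^ R) \<longlongrightarrow> lead_coeff p * 0) at_top" by (simp only:)
    thus False using tendsto_unique[OF _ lim, of "lead_coeff p * 0"] c by simp
  qed
  moreover have "\<not> R < degree p"
  proof
    assume R: "R < degree p"
    hence "((\<lambda>x. poly p x / x ^ R * (1 / x ^ (degree p - R))) \<longlongrightarrow> c * 0) at_top"
      by (intro tendsto_mult lim z) simp
    moreover have "poly p x / x ^ R * (1 / x ^ (degree p - R)) = poly p x / x ^ degree p" for x
      using R by (simp add: power_add[symmetric])
    ultimately have "((\<lambda>x. poly p x / x ^ degree p) \<longlongrightarrow> c * 0) at_top" by (simp only:)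
    hence "lead_coeff p = 0" using tendsto_unique[OF _ L, of "c * 0"] by simp
    thus False using R by simp
  qed
  ultimately show d: "degree p = R" by simp
  show "lead_coeff p = c" using tendsto_unique[OF _ L] lim d by simp
qed

lemma poly_bigo_power:
  fixes p :: "real poly"
  assumes "degree p \<le> m"
  shows "poly p \<in> O[at_top](\<lambda>x. x ^ m)"
proof -
  have "((\<lambda>x. poly p x / x ^ degree p) \<longlongrightarrow> lead_coeff p) at_top"
    using poly_divide_tendsto_aux[of p] at_top_le_at_infinity tendsto_mono by blast
  hence "poly p \<in> O[at_top](\<lambda>x. x ^ degree p)"
    by (rule bigoI_tendsto) (rule eventually_mono[OF eventually_gt_at_top[of 0]], simp)
  also have "(\<lambda>x::real. x ^ degree p) \<in> O[at_top](\<lambda>x. x ^ m)"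
    by (rule bigoI[of _ 1], rule eventually_mono[OF eventually_ge_at_top[of 1]])
       (use assms in \<open>auto intro!: power_increasing\<close>)
  finally show ?thesis .
qed

section \<open>The asymptotic expansion\<close>

text \<open>The logarithm of the product of all chosen divisors. It dominates every
  \<open>face_shift\<close> and serves as the exponent in the truncation by Rankin's trick.\<close>

definition face_weight :: "nat set \<Rightarrow> (nat \<Rightarrow> nat set set) \<Rightarrow> real" where
  "face_weight P \<sigma> = (\<Sum>p\<in>P. real (card (\<sigma> p)) * ln (real p))"

definition mobius_coeff :: "nat set \<Rightarrow> (nat \<Rightarrow> nat set set) \<Rightarrow> real" where
  "mobius_coeff P \<sigma> = (\<Prod>p\<in>P. nested_mobius (\<sigma> p) / real p ^ card (\<sigma> p))"

definition primes_upto :: "nat \<Rightarrow> nat set" where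
  "primes_upto N = {p. prime p \<and> p \<le> N}"

definition face_maps :: "nat \<Rightarrow> nat \<Rightarrow> (nat \<Rightarrow> nat set set) set" where
  "face_maps n N = PiE (primes_upto N) (\<lambda>_. Pow (proper_faces n))"

lemma finite_primes_upto [simp]: "finite (primes_upto N)"
  by (rule finite_subset[of _ "{..N}"]) (auto simp: primes_upto_def)

lemma finite_face_maps [simp]: "finite (face_maps n N)"
  unfolding face_maps_def by (intro finite_PiE) auto

lemma face_maps_subset: "\<sigma> \<in> face_maps n N \<Longrightarrow> p \<in> primes_upto N \<Longrightarrow> \<sigma> p \<subseteq> proper_faces n"
  by (auto simp: face_maps_def PiE_def Pi_def)

lemma ln_prime_nonneg: "p \<in> primes_upto N \<Longrightarrow> 0 \<le> ln (real p)"
  using prime_gt_0_nat[of p] by (auto simp: primes_upto_def)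

lemma face_shift_bounds:
  assumes \<sigma>: "\<sigma> \<in> face_maps n N"
  shows "0 \<le> face_shift (primes_upto N) \<sigma> j"
    and "face_shift (primes_upto N) \<sigma> j \<le> face_weight (primes_upto N) \<sigma>"
proof -
  show "0 \<le> face_shift (primes_upto N) \<sigma> j"
    unfolding face_shift_def by (intro sum_nonneg mult_nonneg_nonneg) (auto simp: ln_prime_nonneg)
  show "face_shift (primes_upto N) \<sigma> j \<le> face_weight (primes_upto N) \<sigma>"
    unfolding face_shift_def face_weight_def
  proof (intro sum_mono mult_right_mono)
    fix p assume p: "p \<in> primes_upto N"
    have "finite (\<sigma> p)" by (rule finite_subset[OF face_maps_subset[OF \<sigma> p] finite_proper_faces])
    thus "real (card {S \<in> \<sigma> p. j \<in> S}) \<le> real (card (\<sigma> p))"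
      by (auto intro!: card_mono)
  qed (auto simp: ln_prime_nonneg)
qed

lemma face_weight_nonneg: "0 \<le> face_weight (primes_upto N) \<sigma>"
  unfolding face_weight_def by (intro sum_nonneg mult_nonneg_nonneg) (auto simp: ln_prime_nonneg)

text \<open>The extra exponential turns \<open>1 / p\<close> into
  \<open>t p = p powr (- 3 / 4)\<close> in each local factor. As the local factors have no linear
  term, they are \<open>1 + O(p powr (- 3 / 2))\<close>, and their product stays bounded.\<close>

lemma mobius_coeff_weighted_bounded:
  "\<exists>Z>0. \<forall>N. (\<Sum>\<sigma>\<in>face_maps n N. \<bar>mobius_coeff (primes_upto N) \<sigma>\<bar> *
      exp (face_weight (primes_upto N) \<sigma> / 4)) \<le> Z"
proof -
  define C where "C = (\<Sum>X\<in>Pow (proper_faces n). \<bar>nested_mobius X\<bar>)"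
  define M where "M = (\<Sum>k. real k powr (- (3/2)))"
  have C: "0 \<le> C" by (simp add: C_def sum_nonneg)
  have sm: "summable (\<lambda>k. real k powr (- (3/2)))" by (subst summable_real_powr_iff) simp
  have "(\<Sum>\<sigma>\<in>face_maps n N. \<bar>mobius_coeff (primes_upto N) \<sigma>\<bar> * exp (face_weight (primes_upto N) \<sigma> / 4)) \<le> exp (C * M)" for N
  proof -
    let ?P = "primes_upto N"
    define t where "t p = real p powr (- (3/4))" for p
    have pos: "0 < real p" if "p \<in> ?P" for p using that prime_gt_0_nat by (auto simp: primes_upto_def)
    have t: "0 \<le> t p" "t p \<le> 1" if "p \<in> ?P" for p
    proof -
      have "1 \<le> real p" using pos[OF that] by simp
      thus "0 \<le> t p" "t p \<le> 1" using powr_mono[of "-(3/4)" 0 "real p"] by (auto simp: t_def)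
    qed
    have e: "\<bar>mobius_coeff ?P \<sigma>\<bar> * exp (face_weight ?P \<sigma> / 4) = (\<Prod>p\<in>?P. \<bar>nested_mobius (\<sigma> p)\<bar> * t p ^ card (\<sigma> p))" for \<sigma>
    proof -
      have "exp (face_weight ?P \<sigma> / 4) = (\<Prod>p\<in>?P. exp (real (card (\<sigma> p)) * ln (real p) / 4))"
        by (simp add: face_weight_def sum_divide_distrib exp_sum)
      also have "\<dots> = (\<Prod>p\<in>?P. (real p powr (1/4)) ^ card (\<sigma> p))"
        using pos by (intro prod.cong) (auto simp: powr_def exp_of_nat_mult[symmetric])
      finally have 1: "exp (face_weight ?P \<sigma> / 4) = (\<Prod>p\<in>?P. (real p powr (1/4)) ^ card (\<sigma> p))" .
      have "\<bar>mobius_coeff ?P \<sigma>\<bar> * exp (face_weight ?P \<sigma> / 4) =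
        (\<Prod>p\<in>?P. \<bar>nested_mobius (\<sigma> p)\<bar> / real p ^ card (\<sigma> p) * (real p powr (1/4)) ^ card (\<sigma> p))"
        unfolding 1 mobius_coeff_def abs_prod prod.distrib[symmetric] by (intro prod.cong) (auto simp: abs_divide)
      also have "\<dots> = (\<Prod>p\<in>?P. \<bar>nested_mobius (\<sigma> p)\<bar> * t p ^ card (\<sigma> p))"
      proof (rule prod.cong)
        fix p assume p: "p \<in> ?P"
        have "t p = real p powr (1/4) / real p powr 1"
          unfolding t_def powr_diff[symmetric] by simp
        hence "t p = real p powr (1/4) / real p" using pos[OF p] by simp
        thus "\<bar>nested_mobius (\<sigma> p)\<bar> / real p ^ card (\<sigma> p) * (real p powr (1/4)) ^ card (\<sigma> p) =
          \<bar>nested_mobius (\<sigma> p)\<bar> * t p ^ card (\<sigma> p)" by (simp add: power_divide)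
      qed simp
      finally show ?thesis .
    qed
    have "(\<Sum>\<sigma>\<in>face_maps n N. \<bar>mobius_coeff ?P \<sigma>\<bar> * exp (face_weight ?P \<sigma> / 4)) =
      (\<Prod>p\<in>?P. \<Sum>X\<in>Pow (proper_faces n). \<bar>nested_mobius X\<bar> * t p ^ card X)"
      unfolding e face_maps_def by (rule prod_sum_PiE[symmetric]) auto
    also have "\<dots> \<le> (\<Prod>p\<in>?P. exp (C * real p powr (- (3/2))))"
    proof (rule prod_mono)
      fix p assume p: "p \<in> ?P"
      have "(t p)\<^sup>2 = real p powr (- (3/2))"
        unfolding t_def power2_eq_square powr_add[symmetric] by simp
      hence "(\<Sum>X\<in>Pow (proper_faces n). \<bar>nested_mobius X\<bar> * t p ^ card X) \<le> 1 + C * real p powr (- (3/2))"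
        using nested_mobius_sum_bounds(1)[OF finite_proper_faces t[OF p], of n] by (simp add: C_def)
      also have "\<dots> \<le> exp (C * real p powr (- (3/2)))" by (rule exp_ge_add_one_self)
      finally show "0 \<le> (\<Sum>X\<in>Pow (proper_faces n). \<bar>nested_mobius X\<bar> * t p ^ card X) \<and>
        (\<Sum>X\<in>Pow (proper_faces n). \<bar>nested_mobius X\<bar> * t p ^ card X) \<le> exp (C * real p powr (- (3/2)))"
        using t[OF p] by (auto intro!: sum_nonneg)
    qed
    also have "\<dots> = exp (C * (\<Sum>p\<in>?P. real p powr (- (3/2))))"
      by (simp add: exp_sum sum_distrib_left)
    also have "\<dots> \<le> exp (C * M)"
      unfolding M_def using C by (simp add: mult_left_mono sum_le_suminf[OF sm])
    finally show ?thesis .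
  qed
  thus ?thesis by (intro exI[of _ "exp (C * M)"]) auto
qed

text \<open>The enumeration of the faces is a parameter, so that it can finally be taken from the
  integration variables; then \<open>V\<close> is literally the iterated integral behind
  \<open>K_const\<close>.\<close>

locale face_list =
  fixes n :: nat and Ss :: "nat set list"
  assumes n: "2 \<le> n" and distinct: "distinct Ss" and set_Ss: "set Ss = proper_faces n"
begin

abbreviation "R \<equiv> (2 ^ n - 2 :: nat)"

lemma length_Ss: "length Ss = R"
  using card_proper_faces[of n] n by (simp add: distinct_card[OF distinct, symmetric] set_Ss)

lemma R_ge: "2 \<le> R"
  using power_increasing[OF n, of "2::nat"] by simp

lemma faces: "\<forall>S\<in>set Ss. face n S"
  by (auto simp: set_Ss proper_faces_def face_def)

lemma U_exp:
  assumes "exp L \<le> real N"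
  shows "U n (exp L) = (\<Sum>\<sigma>\<in>face_maps n N. mobius_coeff (primes_upto N) \<sigma> *
    iter_op n (sum_op N) Ss (\<lambda>j. L - face_shift (primes_upto N) \<sigma> j))"
  using U_expansion[OF _ _ assms distinct set_Ss primes_upto_def] n
  by (simp add: mobius_coeff_def face_maps_def)

definition Z :: real where
  "Z = (SOME Z. 0 < Z \<and> (\<forall>N. (\<Sum>\<sigma>\<in>face_maps n N. \<bar>mobius_coeff (primes_upto N) \<sigma>\<bar> *
      exp (face_weight (primes_upto N) \<sigma> / 4)) \<le> Z))"

lemma Z: "0 < Z" "(\<Sum>\<sigma>\<in>face_maps n N. \<bar>mobius_coeff (primes_upto N) \<sigma>\<bar> *
      exp (face_weight (primes_upto N) \<sigma> / 4)) \<le> Z"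
proof -
  have "\<exists>Z. 0 < Z \<and> (\<forall>N. (\<Sum>\<sigma>\<in>face_maps n N. \<bar>mobius_coeff (primes_upto N) \<sigma>\<bar> *
      exp (face_weight (primes_upto N) \<sigma> / 4)) \<le> Z)"
    using mobius_coeff_weighted_bounded[of n] by blast
  from someI_ex[OF this] show "0 < Z" "(\<Sum>\<sigma>\<in>face_maps n N. \<bar>mobius_coeff (primes_upto N) \<sigma>\<bar> *
      exp (face_weight (primes_upto N) \<sigma> / 4)) \<le> Z"
    unfolding Z_def by blast+
qed

text \<open>In the Moebius expansion, terms with \<open>face_weight\<close> at most
  \<open>\<epsilon> * k\<close> are approximated by polynomials and the rest by zero. Both errors
  are at most \<open>E * exp (face_weight / 4)\<close>, which is summable against the
  coefficients.\<close>

lemma U_local_poly: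
  "\<exists>\<mu>>0. \<exists>C\<ge>0. \<exists>k0 m. \<forall>k\<ge>k0. \<exists>p. degree p \<le> m \<and>
     (\<forall>l\<in>{real k..2 * real k}. \<bar>U n (exp l) - poly p l\<bar> \<le> C * exp (- \<mu> * real k))"
proof -
  obtain K m where K: "0 \<le> K" and Kp: "\<And>D C v. 1 \<le> D \<Longrightarrow> 0 \<le> C \<Longrightarrow> (\<forall>j\<in>{1..n}. \<bar>v j\<bar> \<le> C) \<Longrightarrow>
    \<exists>p. degree p \<le> m \<and> (\<forall>l > K * (real (length Ss) * ln (real D) + C).
       iter_op n (mixed_op D) Ss (\<lambda>j. l - v j) = poly p l)"
    using iter_mixed_op_diag_poly[OF faces] by blast
  \<comment> \<open>The shifts amount to about \<open>(R + 1) * \<epsilon> * k\<close>, so this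
    choice keeps \<open>K\<close> times them below \<open>k / 2\<close>. The remaining
    \<open>K * R\<close>, from rounding in \<open>ln D\<close>, is below \<open>k / 2\<close> by the
    choice of \<open>k0\<close>.\<close>
  define \<epsilon> where "\<epsilon> = 1 / (2 * (K + 1) * (real R + 1))"
  have eps: "0 < \<epsilon>" "\<epsilon> \<le> 1"
  proof -
    have "1 \<le> (K + 1) * (real R + 1)" using mult_mono[of 1 "K + 1" 1 "real R + 1"] K by simp
    thus "0 < \<epsilon>" "\<epsilon> \<le> 1" unfolding \<epsilon>_def by (simp_all add: mult.assoc del: distrib_left_numeral)
  qed
  have "0 < \<epsilon> / 4" using eps by simp
  then obtain A where A: "0 \<le> A" "\<And>k::nat. (2 * real k + 1) ^ R * exp (- (\<epsilon> / 4) * real k) \<le> A * exp (- (\<epsilon> / 4 / 2) * real k)"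
    using poly_mult_exp_bound[of 2 1 "\<epsilon> / 4" R] by auto
  define C where "C = (real R + 1) * Z * A"
  define k0 where "k0 = nat \<lceil>2 * K * real R\<rceil> + 1"
  have main: "\<exists>p. degree p \<le> m \<and> (\<forall>l\<in>{real k..2 * real k}. \<bar>U n (exp l) - poly p l\<bar> \<le> C * exp (- (\<epsilon> / 8) * real k))"
    if k: "k \<ge> k0" for k
  proof -
    have k1: "2 * K * real R < real k" using k unfolding k0_def by linarith
    have kpos: "0 < real k" using k by (simp add: k0_def)
    \<comment> \<open>One truncation for the whole range: \<open>N\<close> bounds
      \<open>exp l\<close> for every \<open>l \<le> 2 * k\<close>.\<close>
    define N where "N = nat \<lceil>exp (2 * real k)\<rceil>"
    define D where "D = Suc (nat \<lfloor>exp (\<epsilon> * real k)\<rfloor>)"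
    define P where "P = primes_upto N"
    let ?X = "face_maps n N"
    have N: "exp (2 * real k) \<le> real N" unfolding N_def by linarith
    have lnN: "2 * real k < ln (real (Suc N))"
    proof -
      have "exp (2 * real k) < real (Suc N)" using N by simp
      thus ?thesis by (metis exp_gt_zero less_trans ln_exp ln_less_cancel_iff)
    qed
    have D1: "1 \<le> D" by (simp add: D_def)
    have De: "exp (\<epsilon> * real k) \<le> real D" unfolding D_def by linarith
    have "exp (\<epsilon> * real k) \<le> exp (2 * real k)" using eps kpos by (simp add: mult_right_mono)
    hence DN: "D \<le> Suc N" using N unfolding D_def by linarith
    have "real (nat \<lfloor>exp (\<epsilon> * real k)\<rfloor>) = of_int \<lfloor>exp (\<epsilon> * real k)\<rfloor>" by simp
    hence "real D \<le> 1 + exp (\<epsilon> * real k)" unfolding D_def by linarith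
    also have "\<dots> \<le> exp 1 * exp (\<epsilon> * real k)"
    proof -
      have "1 \<le> exp (\<epsilon> * real k)" using eps by simp
      moreover have "2 \<le> exp (1::real)" using exp_ge_add_one_self[of 1] by simp
      ultimately show ?thesis using mult_right_mono[of 2 "exp 1" "exp (\<epsilon> * real k)"] by linarith
    qed
    finally have "real D \<le> exp (1 + \<epsilon> * real k)" by (simp add: exp_add)
    hence lnD: "ln (real D) \<le> 1 + \<epsilon> * real k"
      using D1 ln_mono[of "real D" "exp (1 + \<epsilon> * real k)"] by simp
    have large: "K * (real (length Ss) * ln (real D) + \<epsilon> * real k) < real k"
    proof -
      have "K * (real R * ln (real D) + \<epsilon> * real k) \<le> K * (real R * (1 + \<epsilon> * real k) + \<epsilon> * real k)"
        using K lnD by (intro mult_left_mono add_right_mono) auto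
      also have "\<dots> = K * real R + K * (real R + 1) * \<epsilon> * real k" by (simp add: algebra_simps)
      also have "K * (real R + 1) * \<epsilon> \<le> 1 / 2"
      proof -
        have "K * (real R + 1) * \<epsilon> \<le> (K + 1) * (real R + 1) * \<epsilon>"
          using eps by (intro mult_right_mono) auto
        also have "\<dots> = 1 / 2" unfolding \<epsilon>_def using K by (simp del: distrib_right_numeral distrib_left_numeral)
        finally show ?thesis .
      qed
      hence "K * (real R + 1) * \<epsilon> * real k \<le> 1 / 2 * real k" by (rule mult_right_mono) simp
      finally show ?thesis using k1 by (simp add: length_Ss)
    qed
    let ?c = "mobius_coeff P" and ?w = "face_weight P" and ?b = "face_shift P"
    let ?A = "iter_op n (sum_op N) Ss" and ?W = "iter_op n (mixed_op D) Ss"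
    have "\<exists>p. degree p \<le> m \<and> (\<forall>l \<ge> real k. ?W (\<lambda>j. l - ?b \<sigma> j) = poly p l)"
      if \<sigma>: "\<sigma> \<in> ?X" "?w \<sigma> \<le> \<epsilon> * real k" for \<sigma>
    proof -
      have "\<forall>j\<in>{1..n}. \<bar>?b \<sigma> j\<bar> \<le> \<epsilon> * real k"
        using face_shift_bounds[OF \<sigma>(1)] \<sigma>(2) unfolding P_def by (smt (verit))
      from Kp[OF D1 _ this] eps obtain p where
        "degree p \<le> m" "\<forall>l > K * (real (length Ss) * ln (real D) + \<epsilon> * real k). ?W (\<lambda>j. l - ?b \<sigma> j) = poly p l"
        by auto
      thus ?thesis using large by (intro exI[of _ p]) auto
    qed
    then obtain p where p: "\<And>\<sigma>. \<sigma> \<in> ?X \<Longrightarrow> ?w \<sigma> \<le> \<epsilon> * real k \<Longrightarrow> degree (p \<sigma>) \<le> m"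
      "\<And>\<sigma> l. \<sigma> \<in> ?X \<Longrightarrow> ?w \<sigma> \<le> \<epsilon> * real k \<Longrightarrow> real k \<le> l \<Longrightarrow> ?W (\<lambda>j. l - ?b \<sigma> j) = poly (p \<sigma>) l"
      by metis
    define q where "q \<sigma> = (if ?w \<sigma> \<le> \<epsilon> * real k then p \<sigma> else 0)" for \<sigma>
    define Q where "Q = (\<Sum>\<sigma>\<in>?X. smult (?c \<sigma>) (q \<sigma>))"
    have "degree Q \<le> m"
      unfolding Q_def using p(1)
      by (intro degree_sum_le) (auto simp: q_def intro: order_trans[OF degree_smult_le])
    moreover have "\<bar>U n (exp l) - poly Q l\<bar> \<le> C * exp (- (\<epsilon> / 8) * real k)"
      if l: "l \<in> {real k..2 * real k}" for l
    proof -
      \<comment> \<open>The rate \<open>\<epsilon> / 4\<close> is dictated by the discarded terms,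
        for which only a quarter of the weight is available; the approximated terms have rate
        \<epsilon>.\<close>
      define E where "E = (real R + 1) * (1 + 2 * real k) ^ R * exp (- (\<epsilon> / 4) * real k)"
      have bnd: "\<bar>?A (\<lambda>j. l - ?b \<sigma> j) - poly (q \<sigma>) l\<bar> \<le> E * exp (?w \<sigma> / 4)" if \<sigma>: "\<sigma> \<in> ?X" for \<sigma>
      proof -
        let ?L = "\<lambda>j. l - ?b \<sigma> j"
        have w0: "0 \<le> ?w \<sigma>" unfolding P_def by (rule face_weight_nonneg)
        have Lb: "\<forall>j\<in>{1..n}. ?L j \<le> 2 * real k"
          using face_shift_bounds(1)[OF \<sigma>] l unfolding P_def by (smt (verit) atLeastAtMost_iff)
        have o: "orthant n ?L \<le> 1" by (simp add: orthant_def)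
        have Anonneg: "0 \<le> ?A ?L"
          by (intro orthant_mono_nonneg[of n] orthant_mono_iter_op orthant_mono_sum_op)
        show ?thesis
        proof (cases "?w \<sigma> \<le> \<epsilon> * real k")
          case True
          have "?A ?L - ?W ?L \<le> real R * (1 + 2 * real k) ^ (R - 1) / real D * orthant n ?L"
            using iter_sum_op_mixed_op(2)[OF faces D1 DN Lb _ lnN] by (simp add: length_Ss)
          also have "\<dots> \<le> real R * (1 + 2 * real k) ^ (R - 1) / real D"
            using o by (intro mult_left_le) auto
          also have "\<dots> \<le> real R * (1 + 2 * real k) ^ R / exp (\<epsilon> * real k)"
            using De by (intro frac_le mult_left_mono power_increasing) auto
          also have "\<dots> = real R * (1 + 2 * real k) ^ R * exp (- \<epsilon> * real k)"
            by (simp add: exp_minus field_simps)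
          also have "\<dots> \<le> (real R + 1) * (1 + 2 * real k) ^ R * exp (- (\<epsilon> / 4) * real k)"
            using eps by (intro mult_mono) auto
          finally have "?A ?L - ?W ?L \<le> E" by (simp add: E_def)
          moreover have "?W ?L \<le> ?A ?L"
            using iter_sum_op_mixed_op(1)[OF faces D1 DN Lb _ lnN] by simp
          moreover have "?W ?L = poly (q \<sigma>) l" using p(2)[OF \<sigma> True] l True by (simp add: q_def)
          ultimately have "\<bar>?A ?L - poly (q \<sigma>) l\<bar> \<le> E" by simp
          also have "E \<le> E * exp (?w \<sigma> / 4)"
            using w0 mult_left_mono[of 1 "exp (?w \<sigma> / 4)" E] by (simp add: E_def)
          finally show ?thesis .
        next
          case False
          have "?A ?L \<le> (1 + 2 * real k) ^ R * orthant n ?L"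
            using iter_sum_op_le[OF faces Lb _ lnN] by (simp add: length_Ss)
          also have "\<dots> \<le> (1 + 2 * real k) ^ R" using o by (intro mult_left_le) auto
          also have "\<dots> \<le> (1 + 2 * real k) ^ R * (exp (- (\<epsilon> / 4) * real k) * exp (?w \<sigma> / 4))"
          proof -
            \<comment> \<open>Rankin's trick: the weight exceeds \<open>\<epsilon> * k\<close>, so
              the gain outweighs the loss.\<close>
            have "1 \<le> exp (- (\<epsilon> / 4) * real k) * exp (?w \<sigma> / 4)"
              using False by (simp add: exp_add[symmetric])
            thus ?thesis using mult_left_mono[of 1 _ "(1 + 2 * real k) ^ R"] by simp
          qed
          also have "\<dots> \<le> E * exp (?w \<sigma> / 4)"
            unfolding E_def by (simp add: mult_ac mult_left_mono)
          finally show ?thesis using Anonneg False by (simp add: q_def)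
        qed
      qed
      have t: "\<bar>?c \<sigma> * (?A (\<lambda>j. l - ?b \<sigma> j) - poly (q \<sigma>) l)\<bar> \<le> E * (\<bar>?c \<sigma>\<bar> * exp (?w \<sigma> / 4))" if "\<sigma> \<in> ?X" for \<sigma>
        using mult_left_mono[OF bnd[OF that], of "\<bar>?c \<sigma>\<bar>"] by (simp add: abs_mult mult_ac)
      have "exp l \<le> real N" using N l order_trans[of "exp l" "exp (2 * real k)"] by simp
      hence "U n (exp l) - poly Q l = (\<Sum>\<sigma>\<in>?X. ?c \<sigma> * (?A (\<lambda>j. l - ?b \<sigma> j) - poly (q \<sigma>) l))"
        by (simp add: U_exp Q_def poly_sum sum_subtractf right_diff_distrib P_def)
      hence "\<bar>U n (exp l) - poly Q l\<bar> \<le> (\<Sum>\<sigma>\<in>?X. E * (\<bar>?c \<sigma>\<bar> * exp (?w \<sigma> / 4)))"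
        using t by (simp only:) (intro order_trans[OF sum_abs] sum_mono, auto)
      also have "\<dots> \<le> E * Z"
        unfolding sum_distrib_left[symmetric] using Z(2)[of N] by (intro mult_left_mono) (auto simp: E_def P_def)
      also have "\<dots> = (real R + 1) * Z * ((2 * real k + 1) ^ R * exp (- (\<epsilon> / 4) * real k))"
        by (simp add: E_def mult_ac add.commute)
      also have "\<dots> \<le> (real R + 1) * Z * (A * exp (- (\<epsilon> / 4 / 2) * real k))"
        using Z(1) by (intro mult_left_mono A) auto
      finally show ?thesis by (simp add: C_def mult_ac)
    qed
    ultimately show ?thesis by blast
  qed
  have "0 \<le> C" using Z(1) A by (simp add: C_def)
  thus ?thesis using main eps by (intro exI[of _ "\<epsilon> / 8"] conjI exI[of _ C] exI[of _ k0] exI[of _ m]) auto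
qed

abbreviation "V \<equiv> iter_op n int_op Ss (\<lambda>_. 1)"

lemma power_diff_le:
  fixes x y :: real
  assumes "0 \<le> y" "y \<le> x"
  shows "x ^ k - y ^ k \<le> real k * (x - y) * x ^ (k - 1)"
proof (induction k)
  case (Suc k)
  have "x ^ Suc k - y ^ Suc k = x * (x ^ k - y ^ k) + (x - y) * y ^ k" by (simp add: algebra_simps)
  also have "\<dots> \<le> x * (real k * (x - y) * x ^ (k - 1)) + (x - y) * x ^ k"
    using assms Suc by (intro add_mono mult_left_mono power_mono) auto
  also have "\<dots> = real (Suc k) * (x - y) * x ^ (Suc k - 1)"
    by (cases k) (auto simp: algebra_simps)
  finally show ?case .
qed simp

text \<open>With \<open>D = 1\<close> all sums become integrals at the cost of
  \<open>(1 + L) ^ (R - 1)\<close>. Undoing the shifts costs the same order times the weight, which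
  the exponential of a quarter of the weight absorbs.\<close>

lemma U_leading:
  assumes L: "1 \<le> L"
  shows "\<bar>U n (exp L) - V * L ^ R * (\<Prod>p | prime p \<and> p \<le> nat \<lceil>exp L\<rceil>.
      mobius_factor n p)\<bar>
    \<le> (real R + 4 * real R * V) * Z * (1 + L) ^ (R - 1)"
proof -
  define N where "N = nat \<lceil>exp L\<rceil>"
  define P where "P = primes_upto N"
  let ?X = "face_maps n N"
  let ?c = "mobius_coeff P" and ?w = "face_weight P" and ?b = "face_shift P"
  let ?A = "iter_op n (sum_op N) Ss" and ?V = "iter_op n int_op Ss"
  have N: "exp L \<le> real N" unfolding N_def by linarith
  have lnN: "L < ln (real (Suc N))"
  proof -
    have "exp L < real (Suc N)" using N by simp
    thus ?thesis by (metis exp_gt_zero less_trans ln_exp ln_less_cancel_iff)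
  qed
  have Vm: "orthant_mono n ?V" using faces by (intro orthant_mono_iter_op orthant_mono_int_op) auto
  have V0: "0 \<le> V" by (rule orthant_mono_nonneg[OF Vm])
  have Vt: "?V (\<lambda>_. t) = t ^ R * V" if "0 < t" for t
    using iter_int_op_scale[OF that, of n Ss "\<lambda>_. 1"] by (simp add: length_Ss)
  have bnd: "\<bar>?A (\<lambda>j. L - ?b \<sigma> j) - V * L ^ R\<bar> \<le> (real R + 4 * real R * V) * (1 + L) ^ (R - 1) * exp (?w \<sigma> / 4)"
    if \<sigma>: "\<sigma> \<in> ?X" for \<sigma>
  proof -
    let ?L = "\<lambda>j. L - ?b \<sigma> j"
    have w0: "0 \<le> ?w \<sigma>" unfolding P_def by (rule face_weight_nonneg)
    have b: "0 \<le> ?b \<sigma> j" "?b \<sigma> j \<le> ?w \<sigma>" for j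
      using face_shift_bounds[OF \<sigma>] unfolding P_def by auto
    have Lb: "\<forall>j\<in>{1..n}. ?L j \<le> L" using b by simp
    have i: "iter_op n (mixed_op 1) Ss = ?V"
      using mixed_op_1 by (metis ext)
    have "?A ?L - ?V ?L \<le> real R * (1 + L) ^ (R - 1) * orthant n ?L" "?V ?L \<le> ?A ?L"
      using iter_sum_op_mixed_op[OF faces _ _ Lb _ lnN, of 1] L unfolding i by (simp_all add: length_Ss)
    moreover have "real R * (1 + L) ^ (R - 1) * orthant n ?L \<le> real R * (1 + L) ^ (R - 1)"
      using L by (intro mult_left_le) (auto simp: orthant_def)
    ultimately have 1: "\<bar>?A ?L - ?V ?L\<bar> \<le> real R * (1 + L) ^ (R - 1)" by simp
    have up: "?V ?L \<le> V * L ^ R"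
      using orthant_mono_mono[OF Vm, of ?L "\<lambda>_. L"] b L Vt[of L] by (simp add: mult.commute)
    \<comment> \<open>All coordinates lie between \<open>L - face_weight\<close> and
      \<open>L\<close>. The maximum with \<open>0\<close> covers weights beyond \<open>L\<close>,
      where zero is the lower bound.\<close>
    define y where "y = max 0 (L - ?w \<sigma>)"
    have low: "V * y ^ R \<le> ?V ?L"
    proof (cases "0 < L - ?w \<sigma>")
      case True
      have "?V (\<lambda>_. L - ?w \<sigma>) \<le> ?V ?L" using b by (intro orthant_mono_mono[OF Vm]) simp
      thus ?thesis using True Vt[OF True] by (simp add: y_def mult.commute)
    next
      case False
      hence "y = 0" by (simp add: y_def)
      moreover have "0 < R" using R_ge by linarith
      ultimately have "y ^ R = 0" by (simp only: zero_power)
      thus ?thesis using orthant_mono_nonneg[OF Vm] by (simp only: mult_zero_right)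
    qed
    have "L ^ R - y ^ R \<le> real R * (L - y) * L ^ (R - 1)"
      using w0 L by (intro power_diff_le) (auto simp: y_def)
    also have "\<dots> \<le> real R * ?w \<sigma> * (1 + L) ^ (R - 1)"
      using w0 L by (intro mult_mono power_mono mult_nonneg_nonneg mult_left_mono) (auto simp: y_def)
    finally have "V * (L ^ R - y ^ R) \<le> V * (real R * ?w \<sigma> * (1 + L) ^ (R - 1))"
      using V0 by (intro mult_left_mono)
    hence 2: "\<bar>?V ?L - V * L ^ R\<bar> \<le> V * (real R * ?w \<sigma> * (1 + L) ^ (R - 1))"
      using up low by (simp add: right_diff_distrib)
    have "\<bar>?A ?L - V * L ^ R\<bar> \<le> real R * (1 + L) ^ (R - 1) + V * (real R * ?w \<sigma> * (1 + L) ^ (R - 1))"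
      using 1 2 by linarith
    also have "\<dots> = real R * (1 + L) ^ (R - 1) * 1 + V * real R * (1 + L) ^ (R - 1) * ?w \<sigma>"
      by (simp add: mult_ac)
    also have "\<dots> \<le> real R * (1 + L) ^ (R - 1) * exp (?w \<sigma> / 4) + V * real R * (1 + L) ^ (R - 1) * (4 * exp (?w \<sigma> / 4))"
    proof -
      have "1 \<le> exp (?w \<sigma> / 4)" using w0 by simp
      moreover have "?w \<sigma> \<le> 4 * exp (?w \<sigma> / 4)" using exp_ge_add_one_self[of "?w \<sigma> / 4"] by linarith
      ultimately show ?thesis using V0 L by (intro add_mono mult_left_mono) auto
    qed
    also have "\<dots> = (real R + 4 * real R * V) * (1 + L) ^ (R - 1) * exp (?w \<sigma> / 4)"
      by (simp add: algebra_simps)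
    finally show ?thesis .
  qed
  have *: "(\<Prod>p | prime p \<and> p \<le> N. mobius_factor n p) = (\<Sum>\<sigma>\<in>?X. ?c \<sigma>)"
    unfolding mobius_coeff_def face_maps_def P_def
    by (subst prod_sum_PiE[symmetric]) (auto simp: primes_upto_def[symmetric])
  have "U n (exp L) - V * L ^ R * (\<Prod>p | prime p \<and> p \<le> N. mobius_factor n p)
    = (\<Sum>\<sigma>\<in>?X. ?c \<sigma> * (?A (\<lambda>j. L - ?b \<sigma> j) - V * L ^ R))"
  proof -
    have "(\<Sum>\<sigma>\<in>?X. ?c \<sigma> * (V * L ^ R)) = V * L ^ R * sum ?c ?X"
      unfolding sum_distrib_left by (intro sum.cong) (auto simp: mult_ac)
    with * show ?thesis by (simp add: U_exp[OF N] right_diff_distrib sum_subtractf P_def)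
  qed
  hence "\<bar>U n (exp L) - V * L ^ R * (\<Prod>p | prime p \<and> p \<le> N. mobius_factor n p)\<bar>
    \<le> (\<Sum>\<sigma>\<in>?X. \<bar>?c \<sigma> * (?A (\<lambda>j. L - ?b \<sigma> j) - V * L ^ R)\<bar>)"
    by (simp only: sum_abs)
  also have "\<dots> \<le> (\<Sum>\<sigma>\<in>?X. (real R + 4 * real R * V) * (1 + L) ^ (R - 1) * (\<bar>?c \<sigma>\<bar> * exp (?w \<sigma> / 4)))"
  proof (rule sum_mono)
    fix \<sigma> assume "\<sigma> \<in> ?X"
    from mult_left_mono[OF bnd[OF this], of "\<bar>?c \<sigma>\<bar>"]
    show "\<bar>?c \<sigma> * (?A (\<lambda>j. L - ?b \<sigma> j) - V * L ^ R)\<bar> \<le>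
      (real R + 4 * real R * V) * (1 + L) ^ (R - 1) * (\<bar>?c \<sigma>\<bar> * exp (?w \<sigma> / 4))"
      by (simp add: abs_mult mult_ac)
  qed
  also have "\<dots> \<le> (real R + 4 * real R * V) * (1 + L) ^ (R - 1) * Z"
    unfolding sum_distrib_left[symmetric] P_def using Z(2)[of N] V0 L by (intro mult_left_mono) auto
  finally show ?thesis unfolding N_def by (simp add: mult_ac)
qed

lemma U_over_power_tendsto: "((\<lambda>L. U n (exp L) / L ^ R) \<longlongrightarrow> C_const n * V) at_top"
proof -
  let ?E = "\<lambda>L::real. \<Prod>p | prime p \<and> p \<le> nat \<lceil>exp L\<rceil>. mobius_factor n p"
  define B where "B = (real R + 4 * real R * V) * Z"
  have "filterlim (\<lambda>L::real. nat \<lceil>exp L\<rceil>) sequentially at_top"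
    unfolding filterlim_at_top
  proof
    fix M :: nat
    show "\<forall>\<^sub>F L::real in at_top. M \<le> nat \<lceil>exp L\<rceil>"
      using eventually_ge_at_top[of "real M"]
    proof eventually_elim
      case (elim L)
      have "real M \<le> exp L" using elim exp_ge_add_one_self[of L] by linarith
      thus ?case by linarith
    qed
  qed
  note lim = this
  have "1 \<le> n" using n by simp
  from filterlim_compose[OF euler_product_tendsto[OF this] lim]
  have E: "(?E \<longlongrightarrow> C_const n) at_top" .
  have "((\<lambda>L. U n (exp L) / L ^ R - V * ?E L) \<longlongrightarrow> 0) at_top"
  proof (rule Lim_null_comparison)
    show "\<forall>\<^sub>F L in at_top. norm (U n (exp L) / L ^ R - V * ?E L) \<le> B * 2 ^ (R - 1) / L"
      using eventually_ge_at_top[of 1]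
    proof eventually_elim
      case (elim L)
      have "U n (exp L) / L ^ R - V * ?E L = (U n (exp L) - V * L ^ R * ?E L) / L ^ R"
        using elim by (simp add: field_simps)
      hence "norm (U n (exp L) / L ^ R - V * ?E L) = \<bar>U n (exp L) - V * L ^ R * ?E L\<bar> / L ^ R"
        using elim by simp
      also have "\<dots> \<le> B * (1 + L) ^ (R - 1) / L ^ R"
        unfolding B_def using U_leading[OF elim] elim by (intro divide_right_mono) auto
      also have "\<dots> \<le> B * (2 * L) ^ (R - 1) / L ^ R"
      proof -
        have "0 \<le> B" using Z(1) iter_int_op_pos[OF faces] by (simp add: B_def)
        thus ?thesis using elim by (intro divide_right_mono mult_left_mono power_mono) auto
      qed
      also have "\<dots> = B * 2 ^ (R - 1) / L"
      proof -
        have "L ^ R = L * L ^ (R - 1)" using R_ge by (metis Suc_diff_1 not_gr_zero not_numeral_le_zero power_Suc)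
        thus ?thesis using elim by (simp add: power_mult_distrib)
      qed
      finally show ?case .
    qed
    show "((\<lambda>L. B * 2 ^ (R - 1) / L) \<longlongrightarrow> 0) at_top"
      by (intro tendsto_divide_0[OF tendsto_const] filterlim_at_top_imp_at_infinity filterlim_ident)
  qed
  from tendsto_add[OF this tendsto_mult[OF tendsto_const[of V] E]]
  show ?thesis by (simp add: mult.commute)
qed

end

text \<open>Infinite sum, infinite product and limit are total functions in the definitions, so the
  conclusion also asserts summability, convergence of the product and convergence to
  \<open>K_const n\<close>.\<close>

theorem corollary3:
  fixes n :: nat
  assumes "n \<ge> 2"
  shows "(\<exists>(Q3 :: real poly) (\<mu>3 :: real). degree Q3 = 2 ^ n - 2 \<and> \<mu>3 > 0 \<and>
            (\<lambda>x::real. U n x - poly Q3 (ln x)) \<in> O[at_top](\<lambda>x. x powr (- \<mu>3))) \<and>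
         (\<lambda>x::real. U n x - C_const n * K_const n * ln x ^ (2 ^ n - 2))
            \<in> O[at_top](\<lambda>x. ln x ^ (2 ^ n - 3)) \<and>
         (\<forall>p. prime p \<longrightarrow> summable (local_term n p)) \<and>
         convergent_prod (euler_factor n) \<and> C_const n > 0 \<and>
         (K_quot n \<longlongrightarrow> K_const n) at_top \<and> K_const n > 0"
proof -
  have n1: "1 \<le> n" using assms by simp
  have "finite (int_vars (cube_I n) (\<lambda>_. 1))"
    using bij_betw_finite[OF pair_face_bij[OF n1]] by simp
  then obtain vs where vs: "set vs = int_vars (cube_I n) (\<lambda>_. 1)" "distinct vs"
    using finite_distinct_list by blast
  \<comment> \<open>The faces are listed in the order of the integration variables, so the two
    iterated integrals agree without any exchange of the order of integration.\<close>
  define Ss where "Ss = map (pair_face n) vs"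
  interpret face_list n Ss
    by standard (use assms vs pair_face_bij[OF n1] in \<open>auto simp: Ss_def distinct_map bij_betw_def\<close>)
  have "\<forall>\<^sub>F x in at_top. K_quot n x = V"
    using eventually_gt_at_top[of 1]
    by eventually_elim (use K_quot_eq[OF n1 vs(2,1)] length_Ss in \<open>simp add: Ss_def\<close>)
  hence K: "(K_quot n \<longlongrightarrow> V) at_top" by (rule tendsto_eventually)
  hence KV: "K_const n = V" unfolding K_const_def by (intro tendsto_Lim) auto
  have V: "0 < V" by (rule iter_int_op_pos[OF faces])
  have C: "0 < C_const n" by (rule C_const_pos[OF n1])
  from U_local_poly obtain \<mu> B k0 m where \<mu>: "0 < \<mu>" and B: "0 \<le> B" and
    loc: "\<And>k. k \<ge> k0 \<Longrightarrow> \<exists>p. degree p \<le> m \<and> (\<forall>l\<in>{real k..2 * real k}. \<bar>U n (exp l) - poly p l\<bar> \<le> B * exp (- \<mu> * real k))"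
    by blast
  from local_poly_approx_imp_global[OF \<mu> B loc] obtain Q B' where
    Q: "\<forall>\<^sub>F l in at_top. \<bar>U n (exp l) - poly Q l\<bar> \<le> B' * exp (- (\<mu> / 2) * l)" by blast
  have "((\<lambda>l. U n (exp l) / l ^ R - poly Q l / l ^ R) \<longlongrightarrow> 0) at_top"
  proof (rule Lim_null_comparison)
    show "\<forall>\<^sub>F l in at_top. norm (U n (exp l) / l ^ R - poly Q l / l ^ R) \<le> B' * exp (- (\<mu> / 2) * l)"
      using Q eventually_ge_at_top[of 1]
    proof eventually_elim
      case (elim l)
      have "norm (U n (exp l) / l ^ R - poly Q l / l ^ R) = \<bar>U n (exp l) - poly Q l\<bar> / l ^ R"
        using elim by (simp add: diff_divide_distrib[symmetric])
      also have "\<dots> \<le> \<bar>U n (exp l) - poly Q l\<bar> / 1"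
        using elim by (intro divide_left_mono) auto
      finally show ?case using elim by simp
    qed
    have "filterlim (\<lambda>l::real. \<mu> / 2 * l) at_top at_top"
      using \<mu> by (intro filterlim_tendsto_pos_mult_at_top[OF tendsto_const] filterlim_ident) auto
    hence "((\<lambda>l::real. exp (- (\<mu> / 2) * l)) \<longlongrightarrow> 0) at_top"
      by (intro filterlim_compose[OF exp_at_bot]) (simp add: filterlim_uminus_at_bot)
    from tendsto_mult[OF tendsto_const[of B'] this]
    show "((\<lambda>l::real. B' * exp (- (\<mu> / 2) * l)) \<longlongrightarrow> 0) at_top" by simp
  qed
  \<comment> \<open>The glued polynomial comes with no information on its degree. The limit, nonzero
    because both constants are positive, determines degree and leading coefficient at once.\<close>
  from tendsto_diff[OF U_over_power_tendsto this]
  have "((\<lambda>l. poly Q l / l ^ R) \<longlongrightarrow> C_const n * V) at_top" by simp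
  note deg = poly_over_power_tendsto[OF this]
  have dQ: "degree Q = R" and lQ: "lead_coeff Q = C_const n * V"
    using deg C V by auto
  have 1: "(\<lambda>x. U n x - poly Q (ln x)) \<in> O[at_top](\<lambda>x. x powr (- (\<mu> / 2)))"
  proof (rule bigoI)
    have "\<forall>\<^sub>F x in at_top. \<bar>U n (exp (ln x)) - poly Q (ln x)\<bar> \<le> B' * exp (- (\<mu> / 2) * ln x)"
      using filterlim_iff[THEN iffD1, OF ln_at_top] Q by blast
    thus "\<forall>\<^sub>F x in at_top. norm (U n x - poly Q (ln x)) \<le> B' * norm (x powr (- (\<mu> / 2)))"
      using eventually_gt_at_top[of 0] by eventually_elim (simp add: powr_def)
  qed
  have 2: "(\<lambda>x. U n x - C_const n * V * ln x ^ R) \<in> O[at_top](\<lambda>x. ln x ^ (R - 1))"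
  proof -
    \<comment> \<open>Only the lower-order part of \<open>Q\<close> remains once the leading term is
      removed, and powers of \<open>x\<close> with negative exponent are absorbed by powers of
      \<open>ln x\<close>.\<close>
    define q where "q = Q - monom (lead_coeff Q) R"
    have "degree q \<le> R - 1"
    proof (rule degree_le, intro allI impI)
      fix i assume "R - 1 < i"
      thus "coeff q i = 0" using dQ R_ge by (cases "i = R") (auto simp: q_def coeff_eq_0)
    qed
    hence q: "(\<lambda>x. poly q (ln x)) \<in> O[at_top](\<lambda>x. ln x ^ (R - 1))"
      by (intro landau_o.big.compose[OF poly_bigo_power ln_at_top])
    have p: "(\<lambda>x. x powr (- (\<mu> / 2))) \<in> O[at_top](\<lambda>x. ln x ^ (R - 1))"
    proof (rule bigoI[of _ 1])
      show "\<forall>\<^sub>F x in at_top. norm (x powr (- (\<mu> / 2))) \<le> 1 * norm (ln x ^ (R - 1))"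
        using eventually_ge_at_top[of "exp 1"]
      proof eventually_elim
        case (elim x)
        have x: "1 \<le> x" using elim exp_ge_add_one_self[of 1] by linarith
        have "1 \<le> ln x" using elim x ln_mono[of "exp 1" x] by simp
        hence "1 \<le> ln x ^ (R - 1)" by (rule one_le_power)
        moreover have "x powr (- (\<mu> / 2)) \<le> x powr 0" using x \<mu> by (intro powr_mono) auto
        ultimately show ?case using x by simp
      qed
    qed
    have "(\<lambda>x. (U n x - poly Q (ln x)) + poly q (ln x)) \<in> O[at_top](\<lambda>x. ln x ^ (R - 1))"
      by (rule sum_in_bigo(1)[OF landau_o.big_trans[OF 1 p] q])
    thus ?thesis by (simp add: q_def poly_monom lQ)
  qed
  have "2 ^ n - 3 = R - 1" by simp
  thus ?thesis
    using 1 2 dQ \<mu> K C V summable_local_term[of _ n] convergent_prod_euler_factor[OF n1]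
    unfolding KV by (intro conjI exI[of _ Q] exI[of _ "\<mu> / 2"]) auto
qed

end
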